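(* Let $N$ and $K$ be nontrivial groups. The wreath product $N\wr K$ is $C^*$-simple (resp. has the unique trace property) if and only if $N$ is $C^*$-simple (resp. has the unique trace property).
   Context: Groups are discrete. The wreath product $N\wr K$ is the semidirect product $(\bigoplus_K N)\rtimes K$, where $K$ acts by translation on the index set: $k\cdot(x_j)_{j\in K}=(x_{k^{-1}j})_{j\in K}$. A group $G$ is $C^*$-simple if its reduced group C$^*$-algebra $C_r^*(G)$ (generated by the left regular representation on $\ell^2(G)$) is simple, and has the unique trace property if $C_r^*(G)$ has a unique tracial state. *)

theory Defs
  imports "HOL-Analysis.Analysis" "HOL-Algebra.Product_Groups"
begin

section \<open>Wreath products\<close>

definition semidirect_product ::
    "('a, 'c) monoid_scheme \<Rightarrow> ('b, 'd) monoid_scheme \<Rightarrow> ('b \<Rightarrow> 'a \<Rightarrow> 'a) \<Rightarrow> ('a \<times> 'b) monoid"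
  where
  "semidirect_product N K \<alpha> =
     \<lparr>carrier = carrier N \<times> carrier K,
      monoid.mult = (\<lambda>(x, k) (y, l). (x \<otimes>\<^bsub>N\<^esub> \<alpha> k y, k \<otimes>\<^bsub>K\<^esub> l)),
      one = (\<one>\<^bsub>N\<^esub>, \<one>\<^bsub>K\<^esub>)\<rparr>"

definition shift :: "('b, 'd) monoid_scheme \<Rightarrow> 'b \<Rightarrow> ('b \<Rightarrow> 'a) \<Rightarrow> 'b \<Rightarrow> 'a" where
  "shift K k x = (\<lambda>j\<in>carrier K. x (inv\<^bsub>K\<^esub> k \<otimes>\<^bsub>K\<^esub> j))"

definition wreath_product ::
    "('a, 'c) monoid_scheme \<Rightarrow> ('b, 'd) monoid_scheme \<Rightarrow> (('b \<Rightarrow> 'a) \<times> 'b) monoid"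
    (infixr \<open>\<wr>\<close> 75)
  where
  "N \<wr> K = semidirect_product (sum_group (carrier K) (\<lambda>_. N)) K (shift K)"

lemma group_semidirect_product:
  assumes "group N" "group K"
    and closed: "\<And>k x. k \<in> carrier K \<Longrightarrow> x \<in> carrier N \<Longrightarrow> \<alpha> k x \<in> carrier N"
    and mult: "\<And>k x y. k \<in> carrier K \<Longrightarrow> x \<in> carrier N \<Longrightarrow> y \<in> carrier N \<Longrightarrow>
      \<alpha> k (x \<otimes>\<^bsub>N\<^esub> y) = \<alpha> k x \<otimes>\<^bsub>N\<^esub> \<alpha> k y"
    and one: "\<And>x. x \<in> carrier N \<Longrightarrow> \<alpha> \<one>\<^bsub>K\<^esub> x = x"
    and comp: "\<And>k l x. k \<in> carrier K \<Longrightarrow> l \<in> carrier K \<Longrightarrow> x \<in> carrier N \<Longrightarrow>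
      \<alpha> (k \<otimes>\<^bsub>K\<^esub> l) x = \<alpha> k (\<alpha> l x)"
  shows "group (semidirect_product N K \<alpha>)"
proof -
  interpret N: group N by fact
  interpret K: group K by fact
  show ?thesis
  proof (rule groupI)
    fix p assume "p \<in> carrier (semidirect_product N K \<alpha>)"
    then obtain x k where p: "p = (x, k)" "x \<in> carrier N" "k \<in> carrier K"
      by (auto simp: semidirect_product_def)
    let ?q = "(\<alpha> (inv\<^bsub>K\<^esub> k) (inv\<^bsub>N\<^esub> x), inv\<^bsub>K\<^esub> k)"
    have "\<alpha> (inv\<^bsub>K\<^esub> k) (inv\<^bsub>N\<^esub> x) \<otimes>\<^bsub>N\<^esub> \<alpha> (inv\<^bsub>K\<^esub> k) x = \<alpha> (inv\<^bsub>K\<^esub> k) \<one>\<^bsub>N\<^esub>"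
      using p by (simp flip: mult)
    also have "\<dots> = \<one>\<^bsub>N\<^esub>"
      using mult[of "inv\<^bsub>K\<^esub> k" "\<one>\<^bsub>N\<^esub>" "\<one>\<^bsub>N\<^esub>"] p closed[of "inv\<^bsub>K\<^esub> k" "\<one>\<^bsub>N\<^esub>"]
      by (metis K.inv_closed N.l_cancel_one N.one_closed N.r_one)
    finally show "\<exists>q\<in>carrier (semidirect_product N K \<alpha>).
        q \<otimes>\<^bsub>semidirect_product N K \<alpha>\<^esub> p = \<one>\<^bsub>semidirect_product N K \<alpha>\<^esub>"
      using p closed by (intro bexI[of _ ?q]) (auto simp: semidirect_product_def)
  qed (auto simp: semidirect_product_def closed mult one comp N.m_assoc K.m_assoc)
qed

lemma group_wreath_product:
  fixes N :: "('a, 'c) monoid_scheme" and K :: "('b, 'd) monoid_scheme"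
  assumes "group N" "group K"
  shows "group (N \<wr> K)"
proof -
  interpret N: group N by fact
  interpret K: group K by fact
  have fin: "finite {j \<in> carrier K. x (inv\<^bsub>K\<^esub> k \<otimes>\<^bsub>K\<^esub> j) \<noteq> \<one>\<^bsub>N\<^esub>}"
    if k: "k \<in> carrier K" and f: "finite {j \<in> carrier K. x j \<noteq> \<one>\<^bsub>N\<^esub>}" for k and x :: "'b \<Rightarrow> 'a"
  proof (rule finite_subset[OF _ finite_imageI[OF f, of "\<lambda>j. k \<otimes>\<^bsub>K\<^esub> j"]], rule subsetI)
    fix j assume j: "j \<in> {j \<in> carrier K. x (inv\<^bsub>K\<^esub> k \<otimes>\<^bsub>K\<^esub> j) \<noteq> \<one>\<^bsub>N\<^esub>}"
    have "j = k \<otimes>\<^bsub>K\<^esub> (inv\<^bsub>K\<^esub> k \<otimes>\<^bsub>K\<^esub> j)"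
      using k j by (simp flip: K.m_assoc)
    then show "j \<in> (\<lambda>j. k \<otimes>\<^bsub>K\<^esub> j) ` {j \<in> carrier K. x j \<noteq> \<one>\<^bsub>N\<^esub>}"
      using k j by (intro image_eqI) auto
  qed
  show ?thesis
    unfolding wreath_product_def
  proof (rule group_semidirect_product)
    fix k and x :: "'b \<Rightarrow> 'a"
    assume "k \<in> carrier K" "x \<in> carrier (sum_group (carrier K) (\<lambda>_. N))"
    then show "shift K k x \<in> carrier (sum_group (carrier K) (\<lambda>_. N))"
      using fin[of k x] by (auto simp: carrier_sum_group shift_def PiE_iff cong: conj_cong)
  qed (use assms in \<open>auto simp: carrier_sum_group shift_def PiE_iff extensional_def
        K.inv_mult_group K.m_assoc intro!: restrict_ext\<close>)
qed


section \<open>The Hilbert space of square-summable functions\<close>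

typedef 'a ell2 = "{f :: 'a \<Rightarrow> complex. (\<lambda>x. (cmod (f x))\<^sup>2) summable_on UNIV}"
  morphisms ell2_apply Abs_ell2
  by (intro exI[of _ "\<lambda>_. 0"]) simp

setup_lifting type_definition_ell2

lemma square_summable_scale:
  fixes f :: "'a \<Rightarrow> complex"
  assumes "(\<lambda>x. (cmod (f x))\<^sup>2) summable_on S"
  shows "(\<lambda>x. (cmod (c * f x))\<^sup>2) summable_on S"
  using summable_on_cmult_right[OF assms, of "(cmod c)\<^sup>2"]
  by (simp add: norm_mult power_mult_distrib)

lemma square_summable_add:
  fixes f g :: "'a \<Rightarrow> complex"
  assumes "(\<lambda>x. (cmod (f x))\<^sup>2) summable_on S" "(\<lambda>x. (cmod (g x))\<^sup>2) summable_on S"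
  shows "(\<lambda>x. (cmod (f x + g x))\<^sup>2) summable_on S"
proof (rule summable_on_comparison_test)
  show "(\<lambda>x. 2 * (cmod (f x))\<^sup>2 + 2 * (cmod (g x))\<^sup>2) summable_on S"
    by (intro summable_on_add summable_on_cmult_right assms)
  fix x
  have "(cmod (f x + g x))\<^sup>2 \<le> (cmod (f x) + cmod (g x))\<^sup>2"
    by (intro power_mono norm_triangle_ineq) auto
  also have "\<dots> \<le> 2 * (cmod (f x))\<^sup>2 + 2 * (cmod (g x))\<^sup>2"
    using zero_le_power2[of "cmod (f x) - cmod (g x)"] by (simp add: power2_eq_square algebra_simps)
  finally show "(cmod (f x + g x))\<^sup>2 \<le> 2 * (cmod (f x))\<^sup>2 + 2 * (cmod (g x))\<^sup>2" .
qed auto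

lemma square_summable_mult:
  fixes f g :: "'a \<Rightarrow> complex"
  assumes "(\<lambda>x. (cmod (f x))\<^sup>2) summable_on S" "(\<lambda>x. (cmod (g x))\<^sup>2) summable_on S"
  shows "(\<lambda>x. f x * cnj (g x)) summable_on S"
proof (rule abs_summable_summable, rule summable_on_comparison_test)
  show "(\<lambda>x. (cmod (f x))\<^sup>2 + (cmod (g x))\<^sup>2) summable_on S"
    by (intro summable_on_add assms)
  fix x
  have "cmod (f x * cnj (g x)) = cmod (f x) * cmod (g x)"
    by (simp add: norm_mult)
  also have "\<dots> \<le> (cmod (f x))\<^sup>2 + (cmod (g x))\<^sup>2"
    using zero_le_power2[of "cmod (f x) - cmod (g x)"]
    by (simp add: power2_eq_square algebra_simps)
       (smt (verit) mult_nonneg_nonneg norm_ge_zero)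
  finally show "cmod (f x * cnj (g x)) \<le> (cmod (f x))\<^sup>2 + (cmod (g x))\<^sup>2" .
qed auto

lift_definition cinner :: "'a ell2 \<Rightarrow> 'a ell2 \<Rightarrow> complex"
  is "\<lambda>f g. \<Sum>\<^sub>\<infinity>x. f x * cnj (g x)" .

lift_definition scaleC :: "complex \<Rightarrow> 'a ell2 \<Rightarrow> 'a ell2" (infixr \<open>*\<^sub>C\<close> 75)
  is "\<lambda>c f x. c * f x"
  by (rule square_summable_scale)

instantiation ell2 :: (type) real_vector
begin

lift_definition zero_ell2 :: "'a ell2" is "\<lambda>_. 0" by simp

lift_definition plus_ell2 :: "'a ell2 \<Rightarrow> 'a ell2 \<Rightarrow> 'a ell2" is "\<lambda>f g x. f x + g x"
  by (rule square_summable_add)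

lift_definition uminus_ell2 :: "'a ell2 \<Rightarrow> 'a ell2" is "\<lambda>f x. - f x" by simp

lift_definition minus_ell2 :: "'a ell2 \<Rightarrow> 'a ell2 \<Rightarrow> 'a ell2" is "\<lambda>f g x. f x - g x"
  using square_summable_add[of _ UNIV "\<lambda>x. - _ x"] by simp

definition scaleR_ell2 :: "real \<Rightarrow> 'a ell2 \<Rightarrow> 'a ell2" where
  "scaleR_ell2 r f = complex_of_real r *\<^sub>C f"

instance
proof
  fix f g h :: "'a ell2" and r s :: real
  show "f + g + h = f + (g + h)" by transfer (simp add: add.assoc)
  show "f + g = g + f" by transfer (simp add: add.commute)
  show "0 + f = f" by transfer simp
  show "- f + f = 0" by transfer simp
  show "f - g = f + - g" by transfer simp
  show "r *\<^sub>R (f + g) = r *\<^sub>R f + r *\<^sub>R g"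
    unfolding scaleR_ell2_def by transfer (simp add: algebra_simps)
  show "(r + s) *\<^sub>R f = r *\<^sub>R f + s *\<^sub>R f"
    unfolding scaleR_ell2_def by transfer (simp add: algebra_simps)
  show "r *\<^sub>R s *\<^sub>R f = (r * s) *\<^sub>R f"
    unfolding scaleR_ell2_def by transfer (simp add: algebra_simps)
  show "1 *\<^sub>R f = f"
    unfolding scaleR_ell2_def by transfer simp
qed

end

lemma cinner_commute: "cinner g f = cnj (cinner f g)"
  by transfer (simp add: mult.commute flip: infsum_cnj)

lemma cinner_add_left: "cinner (f + g) h = cinner f h + cinner g h"
  by transfer (simp add: distrib_right infsum_add square_summable_mult)

lemma cinner_scaleC_left: "cinner (c *\<^sub>C f) g = c * cinner f g"
  by transfer (simp add: mult.assoc infsum_cmult_right')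

lemma cinner_self: "cinner f f = complex_of_real (\<Sum>\<^sub>\<infinity>x. (cmod (ell2_apply f x))\<^sup>2)"
proof -
  have "((\<lambda>x. (cmod (ell2_apply f x))\<^sup>2) has_sum (\<Sum>\<^sub>\<infinity>x. (cmod (ell2_apply f x))\<^sup>2)) UNIV"
    using ell2_apply[of f] by simp
  then have "((\<lambda>x. complex_of_real ((cmod (ell2_apply f x))\<^sup>2))
      has_sum complex_of_real (\<Sum>\<^sub>\<infinity>x. (cmod (ell2_apply f x))\<^sup>2)) UNIV"
    by (rule has_sum_of_real)
  then show ?thesis
    unfolding cinner.rep_eq complex_norm_square by (rule infsumI)
qed

instantiation ell2 :: (type) real_inner
begin

definition inner_ell2 :: "'a ell2 \<Rightarrow> 'a ell2 \<Rightarrow> real" where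
  "inner_ell2 f g = Re (cinner f g)"

definition norm_ell2 :: "'a ell2 \<Rightarrow> real" where
  "norm_ell2 f = sqrt (f \<bullet> f)"

definition sgn_ell2 :: "'a ell2 \<Rightarrow> 'a ell2" where
  "sgn_ell2 f = scaleR (inverse (norm f)) f"

definition dist_ell2 :: "'a ell2 \<Rightarrow> 'a ell2 \<Rightarrow> real" where
  "dist_ell2 f g = norm (f - g)"

definition uniformity_ell2 :: "('a ell2 \<times> 'a ell2) filter" where
  "uniformity_ell2 = (INF e\<in>{0<..}. principal {(f, g). dist f g < e})"

definition open_ell2 :: "'a ell2 set \<Rightarrow> bool" where
  "open_ell2 U \<longleftrightarrow> (\<forall>f\<in>U. \<forall>\<^sub>F (f', g) in uniformity. f' = f \<longrightarrow> g \<in> U)"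

instance
proof
  fix f g h :: "'a ell2" and r :: real
  show "sgn f = f /\<^sub>R norm f" by (rule sgn_ell2_def)
  show "dist f g = norm (f - g)" by (rule dist_ell2_def)
  show "uniformity = (INF e\<in>{0<..}. principal {(f, g :: 'a ell2). dist f g < e})"
    by (rule uniformity_ell2_def)
  show "open U \<longleftrightarrow> (\<forall>f\<in>U. \<forall>\<^sub>F (f', g) in uniformity. f' = f \<longrightarrow> g \<in> U)" for U :: "'a ell2 set"
    by (rule open_ell2_def)
  show "f \<bullet> g = g \<bullet> f"
    unfolding inner_ell2_def by (subst cinner_commute) simp
  show "(f + g) \<bullet> h = f \<bullet> h + g \<bullet> h"
    by (simp add: inner_ell2_def cinner_add_left)
  show "(r *\<^sub>R f) \<bullet> g = r * (f \<bullet> g)"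
    by (simp add: inner_ell2_def scaleR_ell2_def cinner_scaleC_left)
  have sq: "f \<bullet> f = (\<Sum>\<^sub>\<infinity>x. (cmod (ell2_apply f x))\<^sup>2)"
    by (simp add: inner_ell2_def cinner_self)
  show "0 \<le> f \<bullet> f" unfolding sq by (intro infsum_nonneg) simp
  show "f \<bullet> f = 0 \<longleftrightarrow> f = 0"
  proof
    assume "f \<bullet> f = 0"
    then have "(cmod (ell2_apply f x))\<^sup>2 = 0" for x
      unfolding sq using ell2_apply[of f] nonneg_infsum_le_0D[of "\<lambda>x. (cmod (ell2_apply f x))\<^sup>2" UNIV x]
      by simp
    then show "f = 0"
      by (simp add: zero_ell2.rep_eq fun_eq_iff flip: ell2_apply_inject)
  next
    assume "f = 0"
    then show "f \<bullet> f = 0" unfolding sq by (simp add: zero_ell2.rep_eq)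
  qed
  show "norm f = sqrt (f \<bullet> f)" by (rule norm_ell2_def)
qed

end

lemma norm_ell2_square: "(norm f)\<^sup>2 = (\<Sum>\<^sub>\<infinity>x. (cmod (ell2_apply f x))\<^sup>2)"
  unfolding power2_norm_eq_inner inner_ell2_def cinner_self by simp

lemma norm_scaleC: "norm (c *\<^sub>C f) = cmod c * norm f"
proof -
  have "(norm (c *\<^sub>C f))\<^sup>2 = (cmod c * norm f)\<^sup>2"
    by (simp add: norm_ell2_square scaleC.rep_eq norm_mult power_mult_distrib infsum_cmult_right')
  then show ?thesis by (simp add: power2_eq_iff_nonneg)
qed


section \<open>Operators and C*-algebras of operators\<close>

text \<open>Bounded operators are the library's \<^typ>\<open>'a ell2 \<Rightarrow>\<^sub>L 'a ell2\<close>, which are only real-linear;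
  complex linearity is imposed by \<open>complex_linear\<close> in \<open>cstar_subalgebra\<close>.\<close>

type_synonym 'a operator = "'a ell2 \<Rightarrow>\<^sub>L 'a ell2"

definition complex_linear :: "'a operator \<Rightarrow> bool" where
  "complex_linear T \<longleftrightarrow> (\<forall>c f. T (c *\<^sub>C f) = c *\<^sub>C T f)"

lift_definition scalar_op :: "complex \<Rightarrow> 'a operator" is "\<lambda>c f. c *\<^sub>C f"
proof (rule bounded_linear_intro)
  fix c :: complex and f g :: "'a ell2" and r :: real
  show "c *\<^sub>C (f + g) = c *\<^sub>C f + c *\<^sub>C g" by transfer (simp add: algebra_simps)
  show "c *\<^sub>C (r *\<^sub>R f) = r *\<^sub>R (c *\<^sub>C f)"
    unfolding scaleR_ell2_def by transfer (simp add: algebra_simps)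
  show "norm (c *\<^sub>C f) \<le> norm f * cmod c" by (simp add: norm_scaleC)
qed

definition is_adjoint :: "'a operator \<Rightarrow> 'a operator \<Rightarrow> bool" where
  "is_adjoint S T \<longleftrightarrow> (\<forall>f g. cinner (T f) g = cinner f (S g))"

definition cstar_subalgebra :: "'a operator set \<Rightarrow> bool" where
  "cstar_subalgebra A \<longleftrightarrow>
     (\<forall>T\<in>A. complex_linear T) \<and>
     0 \<in> A \<and>
     (\<forall>S\<in>A. \<forall>T\<in>A. S + T \<in> A) \<and>
     (\<forall>c. \<forall>T\<in>A. scalar_op c o\<^sub>L T \<in> A) \<and>
     (\<forall>S\<in>A. \<forall>T\<in>A. S o\<^sub>L T \<in> A) \<and>
     (\<forall>T\<in>A. \<exists>S\<in>A. is_adjoint S T) \<and>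
     closed A"

definition closed_ideal :: "'a operator set \<Rightarrow> 'a operator set \<Rightarrow> bool" where
  "closed_ideal I A \<longleftrightarrow>
     I \<subseteq> A \<and>
     0 \<in> I \<and>
     (\<forall>S\<in>I. \<forall>T\<in>I. S + T \<in> I) \<and>
     (\<forall>c. \<forall>T\<in>I. scalar_op c o\<^sub>L T \<in> I) \<and>
     (\<forall>S\<in>A. \<forall>T\<in>I. S o\<^sub>L T \<in> I \<and> T o\<^sub>L S \<in> I) \<and>
     closed I"

definition simple_cstar_algebra :: "'a operator set \<Rightarrow> bool" where
  "simple_cstar_algebra A \<longleftrightarrow> A \<noteq> {0} \<and> (\<forall>I. closed_ideal I A \<longrightarrow> I = {0} \<or> I = A)"

text \<open>Here \<open>E\<close> is the unit of the C*-algebra \<open>A\<close>.\<close>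

definition tracial_state :: "'a operator set \<Rightarrow> 'a operator \<Rightarrow> ('a operator \<Rightarrow> complex) \<Rightarrow> bool" where
  "tracial_state A E \<tau> \<longleftrightarrow>
     (\<forall>S\<in>A. \<forall>T\<in>A. \<tau> (S + T) = \<tau> S + \<tau> T) \<and>
     (\<forall>c. \<forall>T\<in>A. \<tau> (scalar_op c o\<^sub>L T) = c * \<tau> T) \<and>
     (\<forall>S\<in>A. \<forall>T\<in>A. is_adjoint S T \<longrightarrow> \<tau> (S o\<^sub>L T) \<in> \<real>\<^sub>\<ge>\<^sub>0) \<and>
     \<tau> E = 1 \<and>
     (\<forall>S\<in>A. \<forall>T\<in>A. \<tau> (S o\<^sub>L T) = \<tau> (T o\<^sub>L S))"


section \<open>Reduced group C*-algebras\<close>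

text \<open>The Hilbert space of a group \<open>G\<close> is the subspace of \<^typ>\<open>'a ell2\<close> of functions vanishing
  outside \<^term>\<open>carrier G\<close>. An operator on that subspace is extended by \<open>0\<close> on its orthogonal
  complement, which identifies the operators on it isometrically with a corner of those on
  \<^typ>\<open>'a ell2\<close>. The unit of the reduced C*-algebra is therefore the projection
  \<open>left_regular G \<one>\<close> rather than the identity of \<^typ>\<open>'a ell2\<close>.\<close>

definition left_regular :: "('a, 'c) monoid_scheme \<Rightarrow> 'a \<Rightarrow> 'a operator" where
  "left_regular G g = Blinfun (\<lambda>f. Abs_ell2 (\<lambda>x.
     if x \<in> carrier G then ell2_apply f (inv\<^bsub>G\<^esub> g \<otimes>\<^bsub>G\<^esub> x) else 0))"

lemma left_regular_apply:
  assumes "group G" "g \<in> carrier G"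
  shows "ell2_apply (left_regular G g f) x =
    (if x \<in> carrier G then ell2_apply f (inv\<^bsub>G\<^esub> g \<otimes>\<^bsub>G\<^esub> x) else 0)"
proof -
  interpret group G by fact
  define L where "L f x = (if x \<in> carrier G then ell2_apply f (inv\<^bsub>G\<^esub> g \<otimes>\<^bsub>G\<^esub> x) else 0)" for f x
  have bij: "bij_betw (\<lambda>x. inv\<^bsub>G\<^esub> g \<otimes>\<^bsub>G\<^esub> x) (carrier G) (carrier G)"
    using assms(2)
    by (intro bij_betwI[of _ _ _ "\<lambda>x. g \<otimes>\<^bsub>G\<^esub> x"]) (auto simp flip: m_assoc)
  have sq: "(\<lambda>x. (cmod (ell2_apply f x))\<^sup>2) summable_on S" for f :: "'a ell2" and S
    using ell2_apply[of f] summable_on_subset_banach[of _ UNIV S] by auto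
  have sumL: "(\<lambda>x. (cmod (L f x))\<^sup>2) summable_on UNIV" for f
  proof -
    have "(\<lambda>x. (cmod (ell2_apply f (inv\<^bsub>G\<^esub> g \<otimes>\<^bsub>G\<^esub> x)))\<^sup>2) summable_on carrier G"
      using summable_on_reindex_bij_betw[OF bij, of "\<lambda>x. (cmod (ell2_apply f x))\<^sup>2"] sq by simp
    then show ?thesis
      by (subst summable_on_cong_neutral[where T = "carrier G"
            and g = "\<lambda>x. (cmod (ell2_apply f (inv\<^bsub>G\<^esub> g \<otimes>\<^bsub>G\<^esub> x)))\<^sup>2"]) (auto simp: L_def)
  qed
  have ap: "ell2_apply (Abs_ell2 (L f)) = L f" for f
    using sumL by (simp add: Abs_ell2_inverse)
  have "bounded_linear (\<lambda>f. Abs_ell2 (L f))"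
  proof (rule bounded_linear_intro)
    fix f h :: "'a ell2" and r :: real
    show "Abs_ell2 (L (f + h)) = Abs_ell2 (L f) + Abs_ell2 (L h)"
      by (simp add: ap plus_ell2.rep_eq fun_eq_iff flip: ell2_apply_inject)
         (simp add: L_def plus_ell2.rep_eq)
    show "Abs_ell2 (L (r *\<^sub>R f)) = r *\<^sub>R Abs_ell2 (L f)"
      by (simp add: ap scaleR_ell2_def scaleC.rep_eq fun_eq_iff flip: ell2_apply_inject)
         (simp add: L_def scaleC.rep_eq)
    have "(norm (Abs_ell2 (L f)))\<^sup>2 = (\<Sum>\<^sub>\<infinity>x. (cmod (L f x))\<^sup>2)"
      by (simp add: norm_ell2_square ap)
    also have "\<dots> = (\<Sum>\<^sub>\<infinity>x\<in>carrier G. (cmod (ell2_apply f (inv\<^bsub>G\<^esub> g \<otimes>\<^bsub>G\<^esub> x)))\<^sup>2)"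
      by (intro infsum_cong_neutral) (auto simp: L_def)
    also have "\<dots> = (\<Sum>\<^sub>\<infinity>x\<in>carrier G. (cmod (ell2_apply f x))\<^sup>2)"
      by (rule infsum_reindex_bij_betw[OF bij])
    also have "\<dots> \<le> (norm f)\<^sup>2"
      unfolding norm_ell2_square by (intro infsum_mono2 sq) auto
    finally show "norm (Abs_ell2 (L f)) \<le> norm f * 1"
      using power2_le_imp_le by auto
  qed
  then have "left_regular G g f = Abs_ell2 (L f)"
    unfolding left_regular_def L_def by (simp add: bounded_linear_Blinfun_apply)
  then show ?thesis by (simp add: ap L_def)
qed

definition reduced_cstar_algebra :: "('a, 'c) monoid_scheme \<Rightarrow> 'a operator set" where
  "reduced_cstar_algebra G = cstar_subalgebra hull (left_regular G ` carrier G)"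

definition cstar_simple :: "('a, 'c) monoid_scheme \<Rightarrow> bool" where
  "cstar_simple G \<longleftrightarrow> simple_cstar_algebra (reduced_cstar_algebra G)"

text \<open>A functional on the reduced C*-algebra is represented by an extensional function.\<close>

definition unique_trace_property :: "('a, 'c) monoid_scheme \<Rightarrow> bool" where
  "unique_trace_property G \<longleftrightarrow>
     (\<exists>!\<tau>. \<tau> \<in> extensional (reduced_cstar_algebra G) \<and>
           tracial_state (reduced_cstar_algebra G) (left_regular G \<one>\<^bsub>G\<^esub>) \<tau>)"

end

theory Submission
  imports Defs
begin


text \<open>Let \<open>G = N \<wr> K\<close>, let \<open>M\<close> be its base group, the direct sum of copies of \<open>N\<close>, and write \<open>U\<^sub>g\<close> for
  left translation by \<open>g\<close>. The copies of \<open>N\<close> give copies of \<open>C\<^sub>r\<^sup>*(N)\<close> inside \<open>C\<^sub>r\<^sup>*(G)\<close> that commute with each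
  other (\<open>lift\<close>), and the proof compares the states of the two algebras.

  From \<open>G\<close> to \<open>N\<close>: a state \<open>\<phi>\<close> of \<open>C\<^sub>r\<^sup>*(N)\<close> has an infinite product \<open>\<Phi>\<close>, a state of \<open>C\<^sub>r\<^sup>*(G)\<close> with
  \<open>\<Phi>(U\<^sub>m) = \<Prod>\<^sub>j \<phi>(m\<^sub>j)\<close> on the base group and \<open>0\<close> elsewhere (\<open>exists_infinite_product_state\<close>). It is bounded
  in the reduced norm because \<open>\<phi>\<close> is dominated by vector functionals of \<open>\<ell>\<^sup>2(N)\<close> and finite products of
  these are vector functionals of \<open>\<ell>\<^sup>2(G)\<close>. If \<open>\<phi>\<close> is a trace other than the canonical one, then so is \<open>\<Phi>\<close>.
  If \<open>\<phi>\<close> vanishes on a proper ideal \<open>I\<close> of \<open>C\<^sub>r\<^sup>*(N)\<close>, then the elements \<open>T\<close> with \<open>\<Phi>(PTR) = 0\<close> for all \<open>P, R\<close>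
  form a proper ideal that contains a copy of \<open>I\<close>.

  From \<open>N\<close> to \<open>G\<close>: both properties force the nontrivial group \<open>N\<close> to be infinite, since on the
  reduced algebra of a finite one the trivial character is a trace, and its kernel is an ideal. Consider a trace of \<open>C\<^sub>r\<^sup>*(G)\<close>, or the set of
  all states that vanish on a given proper ideal.
  \<^item> The first step produces the canonical trace on \<open>M\<close>. A trace equals it there because its compressions by
    elements commuting with one copy of \<open>C\<^sub>r\<^sup>*(N)\<close> are traces on that copy. For an ideal, the set of states
    is compact, convex and closed under compressions. Inside it, maximising a strictly convex function
    yields states that are multiplicative between one copy of \<open>C\<^sub>r\<^sup>*(N)\<close> and the elements of \<open>M\<close> commuting with it,
    and then simplicity allows their restriction to that copy to be replaced by the canonical trace
    (\<open>exists_product_state\<close>). The coordinates are treated one after another, and compactness does the rest.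
  \<^item> The second step treats \<open>x\<close> outside \<open>M\<close>. The conjugates of \<open>x\<close> by different elements at one coordinate
    are orthonormal for a state that is canonical on \<open>M\<close>, so averages over \<open>l\<close> of them have a value of
    modulus at most \<open>1/\<surd>l\<close> (\<open>average_of_conjugates\<close>). A trace does not see the conjugation and vanishes at \<open>U\<^sub>x\<close>; in
    the case of an ideal the canonical trace of \<open>G\<close> is a limit of averaged states, so it vanishes on the
    ideal, and as it is faithful the ideal is \<open>0\<close>.

  Simplicity of \<open>C\<^sub>r\<^sup>*(N)\<close> enters through \<open>simple_positive_square\<close>: an element that is positive in the
  representation of a single state is positive. The spectral theory needed for this reduces to square
  roots, which an explicit iteration provides, and states are supplied by the Hahn-Banach theorem.\<close>


section \<open>Square-summable functions\<close>

lemma scaleC_add_right: "c *\<^sub>C (f + g) = c *\<^sub>C f + c *\<^sub>C g"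
  by transfer (simp add: algebra_simps)

lemma scaleC_add_left: "(c + d) *\<^sub>C f = c *\<^sub>C f + d *\<^sub>C f"
  by transfer (simp add: algebra_simps)

lemma scaleC_scaleC [simp]: "c *\<^sub>C d *\<^sub>C f = (c * d) *\<^sub>C f"
  by transfer (simp add: algebra_simps)

lemma scaleC_one [simp]: "1 *\<^sub>C f = f"
  by transfer simp

lemma scaleC_zero_left [simp]: "0 *\<^sub>C f = 0"
  by transfer simp

lemma scaleC_zero_right [simp]: "c *\<^sub>C 0 = 0"
  by transfer simp

lemma cinner_add_right: "cinner f (g + h) = cinner f g + cinner f h"
  using cinner_commute[of "g + h" f] cinner_commute[of g f] cinner_commute[of h f]
  by (metis cinner_add_left cinner_commute complex_cnj_add)

lemma cinner_scaleC_right: "cinner f (c *\<^sub>C g) = cnj c * cinner f g"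
  by (metis cinner_scaleC_left cinner_commute complex_cnj_mult)

lemma cinner_zero_left [simp]: "cinner 0 g = 0"
  by transfer simp

lemma cinner_zero_right [simp]: "cinner f 0 = 0"
  by transfer simp

lemma cinner_diff_left: "cinner (f - g) h = cinner f h - cinner g h"
  by (metis cinner_add_left add_diff_cancel_right' diff_add_cancel)

lemma cinner_diff_right: "cinner f (g - h) = cinner f g - cinner f h"
  by (metis cinner_add_right add_diff_cancel_right' diff_add_cancel)

lemma cinner_sum_left: "cinner (\<Sum>i\<in>F. f i) g = (\<Sum>i\<in>F. cinner (f i) g)"
  by (induction F rule: infinite_finite_induct) (auto simp: cinner_add_left)

lemma cinner_self_norm: "cinner f f = of_real ((norm f)\<^sup>2)"
  by (simp add: cinner_self norm_ell2_square)

lemma Re_cinner: "Re (cinner f g) = f \<bullet> g"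
  by (simp add: inner_ell2_def)

lemma cinner_Cauchy_Schwarz: "cmod (cinner f g) \<le> norm f * norm g"
proof (cases "cinner f g = 0")
  case False
  define c where "c = cnj (cinner f g) / cmod (cinner f g)"
  have "cmod c = 1"
    using False by (simp add: c_def norm_divide)
  have "c * cinner f g = of_real (cmod (cinner f g))"
    using False by (simp add: c_def complex_norm_square power2_eq_square field_simps)
      (metis complex_norm_square mult.commute of_real_mult power2_eq_square)
  then have "cmod (cinner f g) = (c *\<^sub>C f) \<bullet> g"
    by (metis Re_complex_of_real cinner_scaleC_left Re_cinner)
  also have "\<dots> \<le> norm (c *\<^sub>C f) * norm g"
    by (rule norm_cauchy_schwarz)
  finally show ?thesis
    using \<open>cmod c = 1\<close> by (simp add: norm_scaleC)
qed simp

lemma bounded_bilinear_cinner: "bounded_bilinear cinner"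
  by (rule bounded_bilinear.intro)
    (auto simp: cinner_add_left cinner_add_right scaleR_ell2_def cinner_scaleC_left
      cinner_scaleC_right scaleR_conv_of_real intro!: exI[of _ 1] cinner_Cauchy_Schwarz)

lemma ell2_eqI: "(\<And>x. ell2_apply f x = ell2_apply g x) \<Longrightarrow> f = g"
  by (simp add: fun_eq_iff flip: ell2_apply_inject)

lemma square_summable_ell2: "(\<lambda>x. (cmod (ell2_apply f x))\<^sup>2) summable_on S"
  using ell2_apply[of f] summable_on_subset_banach[of _ UNIV S] by auto

lemma Abs_ell2_apply:
  "(\<lambda>x. (cmod (f x))\<^sup>2) summable_on UNIV \<Longrightarrow> ell2_apply (Abs_ell2 f) x = f x"
  by (simp add: Abs_ell2_inverse)

lift_definition delta :: "'a \<Rightarrow> 'a ell2" is "\<lambda>x y. if y = x then 1 else 0"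
proof -
  fix x :: 'a
  have "(\<lambda>y. (cmod (if y = x then 1 else 0))\<^sup>2) summable_on {x}"
    by simp
  then show "(\<lambda>y. (cmod (if y = x then 1 else 0))\<^sup>2) summable_on UNIV"
    by (rule summable_on_cong_neutral[THEN iffD1, rotated -1]) auto
qed

lemma cinner_delta: "cinner f (delta x) = ell2_apply f x"
proof -
  have "cinner f (delta x) = (\<Sum>\<^sub>\<infinity>y. ell2_apply f y * cnj (if y = x then 1 else 0))"
    by (simp add: cinner.rep_eq delta.rep_eq)
  also have "\<dots> = (\<Sum>\<^sub>\<infinity>y\<in>{x}. ell2_apply f y)"
    by (intro infsum_cong_neutral) auto
  finally show ?thesis by simp
qed

lemma norm_delta [simp]: "norm (delta x) = 1"
proof -
  have "complex_of_real ((norm (delta x))\<^sup>2) = 1"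
    unfolding cinner_self_norm[symmetric] cinner_delta delta.rep_eq by simp
  then have "(norm (delta x))\<^sup>2 = 1"
    using of_real_eq_1_iff by blast
  then show ?thesis
    by (metis abs_norm_cancel real_sqrt_abs real_sqrt_one)
qed

lemma norm_ell2_apply_le: "cmod (ell2_apply f x) \<le> norm f"
  using cinner_Cauchy_Schwarz[of f "delta x"] by (simp add: cinner_delta)

lemma sum_square_le_norm_ell2:
  "finite F \<Longrightarrow> (\<Sum>x\<in>F. (cmod (ell2_apply f x))\<^sup>2) \<le> (norm f)\<^sup>2"
  unfolding norm_ell2_square by (rule finite_sum_le_infsum[OF square_summable_ell2]) auto

lemma norm_ell2_leI:
  assumes "\<And>F. finite F \<Longrightarrow> (\<Sum>x\<in>F. (cmod (ell2_apply f x))\<^sup>2) \<le> b\<^sup>2" and "b \<ge> 0"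
  shows "norm f \<le> b"
proof -
  have "(norm f)\<^sup>2 \<le> b\<^sup>2"
    unfolding norm_ell2_square by (rule infsum_le_finite_sums[OF square_summable_ell2]) (use assms in auto)
  then show ?thesis
    using assms(2) power2_le_imp_le by blast
qed

text \<open>Completeness of \<open>\<ell>\<^sup>2\<close> makes the bounded operators a Banach space, which the construction of
  square roots needs. A Cauchy sequence converges pointwise, and the Cauchy estimate on a finite set
  of points survives the pointwise limit.\<close>

instance ell2 :: (type) banach
proof
  fix X :: "nat \<Rightarrow> 'a ell2"
  assume X: "Cauchy X"
  have "Cauchy (\<lambda>n. ell2_apply (X n) x)" for x
  proof (rule CauchyI)
    fix e :: real assume "e > 0"
    then obtain M where M: "\<And>m n. m \<ge> M \<Longrightarrow> n \<ge> M \<Longrightarrow> norm (X m - X n) < e"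
      using X unfolding Cauchy_iff by blast
    have "cmod (ell2_apply (X m) x - ell2_apply (X n) x) < e" if "m \<ge> M" "n \<ge> M" for m n
      using M[OF that] norm_ell2_apply_le[of "X m - X n" x] by (simp add: minus_ell2.rep_eq)
    then show "\<exists>M. \<forall>m\<ge>M. \<forall>n\<ge>M. cmod (ell2_apply (X m) x - ell2_apply (X n) x) < e"
      by blast
  qed
  then have "\<forall>x. \<exists>l. (\<lambda>n. ell2_apply (X n) x) \<longlonglongrightarrow> l"
    by (metis Cauchy_convergent_iff convergent_def)
  then obtain f where f: "\<And>x. (\<lambda>n. ell2_apply (X n) x) \<longlonglongrightarrow> f x"
    by metis
  have est: "(\<Sum>x\<in>F. (cmod (ell2_apply (X n) x - f x))\<^sup>2) \<le> e\<^sup>2"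
    if M: "\<And>m n. m \<ge> M \<Longrightarrow> n \<ge> M \<Longrightarrow> norm (X m - X n) < e" and "n \<ge> M" "finite F" for M n e F
  proof (rule tendsto_upperbound)
    show "(\<lambda>m. \<Sum>x\<in>F. (cmod (ell2_apply (X n) x - ell2_apply (X m) x))\<^sup>2)
        \<longlonglongrightarrow> (\<Sum>x\<in>F. (cmod (ell2_apply (X n) x - f x))\<^sup>2)"
      by (intro tendsto_intros f)
    show "\<forall>\<^sub>F m in sequentially. (\<Sum>x\<in>F. (cmod (ell2_apply (X n) x - ell2_apply (X m) x))\<^sup>2) \<le> e\<^sup>2"
    proof (rule eventually_sequentiallyI[of M])
      fix m assume "m \<ge> M"
      then have "norm (X n - X m) \<le> e"
        using M that(2) by (meson less_imp_le)
      then have "(norm (X n - X m))\<^sup>2 \<le> e\<^sup>2"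
        by (intro power_mono) auto
      then show "(\<Sum>x\<in>F. (cmod (ell2_apply (X n) x - ell2_apply (X m) x))\<^sup>2) \<le> e\<^sup>2"
        using sum_square_le_norm_ell2[OF that(3), of "X n - X m"]
        by (simp add: minus_ell2.rep_eq)
    qed
  qed simp
  obtain M1 where M1: "\<And>m n. m \<ge> M1 \<Longrightarrow> n \<ge> M1 \<Longrightarrow> norm (X m - X n) < 1"
    using X unfolding Cauchy_iff by (metis zero_less_one)
  have "(\<lambda>x. (cmod (ell2_apply (X M1) x - f x))\<^sup>2) summable_on UNIV"
    by (rule nonneg_bdd_above_summable_on)
      (auto intro!: bdd_aboveI2[where M = "1\<^sup>2"] est[where M = M1] M1)
  then have "(\<lambda>x. (cmod (- 1 * (ell2_apply (X M1) x - f x)))\<^sup>2) summable_on UNIV"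
    by (rule square_summable_scale)
  from square_summable_add[OF this ell2_apply[of "X M1", simplified]]
  have sf: "(\<lambda>x. (cmod (f x))\<^sup>2) summable_on UNIV"
    by simp
  define g where "g = Abs_ell2 f"
  have g: "ell2_apply g = f"
    using sf by (simp add: g_def Abs_ell2_inverse)
  have "X \<longlonglongrightarrow> g"
  proof (rule LIMSEQ_I)
    fix r :: real assume "r > 0"
    then obtain M where M: "\<And>m n. m \<ge> M \<Longrightarrow> n \<ge> M \<Longrightarrow> norm (X m - X n) < r / 2"
      using X unfolding Cauchy_iff by (meson half_gt_zero)
    have "norm (X n - g) \<le> r / 2" if "n \<ge> M" for n
      using est[OF M that] \<open>r > 0\<close> by (intro norm_ell2_leI) (auto simp: minus_ell2.rep_eq g)
    then show "\<exists>no. \<forall>n\<ge>no. norm (X n - g) < r"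
      using \<open>r > 0\<close> by (intro exI[of _ M]) force
  qed
  then show "convergent X"
    by (auto simp: convergent_def)
qed


section \<open>Operators\<close>

text \<open>The infix for composition of operators binds weaker than addition; these abbreviations restore the
  usual precedences.\<close>

abbreviation op_mult :: "'a operator \<Rightarrow> 'a operator \<Rightarrow> 'a operator"  (infixl \<open>\<star>\<close> 70)
  where "S \<star> T \<equiv> S o\<^sub>L T"

abbreviation op_scale :: "complex \<Rightarrow> 'a operator \<Rightarrow> 'a operator"  (infixr \<open>*\<^sub>O\<close> 75)
  where "c *\<^sub>O T \<equiv> scalar_op c o\<^sub>L T"

lemmas op_apply_simps = blinfun.add_left blinfun.diff_left blinfun.minus_left blinfun.zero_left
  scalar_op.rep_eq blinfun.add_right blinfun.diff_right blinfun.minus_right blinfun.zero_right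

lemma op_scale_add_right: "c *\<^sub>O (S + T) = c *\<^sub>O S + c *\<^sub>O T"
  by (rule blinfun_eqI) (simp add: op_apply_simps scaleC_add_right)

lemma op_scale_add_left: "(c + d) *\<^sub>O T = c *\<^sub>O T + d *\<^sub>O T"
  by (rule blinfun_eqI) (simp add: op_apply_simps scaleC_add_left)

lemma op_scale_op_scale [simp]: "c *\<^sub>O d *\<^sub>O T = (c * d) *\<^sub>O T"
  by (rule blinfun_eqI) (simp add: op_apply_simps)

lemma op_scale_one [simp]: "1 *\<^sub>O T = T"
  by (rule blinfun_eqI) (simp add: op_apply_simps)

lemma op_scale_zero_left [simp]: "0 *\<^sub>O T = 0"
  by (rule blinfun_eqI) (simp add: op_apply_simps)

lemma scaleR_op_scale: "r *\<^sub>R T = complex_of_real r *\<^sub>O T"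
  by (rule blinfun_eqI) (simp add: op_apply_simps scaleR_ell2_def blinfun.scaleR_left)

lemma op_uminus: "- T = (- 1) *\<^sub>O T"
  using scaleR_op_scale[of "- 1" T] by simp

lemma op_scale_compose: "(c *\<^sub>O S) \<star> T = c *\<^sub>O (S \<star> T)"
  by (rule blinfun_eqI) simp

lemma compose_assoc: "(R \<star> S) \<star> T = R \<star> (S \<star> T)"
  by (rule blinfun_eqI) simp

lemma compose_op_scale: "complex_linear S \<Longrightarrow> S \<star> (c *\<^sub>O T) = c *\<^sub>O (S \<star> T)"
  by (rule blinfun_eqI) (simp add: op_apply_simps complex_linear_def)

lemma compose_add_left: "(R + S) \<star> T = R \<star> T + S \<star> T"
  by (rule blinfun_eqI) (simp add: op_apply_simps)

lemma compose_add_right: "R \<star> (S + T) = R \<star> S + R \<star> T"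
  by (rule blinfun_eqI) (simp add: op_apply_simps)

lemma compose_diff_left: "(R - S) \<star> T = R \<star> T - S \<star> T"
  by (rule blinfun_eqI) (simp add: op_apply_simps)

lemma compose_diff_right: "R \<star> (S - T) = R \<star> S - R \<star> T"
  by (rule blinfun_eqI) (simp add: op_apply_simps)

lemmas compose_distribs = compose_add_left compose_add_right compose_diff_left compose_diff_right

lemmas compose_scaleR_left = bounded_bilinear.scaleR_left[OF bounded_bilinear_blinfun_compose]
  and compose_scaleR_right = bounded_bilinear.scaleR_right[OF bounded_bilinear_blinfun_compose]
  and tendsto_compose_op = bounded_bilinear.tendsto[OF bounded_bilinear_blinfun_compose]
  and continuous_on_compose_op = bounded_bilinear.continuous_on[OF bounded_bilinear_blinfun_compose]

lemma norm_op_scale: "norm (c *\<^sub>O T) = cmod c * norm T"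
proof (rule antisym)
  show "norm (c *\<^sub>O T) \<le> cmod c * norm T"
    by (rule norm_blinfun_bound)
      (auto simp: op_apply_simps norm_scaleC mult.assoc intro!: mult_left_mono norm_blinfun)
  show "cmod c * norm T \<le> norm (c *\<^sub>O T)"
  proof (cases "c = 0")
    case False
    have "norm T \<le> norm (c *\<^sub>O T) / cmod c"
    proof (rule norm_blinfun_bound)
      fix f
      have "cmod c * norm (T f) \<le> norm (c *\<^sub>O T) * norm f"
        using norm_blinfun[of "c *\<^sub>O T" f] by (simp add: op_apply_simps norm_scaleC)
      then show "norm (T f) \<le> norm (c *\<^sub>O T) / cmod c * norm f"
        using False by (simp add: field_simps)
    qed simp
    then show ?thesis
      using False by (simp add: field_simps)
  qed simp
qed

lemma bounded_linear_op_scale: "bounded_linear (\<lambda>T. c *\<^sub>O T)"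
  by (rule bounded_linear_intro[where K = "cmod c"])
    (simp_all add: op_scale_add_right norm_op_scale mult.commute scaleR_op_scale mult.commute)

subsection \<open>Adjoints\<close>

definition adj :: "'a operator \<Rightarrow> 'a operator" where
  "adj T = (SOME S. is_adjoint S T)"

lemma is_adjoint_unique:
  assumes "is_adjoint S T" "is_adjoint S' T"
  shows "S = S'"
proof (rule blinfun_eqI)
  fix g
  have "cinner (S g - S' g) (S g - S' g) = 0"
    using assms unfolding is_adjoint_def cinner_diff_right by (metis diff_self)
  then show "S g = S' g"
    by (simp add: cinner_self_norm)
qed

lemma adj_eqI: "is_adjoint S T \<Longrightarrow> adj T = S"
  unfolding adj_def by (metis is_adjoint_unique someI)

lemma is_adjoint_sym: "is_adjoint S T \<Longrightarrow> is_adjoint T S"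
  unfolding is_adjoint_def by (metis cinner_commute)

lemma is_adjoint_add: "is_adjoint S T \<Longrightarrow> is_adjoint S' T' \<Longrightarrow> is_adjoint (S + S') (T + T')"
  by (simp add: is_adjoint_def op_apply_simps cinner_add_left cinner_add_right)

lemma is_adjoint_compose: "is_adjoint S T \<Longrightarrow> is_adjoint S' T' \<Longrightarrow> is_adjoint (S \<star> S') (T' \<star> T)"
  by (simp add: is_adjoint_def)

lemma is_adjoint_norm:
  assumes "is_adjoint S T"
  shows "norm S \<le> norm T"
proof (rule norm_blinfun_bound)
  fix g
  have "(norm (S g))\<^sup>2 = cmod (cinner (S g) (S g))"
    by (simp add: cinner_self_norm norm_power)
  also have "\<dots> = cmod (cinner (T (S g)) g)"
    using assms by (simp add: is_adjoint_def)
  also have "\<dots> \<le> norm (T (S g)) * norm g"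
    by (rule cinner_Cauchy_Schwarz)
  also have "\<dots> \<le> norm T * norm (S g) * norm g"
    by (intro mult_right_mono norm_blinfun) auto
  finally show "norm (S g) \<le> norm T * norm g"
    by (cases "norm (S g) = 0") (auto simp: power2_eq_square)
qed simp

lemma is_adjoint_limit:
  assumes "S \<longlonglongrightarrow> S'" "T \<longlonglongrightarrow> T'" "\<And>n. is_adjoint (S n) (T n)"
  shows "is_adjoint S' T'"
  unfolding is_adjoint_def
proof (intro allI)
  fix f g
  have "(\<lambda>n. cinner (T n f) g) \<longlonglongrightarrow> cinner (T' f) g"
    by (intro bounded_bilinear.tendsto[OF bounded_bilinear_cinner] blinfun.tendsto assms tendsto_const)
  moreover have "(\<lambda>n. cinner f (S n g)) \<longlonglongrightarrow> cinner f (S' g)"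
    by (intro bounded_bilinear.tendsto[OF bounded_bilinear_cinner] blinfun.tendsto assms tendsto_const)
  ultimately show "cinner (T' f) g = cinner f (S' g)"
    using assms(3) LIMSEQ_unique by (simp add: is_adjoint_def)
qed

lemma is_adjoint_compose_self_zero:
  assumes "is_adjoint S T" "S \<star> T = 0"
  shows "T = 0"
proof (rule blinfun_eqI)
  fix f
  have "cinner (T f) (T f) = cinner f ((S \<star> T) f)"
    using assms(1) by (simp add: is_adjoint_def)
  then show "T f = blinfun_apply 0 f"
    by (simp add: assms(2) cinner_self_norm op_apply_simps)
qed


section \<open>Unital C*-algebras and positive functionals\<close>

locale unital_cstar =
  fixes A :: "'a operator set" and E :: "'a operator"
  assumes cstar: "cstar_subalgebra A"
    and unit_mem [simp]: "E \<in> A"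
    and unit_left [simp]: "T \<in> A \<Longrightarrow> E \<star> T = T"
    and unit_right [simp]: "T \<in> A \<Longrightarrow> T \<star> E = T"
begin

lemma clin: "T \<in> A \<Longrightarrow> complex_linear T"
  and zero_mem [simp]: "0 \<in> A"
  and add_mem [simp]: "S \<in> A \<Longrightarrow> T \<in> A \<Longrightarrow> S + T \<in> A"
  and scale_mem [simp]: "T \<in> A \<Longrightarrow> c *\<^sub>O T \<in> A"
  and mult_mem [simp]: "S \<in> A \<Longrightarrow> T \<in> A \<Longrightarrow> S \<star> T \<in> A"
  and closed_algebra: "closed A"
  using cstar by (simp_all add: cstar_subalgebra_def)

lemma scaleR_mem [simp]: "T \<in> A \<Longrightarrow> r *\<^sub>R T \<in> A"
  by (simp add: scaleR_op_scale)

lemma uminus_mem [simp]: "T \<in> A \<Longrightarrow> - T \<in> A"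
  by (subst op_uminus) simp

lemma diff_mem [simp]: "S \<in> A \<Longrightarrow> T \<in> A \<Longrightarrow> S - T \<in> A"
  using add_mem[of S "- T"] by simp

lemma sum_mem [simp]: "(\<And>i. i \<in> F \<Longrightarrow> T i \<in> A) \<Longrightarrow> (\<Sum>i\<in>F. T i) \<in> A"
  by (induction F rule: infinite_finite_induct) auto

lemma is_adjoint_adj: "T \<in> A \<Longrightarrow> is_adjoint (adj T) T"
  and adj_mem [simp]: "T \<in> A \<Longrightarrow> adj T \<in> A"
proof -
  assume "T \<in> A"
  then obtain S where "S \<in> A" "is_adjoint S T"
    using cstar by (auto simp: cstar_subalgebra_def)
  then show "is_adjoint (adj T) T" "adj T \<in> A"
    by (auto simp: adj_eqI)
qed

lemma adj_adj [simp]: "T \<in> A \<Longrightarrow> adj (adj T) = T"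
  by (rule adj_eqI[OF is_adjoint_sym[OF is_adjoint_adj]])

lemma adj_add [simp]: "S \<in> A \<Longrightarrow> T \<in> A \<Longrightarrow> adj (S + T) = adj S + adj T"
  by (intro adj_eqI is_adjoint_add is_adjoint_adj)

lemma adj_mult [simp]: "S \<in> A \<Longrightarrow> T \<in> A \<Longrightarrow> adj (S \<star> T) = adj T \<star> adj S"
  by (intro adj_eqI is_adjoint_compose is_adjoint_adj)

lemma adj_scale [simp]: "T \<in> A \<Longrightarrow> adj (c *\<^sub>O T) = cnj c *\<^sub>O adj T"
  by (rule adj_eqI) (simp add: is_adjoint_def cinner_scaleC_left cinner_scaleC_right
      scalar_op.rep_eq is_adjoint_adj[unfolded is_adjoint_def])

lemma adj_scaleR [simp]: "T \<in> A \<Longrightarrow> adj (r *\<^sub>R T) = r *\<^sub>R adj T"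
  by (simp add: scaleR_op_scale)

lemma adj_uminus [simp]: "T \<in> A \<Longrightarrow> adj (- T) = - adj T"
  by (simp only: op_uminus adj_scale complex_cnj_minus complex_cnj_one)

lemma adj_diff [simp]: "S \<in> A \<Longrightarrow> T \<in> A \<Longrightarrow> adj (S - T) = adj S - adj T"
  using adj_add[of S "- T"] by simp

lemma adj_unit [simp]: "adj E = E"
  by (metis adj_adj adj_mem adj_mult unit_left unit_mem unit_right)

lemma norm_adj [simp]: "T \<in> A \<Longrightarrow> norm (adj T) = norm T"
  by (metis adj_adj adj_mem antisym is_adjoint_adj is_adjoint_norm)

lemma adj_mult_self_zero: "T \<in> A \<Longrightarrow> adj T \<star> T = 0 \<Longrightarrow> T = 0"
  using is_adjoint_adj is_adjoint_compose_self_zero by blast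

lemma scale_right [simp]: "S \<in> A \<Longrightarrow> S \<star> (c *\<^sub>O T) = c *\<^sub>O (S \<star> T)"
  by (simp add: clin compose_op_scale)

lemma unit_apply_norm: "norm (E f) \<le> norm f"
proof -
  have "cinner (E f) (E f) = cinner (E (E f)) f"
    using is_adjoint_sym[OF is_adjoint_adj[OF unit_mem]] by (simp add: is_adjoint_def)
  also have "E (E f) = E f"
    by (metis blinfun_apply_blinfun_compose unit_left unit_mem)
  finally have "(norm (E f))\<^sup>2 = cmod (cinner (E f) f)"
    by (metis cinner_self_norm norm_of_real abs_of_nonneg zero_le_power2)
  then have "(norm (E f))\<^sup>2 \<le> norm (E f) * norm f"
    by (simp add: cinner_Cauchy_Schwarz)
  then show ?thesis
    by (cases "norm (E f) = 0") (auto simp: power2_eq_square)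
qed

lemma norm_unit: "norm E \<le> 1"
  by (rule norm_blinfun_bound) (auto simp: unit_apply_norm)

text \<open>The norm bound \<open>\<parallel>c\<^sup>2 - T\<^sup>*T\<parallel> \<le> c\<^sup>2\<close> is how positivity of \<open>T\<^sup>*T\<close> enters below, in place of
  spectral theory.\<close>

lemma norm_unit_minus_square:
  assumes T: "T \<in> A" and "norm T \<le> c"
  shows "norm (c\<^sup>2 *\<^sub>R E - adj T \<star> T) \<le> c\<^sup>2"
proof (rule norm_blinfun_bound)
  fix f
  define g where "g = E f"
  have Tf: "T f = T g"
    unfolding g_def by (metis T blinfun_apply_blinfun_compose unit_right)
  have "0 \<le> c"
    using assms(2) norm_ge_zero order_trans by blast
  have "inner g (adj T (T g)) = (norm (T g))\<^sup>2"
    using is_adjoint_adj[OF T]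
    by (metis Re_cinner is_adjoint_def power2_norm_eq_inner)
  moreover have norm_diff_square: "(norm (v - w))\<^sup>2 = (norm v)\<^sup>2 - 2 * inner v w + (norm w)\<^sup>2"
    for v w :: "'a ell2"
    by (simp add: power2_norm_eq_inner inner_diff_left inner_diff_right inner_commute)
  ultimately have "(norm (c\<^sup>2 *\<^sub>R g - adj T (T g)))\<^sup>2
      = c\<^sup>2 * c\<^sup>2 * (norm g)\<^sup>2 - 2 * c\<^sup>2 * (norm (T g))\<^sup>2 + (norm (adj T (T g)))\<^sup>2"
    by (simp add: norm_diff_square power_mult_distrib)
  moreover have "norm (adj T (T g)) \<le> c * norm (T g)"
    using norm_blinfun[of "adj T" "T g"] assms
    by (smt (verit) mult_right_mono norm_adj norm_ge_zero)
  then have "(norm (adj T (T g)))\<^sup>2 \<le> c\<^sup>2 * (norm (T g))\<^sup>2"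
    by (metis norm_ge_zero power_mono power_mult_distrib)
  moreover have "0 \<le> c\<^sup>2 * (norm (T g))\<^sup>2"
    by simp
  ultimately have "(norm (c\<^sup>2 *\<^sub>R g - adj T (T g)))\<^sup>2 \<le> c\<^sup>2 * c\<^sup>2 * (norm g)\<^sup>2"
    by linarith
  also have "\<dots> = (c\<^sup>2 * norm g)\<^sup>2"
    by (simp add: power2_eq_square)
  finally have "norm (c\<^sup>2 *\<^sub>R g - adj T (T g)) \<le> c\<^sup>2 * norm g"
    using power2_le_imp_le by force
  also have "\<dots> \<le> c\<^sup>2 * norm f"
    by (simp add: g_def mult_left_mono unit_apply_norm)
  finally show "norm ((c\<^sup>2 *\<^sub>R E - adj T \<star> T) f) \<le> c\<^sup>2 * norm f"
    by (simp add: op_apply_simps blinfun.scaleR_left Tf g_def)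
qed simp


subsection \<open>Square roots\<close>

text \<open>A square root of \<open>1 - x\<close> is \<open>1 - Y\<close> with \<open>Y = (x + Y\<^sup>2) / 2\<close>. The iteration of this equation from
  \<open>0\<close> is dominated, increment by increment, by the same iteration for the real number \<open>1\<close>, which is
  increasing and bounded; so it converges even when \<open>\<parallel>x\<parallel> = 1\<close>. Each iterate is a polynomial in \<open>x\<close>,
  which is why \<open>Y\<close> commutes with all that commutes with \<open>x\<close>.\<close>

lemma sqrt_unit_minus:
  assumes x: "x \<in> A" "adj x = x" "norm x \<le> 1"
  obtains Y where "Y \<in> A" "adj Y = Y" "norm Y \<le> 1" "(E - Y) \<star> (E - Y) = E - x"
    "\<And>Z. Z \<star> x = x \<star> Z \<Longrightarrow> Z \<star> Y = Y \<star> Z"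
proof -
  define y :: "nat \<Rightarrow> real" where "y = rec_nat 0 (\<lambda>_ t. (1 + t\<^sup>2) / 2)"
  define Y where "Y = rec_nat 0 (\<lambda>_ T. (1/2) *\<^sub>R (x + T \<star> T))"
  have y_simps: "y 0 = 0" "\<And>n. y (Suc n) = (1 + (y n)\<^sup>2) / 2"
    and Y_simps: "Y 0 = 0" "\<And>n. Y (Suc n) = (1/2) *\<^sub>R (x + Y n \<star> Y n)"
    by (simp_all add: y_def Y_def)
  have y01: "0 \<le> y n \<and> y n \<le> 1" for n
    by (induction n) (auto simp: power_le_one y_simps)
  have y_mono: "y n \<le> y (Suc n)" for n
    using zero_le_power2[of "1 - y n"] by (simp add: y_simps power2_eq_square field_simps)
  have YA: "Y n \<in> A" for n
    by (induction n) (use x in \<open>simp_all add: Y_simps\<close>)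
  have adj_0: "adj (0 :: 'a operator) = 0"
    by (rule adj_eqI) (simp add: is_adjoint_def op_apply_simps)
  have Yadj: "adj (Y n) = Y n" for n
    by (induction n) (use x YA in \<open>simp_all add: Y_simps adj_0\<close>)
  have Ynorm: "norm (Y n) \<le> y n" for n
  proof (induction n)
    case (Suc n)
    have "norm (Y n \<star> Y n) \<le> (y n)\<^sup>2"
      using norm_blinfun_compose[of "Y n" "Y n"] mult_mono[OF Suc Suc] y01[of n]
      by (auto simp: power2_eq_square)
    then show ?case
      using x(3) norm_triangle_ineq[of x "Y n \<star> Y n"] by (simp add: Y_simps y_simps)
  qed (simp add: Y_simps y_simps)
  have half_diff: "(p - q) / 2 = a - b" if "a = (1 + p) / 2" "b = (1 + q) / 2" for a b p q :: real
    using that by (simp add: field_simps)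
  have Ystep: "norm (Y (Suc n) - Y n) \<le> y (Suc n) - y n" for n
  proof (induction n)
    case 0
    then show ?case
      using x(3) by (simp add: Y_simps y_simps)
  next
    case (Suc n)
    let ?D = "Y (Suc n) - Y n"
    have "Y (Suc (Suc n)) - Y (Suc n)
        = (1/2) *\<^sub>R ((x + Y (Suc n) \<star> Y (Suc n)) - (x + Y n \<star> Y n))"
      by (simp only: Y_simps(2)[of "Suc n"] Y_simps(2)[of n] scaleR_diff_right)
    also have "\<dots> = (1/2) *\<^sub>R (Y (Suc n) \<star> ?D + ?D \<star> Y n)"
      by (simp only: compose_distribs) simp
    finally have "Y (Suc (Suc n)) - Y (Suc n) = (1/2) *\<^sub>R (Y (Suc n) \<star> ?D + ?D \<star> Y n)" .
    moreover have "norm (Y (Suc n) \<star> ?D) \<le> y (Suc n) * (y (Suc n) - y n)"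
      by (rule order_trans[OF norm_blinfun_compose]) (intro mult_mono Ynorm Suc y01[THEN conjunct1] norm_ge_zero)
    moreover have "norm (?D \<star> Y n) \<le> (y (Suc n) - y n) * y n"
      by (rule order_trans[OF norm_blinfun_compose])
        (intro mult_mono Ynorm Suc norm_ge_zero, use y_mono[of n] in linarith)
    ultimately have "norm (Y (Suc (Suc n)) - Y (Suc n))
        \<le> (y (Suc n) * (y (Suc n) - y n) + (y (Suc n) - y n) * y n) / 2"
      using norm_triangle_ineq[of "Y (Suc n) \<star> ?D" "?D \<star> Y n"] by simp
    also have "\<dots> = ((y (Suc n))\<^sup>2 - (y n)\<^sup>2) / 2"
      by (simp add: power2_eq_square algebra_simps)
    also have "\<dots> = y (Suc (Suc n)) - y (Suc n)"
      by (rule half_diff[OF y_simps(2) y_simps(2)])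
    finally show ?case .
  qed
  have Ydist: "norm (Y (n + k) - Y n) \<le> y (n + k) - y n" for n k
  proof (induction k)
    case (Suc k)
    then show ?case
      using norm_triangle_ineq[of "Y (Suc (n + k)) - Y (n + k)" "Y (n + k) - Y n"] Ystep[of "n + k"]
      by simp
  qed simp
  have "Bseq y"
    by (rule BseqI'[of _ 1]) (use y01 in auto)
  then have "Cauchy y"
    by (intro convergent_Cauchy Bseq_mono_convergent) (auto simp: y_mono lift_Suc_mono_le incseq_SucI)
  have "Cauchy Y"
  proof (rule CauchyI')
    fix e :: real assume "e > 0"
    then obtain M where M: "\<And>m n. m \<ge> M \<Longrightarrow> n \<ge> M \<Longrightarrow> norm (y m - y n) < e"
      using \<open>Cauchy y\<close> unfolding Cauchy_iff by blast
    have "norm (Y m - Y n) < e" if "m \<ge> M" "n > m" for m n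
    proof -
      have "norm (Y m - Y n) \<le> y n - y m"
        using Ydist[of m "n - m"] that by (simp add: norm_minus_commute)
      also have "\<dots> < e"
        using M[of n m] that by auto
      finally show ?thesis .
    qed
    then show "\<exists>M. \<forall>m\<ge>M. \<forall>n>m. dist (Y m) (Y n) < e"
      by (auto simp: dist_norm)
  qed
  then obtain L where L: "Y \<longlonglongrightarrow> L"
    using Cauchy_convergent_iff convergent_def by blast
  have LA: "L \<in> A"
    using closed_algebra L YA closed_sequentially by blast
  have "is_adjoint L L"
    using is_adjoint_limit[OF L L] is_adjoint_adj[OF YA] Yadj by simp
  then have Ladj: "adj L = L"
    by (rule adj_eqI)
  have "norm (Y n) \<le> 1" for n
    using Ynorm[of n] y01[of n] by linarith
  then have Lnorm: "norm L \<le> 1"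
    by (intro tendsto_upperbound[OF tendsto_norm[OF L]]) auto
  have "(\<lambda>n. Y (Suc n)) \<longlonglongrightarrow> (1/2) *\<^sub>R (x + L \<star> L)"
    unfolding Y_simps by (intro tendsto_intros tendsto_compose_op L)
  then have "L = (1/2) *\<^sub>R (x + L \<star> L)"
    using LIMSEQ_unique[OF LIMSEQ_Suc[OF L]] by blast
  from arg_cong[OF this, of "\<lambda>T. 2 *\<^sub>R T"] have "2 *\<^sub>R L = x + L \<star> L"
    by simp
  then have "L \<star> L = L + L - x"
    unfolding scaleR_2 by (metis add_diff_cancel_left')
  then have sq: "(E - L) \<star> (E - L) = E - x"
    using LA by (simp add: compose_distribs)
  have comm: "Z \<star> L = L \<star> Z" if Z: "Z \<star> x = x \<star> Z" for Z
  proof -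
    have "Z \<star> Y n = Y n \<star> Z" for n
    proof (induction n)
      case (Suc n)
      have "Z \<star> (Y n \<star> Y n) = (Y n \<star> Y n) \<star> Z"
        by (metis Suc compose_assoc)
      then show ?case
        by (simp add: Y_simps compose_add_left compose_add_right Z compose_scaleR_left compose_scaleR_right)
    qed (simp add: Y_simps)
    moreover have "(\<lambda>n. Z \<star> Y n) \<longlonglongrightarrow> Z \<star> L" "(\<lambda>n. Y n \<star> Z) \<longlonglongrightarrow> L \<star> Z"
      by (intro tendsto_compose_op tendsto_const L)+
    ultimately show ?thesis
      using LIMSEQ_unique by auto
  qed
  show ?thesis
    by (rule that[OF LA Ladj Lnorm sq comm])
qed


subsection \<open>Positive functionals\<close>

definition positive_functional :: "('a operator \<Rightarrow> complex) \<Rightarrow> bool" where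
  "positive_functional \<phi> \<longleftrightarrow>
     (\<forall>S\<in>A. \<forall>T\<in>A. \<phi> (S + T) = \<phi> S + \<phi> T) \<and>
     (\<forall>c. \<forall>T\<in>A. \<phi> (c *\<^sub>O T) = c * \<phi> T) \<and>
     (\<forall>T\<in>A. \<phi> (adj T \<star> T) \<in> \<real>\<^sub>\<ge>\<^sub>0)"

definition state :: "('a operator \<Rightarrow> complex) \<Rightarrow> bool" where
  "state \<phi> \<longleftrightarrow> positive_functional \<phi> \<and> \<phi> E = 1"

lemma positive_add: "positive_functional \<phi> \<Longrightarrow> S \<in> A \<Longrightarrow> T \<in> A \<Longrightarrow> \<phi> (S + T) = \<phi> S + \<phi> T"
  and positive_scale: "positive_functional \<phi> \<Longrightarrow> T \<in> A \<Longrightarrow> \<phi> (c *\<^sub>O T) = c * \<phi> T"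
  and positive_nonneg: "positive_functional \<phi> \<Longrightarrow> T \<in> A \<Longrightarrow> \<phi> (adj T \<star> T) \<in> \<real>\<^sub>\<ge>\<^sub>0"
  by (simp_all add: positive_functional_def)

lemma state_positive: "state \<phi> \<Longrightarrow> positive_functional \<phi>"
  and state_unit: "state \<phi> \<Longrightarrow> \<phi> E = 1"
  by (simp_all add: state_def)

lemma positive_zero: "positive_functional \<phi> \<Longrightarrow> \<phi> 0 = 0"
  using positive_scale[of \<phi> E 0] by simp

lemma positive_scaleR: "positive_functional \<phi> \<Longrightarrow> T \<in> A \<Longrightarrow> \<phi> (r *\<^sub>R T) = of_real r * \<phi> T"
  by (simp add: scaleR_op_scale positive_scale)

lemma positive_uminus: "positive_functional \<phi> \<Longrightarrow> T \<in> A \<Longrightarrow> \<phi> (- T) = - \<phi> T"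
  using positive_scaleR[of \<phi> T "-1"] by simp

lemma positive_diff: "positive_functional \<phi> \<Longrightarrow> S \<in> A \<Longrightarrow> T \<in> A \<Longrightarrow> \<phi> (S - T) = \<phi> S - \<phi> T"
  using positive_add[of \<phi> S "- T"] by (simp add: positive_uminus)

lemma positive_sum:
  "positive_functional \<phi> \<Longrightarrow> (\<And>i. i \<in> F \<Longrightarrow> T i \<in> A) \<Longrightarrow> \<phi> (\<Sum>i\<in>F. T i) = (\<Sum>i\<in>F. \<phi> (T i))"
  by (induction F rule: infinite_finite_induct) (auto simp: positive_zero positive_add)

lemmas positive_linear = positive_add positive_scale positive_zero positive_scaleR positive_uminus
  positive_diff

lemma positive_form_Cauchy_Schwarz:
  fixes \<alpha> \<beta> \<gamma> \<delta> :: complex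
  assumes nonneg: "\<And>c. \<alpha> + c * \<gamma> + cnj c * \<delta> + (c * cnj c) * \<beta> \<in> \<real>\<^sub>\<ge>\<^sub>0" and \<beta>: "\<beta> \<in> \<real>\<^sub>\<ge>\<^sub>0"
  shows "\<delta> = cnj \<gamma>" and "(cmod \<gamma>)\<^sup>2 \<le> Re \<alpha> * Re \<beta>"
proof -
  have \<alpha>: "\<alpha> \<in> \<real>\<^sub>\<ge>\<^sub>0"
    using nonneg[of 0] by simp
  show \<delta>: "\<delta> = cnj \<gamma>"
    using nonneg[of 1] nonneg[of \<i>] \<alpha> \<beta> by (simp add: complex_nonneg_Reals_iff complex_eq_iff)
  define u where "u = (cmod \<gamma>)\<^sup>2"
  have u: "\<gamma> * cnj \<gamma> = of_real u"
    by (simp add: u_def flip: complex_norm_square)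
  have quad: "Re \<alpha> - 2 * t * u + t\<^sup>2 * u * Re \<beta> \<ge> 0" for t :: real
  proof -
    have "\<alpha> + (- of_real t * cnj \<gamma>) * \<gamma> + cnj (- of_real t * cnj \<gamma>) * cnj \<gamma>
        + ((- of_real t * cnj \<gamma>) * cnj (- of_real t * cnj \<gamma>)) * \<beta>
        = \<alpha> - of_real t * (\<gamma> * cnj \<gamma>) - of_real t * (\<gamma> * cnj \<gamma>) + (of_real t)\<^sup>2 * (\<gamma> * cnj \<gamma>) * \<beta>"
      by (simp add: power2_eq_square algebra_simps)
    also have "\<dots> = \<alpha> - of_real (2 * t * u) + of_real (t\<^sup>2 * u) * \<beta>"
      unfolding u by simp
    finally have "\<alpha> - of_real (2 * t * u) + of_real (t\<^sup>2 * u) * \<beta> \<in> \<real>\<^sub>\<ge>\<^sub>0"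
      using nonneg[of "- of_real t * cnj \<gamma>"] \<delta> by metis
    then show ?thesis
      by (simp add: complex_nonneg_Reals_iff)
  qed
  have "u \<ge> 0" "Re \<beta> \<ge> 0" "Re \<alpha> \<ge> 0"
    using \<alpha> \<beta> by (auto simp: u_def complex_nonneg_Reals_iff)
  have "u \<le> Re \<alpha> * Re \<beta>"
  proof (cases "Re \<beta> = 0")
    case True
    have "u = 0"
    proof (rule ccontr)
      assume "u \<noteq> 0"
      then have "2 * ((Re \<alpha> + 1) / (2 * u)) * u = Re \<alpha> + 1"
        by simp
      then show False
        using quad[of "(Re \<alpha> + 1) / (2 * u)"] True by simp
    qed
    then show ?thesis
      using True by simp
  next
    case False
    then have "Re \<alpha> - u / Re \<beta> \<ge> 0"
      using quad[of "1 / Re \<beta>"] by (simp add: power2_eq_square)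
    then show ?thesis
      using False \<open>Re \<beta> \<ge> 0\<close> by (simp add: field_simps)
  qed
  then show "(cmod \<gamma>)\<^sup>2 \<le> Re \<alpha> * Re \<beta>"
    by (simp add: u_def)
qed

lemma
  assumes \<phi>: "positive_functional \<phi>" and S: "S \<in> A" and T: "T \<in> A"
  shows positive_hermitian_form: "\<phi> (adj T \<star> S) = cnj (\<phi> (adj S \<star> T))"
    and positive_Cauchy_Schwarz:
      "(cmod (\<phi> (adj S \<star> T)))\<^sup>2 \<le> Re (\<phi> (adj S \<star> S)) * Re (\<phi> (adj T \<star> T))"
proof -
  have *: "\<phi> (adj S \<star> S) + c * \<phi> (adj S \<star> T) + cnj c * \<phi> (adj T \<star> S) + (c * cnj c) * \<phi> (adj T \<star> T)
      \<in> \<real>\<^sub>\<ge>\<^sub>0" for c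
  proof -
    have "adj (S + c *\<^sub>O T) \<star> (S + c *\<^sub>O T) = adj S \<star> S + c *\<^sub>O (adj S \<star> T)
        + cnj c *\<^sub>O (adj T \<star> S) + (c * cnj c) *\<^sub>O (adj T \<star> T)"
      using S T by (simp add: compose_distribs op_scale_compose op_scale_add_right mult.commute)
    then show ?thesis
      using positive_nonneg[OF \<phi>, of "S + c *\<^sub>O T"] S T by (simp add: positive_linear[OF \<phi>])
  qed
  show "\<phi> (adj T \<star> S) = cnj (\<phi> (adj S \<star> T))"
    and "(cmod (\<phi> (adj S \<star> T)))\<^sup>2 \<le> Re (\<phi> (adj S \<star> S)) * Re (\<phi> (adj T \<star> T))"
    using positive_form_Cauchy_Schwarz[OF * positive_nonneg[OF \<phi> T]] by auto
qed

lemma positive_hermitian: "positive_functional \<phi> \<Longrightarrow> T \<in> A \<Longrightarrow> \<phi> (adj T) = cnj (\<phi> T)"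
  using positive_hermitian_form[of \<phi> E T] by simp

lemma positive_null_right:
  assumes "positive_functional \<phi>" "S \<in> A" "T \<in> A" "\<phi> (adj T \<star> T) = 0"
  shows "\<phi> (S \<star> T) = 0"
  using positive_Cauchy_Schwarz[of \<phi> "adj S" T] assms by simp

lemma positive_unit: "positive_functional \<phi> \<Longrightarrow> \<phi> E \<in> \<real>\<^sub>\<ge>\<^sub>0"
  using positive_nonneg[of \<phi> E] by simp

text \<open>Positivity bounds a functional: a square root of \<open>1 - T\<^sup>*T\<close> shows \<open>\<phi>(T\<^sup>*T) \<le> \<phi>(1)\<close>.\<close>

lemma positive_bounded:
  assumes \<phi>: "positive_functional \<phi>" and T: "T \<in> A"
  shows "cmod (\<phi> T) \<le> norm T * Re (\<phi> E)"
proof -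
  have unit_ball: "cmod (\<phi> S) \<le> Re (\<phi> E)" if S: "S \<in> A" "norm S \<le> 1" for S
  proof -
    have "norm (adj S \<star> S) \<le> 1"
      using norm_blinfun_compose[of "adj S" S] S mult_le_one[of "norm S" "norm S"] by simp
    then obtain Y where Y: "Y \<in> A" "adj Y = Y" "(E - Y) \<star> (E - Y) = E - adj S \<star> S"
      using sqrt_unit_minus[of "adj S \<star> S"] S by (auto simp: compose_assoc)
    have "\<phi> (adj (E - Y) \<star> (E - Y)) = \<phi> E - \<phi> (adj S \<star> S)"
      using Y S by (simp add: positive_linear[OF \<phi>])
    then have "Re (\<phi> (adj S \<star> S)) \<le> Re (\<phi> E)"
      using positive_nonneg[OF \<phi>, of "E - Y"] Y(1) by (simp add: complex_nonneg_Reals_iff)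
    moreover have "0 \<le> Re (\<phi> E)"
      using positive_unit[OF \<phi>] by (simp add: complex_nonneg_Reals_iff)
    ultimately have "Re (\<phi> E) * Re (\<phi> (adj S \<star> S)) \<le> (Re (\<phi> E))\<^sup>2"
      by (simp add: power2_eq_square mult_left_mono)
    then have "(cmod (\<phi> S))\<^sup>2 \<le> (Re (\<phi> E))\<^sup>2"
      using positive_Cauchy_Schwarz[OF \<phi> unit_mem S(1)] S(1) by simp
    then show ?thesis
      using \<open>0 \<le> Re (\<phi> E)\<close> power2_le_imp_le by blast
  qed
  show ?thesis
  proof (cases "T = 0")
    case False
    then have "cmod (\<phi> ((1 / norm T) *\<^sub>R T)) \<le> Re (\<phi> E)"
      using T by (intro unit_ball) auto
    then show ?thesis
      using False T by (simp add: positive_linear[OF \<phi>] norm_mult norm_divide field_simps)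
  qed (use \<phi> in \<open>simp add: positive_zero\<close>)
qed

lemma state_bounded: "state \<phi> \<Longrightarrow> T \<in> A \<Longrightarrow> cmod (\<phi> T) \<le> norm T"
  using positive_bounded[of \<phi> T] by (simp add: state_def)

lemma positive_continuous_on:
  assumes \<phi>: "positive_functional \<phi>"
  shows "continuous_on A \<phi>"
proof (rule continuous_onI)
  fix S e assume S: "S \<in> A" and "(e :: real) > 0"
  define C where "C = Re (\<phi> E) + 1"
  have "C > 0"
    using positive_unit[OF \<phi>] by (simp add: C_def complex_nonneg_Reals_iff)
  have "dist (\<phi> T) (\<phi> S) \<le> e" if "T \<in> A" "dist T S < e / C" for T
  proof -
    have "dist (\<phi> T) (\<phi> S) = cmod (\<phi> (T - S))"
      using that S by (simp add: dist_norm positive_linear[OF \<phi>])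
    also have "\<dots> \<le> norm (T - S) * Re (\<phi> E)"
      using that S by (intro positive_bounded[OF \<phi>]) auto
    also have "\<dots> \<le> norm (T - S) * C"
      by (intro mult_left_mono) (auto simp: C_def)
    also have "\<dots> \<le> e"
      using that(2) \<open>C > 0\<close> by (simp add: dist_norm field_simps)
    finally show ?thesis .
  qed
  then show "\<exists>d>0. \<forall>T\<in>A. dist T S < d \<longrightarrow> dist (\<phi> T) (\<phi> S) \<le> e"
    using \<open>C > 0\<close> \<open>e > 0\<close> by (intro exI[of _ "e / C"]) auto
qed

lemma closed_positive_vanishing:
  assumes \<phi>: "positive_functional \<phi>" and "P \<in> A" "R \<in> A"
  shows "closed {T \<in> A. \<phi> (P \<star> T \<star> R) = 0}"
proof (rule continuous_closed_preimage_constant[OF _ closed_algebra])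
  show "continuous_on A (\<lambda>T. \<phi> (P \<star> T \<star> R))"
    by (rule continuous_on_compose2[OF positive_continuous_on[OF \<phi>]])
      (use assms in \<open>auto intro!: continuous_on_compose_op continuous_intros\<close>)
qed

lemma positive_compress:
  assumes \<phi>: "positive_functional \<phi>" and X: "X \<in> A"
  shows "positive_functional (\<lambda>T. \<phi> (adj X \<star> T \<star> X))"
  unfolding positive_functional_def
proof (intro conjI ballI allI)
  fix T assume T: "T \<in> A"
  show "\<phi> (adj X \<star> (adj T \<star> T) \<star> X) \<in> \<real>\<^sub>\<ge>\<^sub>0"
    using positive_nonneg[OF \<phi>, of "T \<star> X"] X T by (simp add: compose_assoc)
qed (use X in \<open>simp_all add: compose_distribs positive_linear[OF \<phi>] op_scale_compose\<close>)

text \<open>Conversely, a functional whose norm is attained at the unit is positive. It is real at a selfadjoint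
  \<open>x\<close>, because \<open>\<bar>\<phi>(x) + it\<bar>\<^sup>2 \<le> \<parallel>x\<parallel>\<^sup>2 + t\<^sup>2\<close> for all real \<open>t\<close>; and \<open>\<bar>c\<^sup>2 - \<phi>(T\<^sup>*T)\<bar> \<le> c\<^sup>2\<close> with \<open>c = \<parallel>T\<parallel>\<close> then keeps
  \<open>\<phi>(T\<^sup>*T)\<close> from being negative.\<close>

lemma contractive_imp_positive:
  assumes add: "\<And>S T. S \<in> A \<Longrightarrow> T \<in> A \<Longrightarrow> \<phi> (S + T) = \<phi> S + \<phi> T"
    and scale: "\<And>c T. T \<in> A \<Longrightarrow> \<phi> (c *\<^sub>O T) = c * \<phi> T"
    and bound: "\<And>T. T \<in> A \<Longrightarrow> cmod (\<phi> T) \<le> norm T"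
    and unit: "\<phi> E = 1"
  shows "state \<phi>"
proof -
  have real: "\<phi> x \<in> \<real>" if x: "x \<in> A" "adj x = x" for x
  proof -
    have "Im (\<phi> x) * t * 2 + (Im (\<phi> x))\<^sup>2 \<le> (norm x)\<^sup>2" for t :: real
    proof -
      have "norm (x + (\<i> * t) *\<^sub>O E) \<le> sqrt ((norm x)\<^sup>2 + t\<^sup>2)"
      proof (rule norm_blinfun_bound)
        fix f
        define g where "g = E f"
        have g: "E g = g" "x f = x g" "norm g \<le> norm f"
          using unit_left[OF unit_mem] unit_right[OF x(1)] unit_apply_norm[of f]
          unfolding g_def by (metis blinfun_apply_blinfun_compose)+
        have "cinner (x g) g = cinner g (x g)"
          using is_adjoint_adj[OF x(1)] x(2) by (simp add: is_adjoint_def)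
        then have "Im (cinner (x g) g) = 0"
          by (metis Reals_cnj_iff cinner_commute complex_is_Real_iff)
        then have "inner (x g) ((\<i> * t) *\<^sub>C g) = 0"
          by (simp add: inner_ell2_def cinner_scaleC_right)
        then have "(norm (x g + (\<i> * t) *\<^sub>C g))\<^sup>2 = (norm (x g))\<^sup>2 + t\<^sup>2 * (norm g)\<^sup>2"
          by (subst norm_add_Pythagorean) (auto simp: orthogonal_def norm_scaleC norm_mult power_mult_distrib)
        also have "\<dots> \<le> (norm x * norm g)\<^sup>2 + t\<^sup>2 * (norm g)\<^sup>2"
          by (intro add_right_mono power_mono norm_blinfun norm_ge_zero)
        also have "\<dots> = ((norm x)\<^sup>2 + t\<^sup>2) * (norm g)\<^sup>2"
          by (simp add: power_mult_distrib algebra_simps)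
        finally have "norm (x g + (\<i> * t) *\<^sub>C g) \<le> sqrt (((norm x)\<^sup>2 + t\<^sup>2) * (norm g)\<^sup>2)"
          by (rule real_le_rsqrt)
        also have "\<dots> = sqrt ((norm x)\<^sup>2 + t\<^sup>2) * norm g"
          by (simp add: real_sqrt_mult)
        also have "\<dots> \<le> sqrt ((norm x)\<^sup>2 + t\<^sup>2) * norm f"
          by (intro mult_left_mono g) auto
        finally show "norm ((x + (\<i> * t) *\<^sub>O E) f) \<le> sqrt ((norm x)\<^sup>2 + t\<^sup>2) * norm f"
          by (simp add: op_apply_simps g g_def[symmetric])
      qed simp
      then have "cmod (\<phi> x + \<i> * t) \<le> sqrt ((norm x)\<^sup>2 + t\<^sup>2)"
        using bound[of "x + (\<i> * t) *\<^sub>O E"] x(1) by (simp add: add scale unit)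
      then have "(cmod (\<phi> x + \<i> * t))\<^sup>2 \<le> (sqrt ((norm x)\<^sup>2 + t\<^sup>2))\<^sup>2"
        by (rule power_mono) simp
      also have "\<dots> = (norm x)\<^sup>2 + t\<^sup>2"
        by simp
      finally have "(cmod (\<phi> x + \<i> * t))\<^sup>2 \<le> (norm x)\<^sup>2 + t\<^sup>2" .
      then have "(Re (\<phi> x))\<^sup>2 + (Im (\<phi> x) + t)\<^sup>2 \<le> (norm x)\<^sup>2 + t\<^sup>2"
        by (simp add: cmod_power2)
      then show ?thesis
        unfolding power2_sum using zero_le_power2[of "Re (\<phi> x)"] by linarith
    qed
    then have "Im (\<phi> x) = 0"
    proof -
      assume *: "\<And>t. Im (\<phi> x) * t * 2 + (Im (\<phi> x))\<^sup>2 \<le> (norm x)\<^sup>2"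
      show ?thesis
      proof (rule ccontr)
        assume "Im (\<phi> x) \<noteq> 0"
        \<comment> \<open>the value of \<open>t\<close> at which the linear term alone exceeds the bound\<close>
        define t where "t = ((norm x)\<^sup>2 + 1) / (2 * Im (\<phi> x))"
        have "Im (\<phi> x) * t * 2 = (norm x)\<^sup>2 + 1"
          unfolding t_def using \<open>Im (\<phi> x) \<noteq> 0\<close> by simp
        with *[of t] have "(Im (\<phi> x))\<^sup>2 + 1 \<le> 0"
          by simp
        then show False
          using zero_le_power2[of "Im (\<phi> x)"] by linarith
      qed
    qed
    then show ?thesis
      by (simp add: complex_is_Real_iff)
  qed
  have "\<phi> (adj T \<star> T) \<in> \<real>\<^sub>\<ge>\<^sub>0" if T: "T \<in> A" for T
  proof -
    let ?c = "(norm T)\<^sup>2" and ?x = "adj T \<star> T"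
    have "?c *\<^sub>R E - ?x = complex_of_real ?c *\<^sub>O E + (-1) *\<^sub>O ?x"
      by (simp add: scaleR_op_scale op_uminus[symmetric])
    then have "\<phi> (?c *\<^sub>R E - ?x) = ?c - \<phi> ?x"
      using T by (simp add: add scale unit)
    then have "cmod (?c - \<phi> ?x) \<le> ?c"
      using order_trans[OF bound[of "?c *\<^sub>R E - ?x"] norm_unit_minus_square[OF T order_refl]] T
      by simp
    then have "0 \<le> Re (\<phi> ?x)"
      using complex_Re_le_cmod[of "?c - \<phi> ?x"] by simp
    moreover have "\<phi> ?x \<in> \<real>"
      using T by (intro real) auto
    ultimately show ?thesis
      by (simp add: complex_nonneg_Reals_iff complex_is_Real_iff)
  qed
  then show ?thesis
    by (simp add: state_def positive_functional_def add scale unit)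
qed

end


lemmas compose_minus_left = bounded_bilinear.minus_left[OF bounded_bilinear_blinfun_compose]

context unital_cstar
begin

subsection \<open>Ideals and simplicity\<close>

lemma closed_idealD:
  assumes "closed_ideal I A"
  shows "T \<in> I \<Longrightarrow> T \<in> A" "0 \<in> I" "S \<in> I \<Longrightarrow> T \<in> I \<Longrightarrow> S + T \<in> I" "T \<in> I \<Longrightarrow> c *\<^sub>O T \<in> I"
    "S \<in> A \<Longrightarrow> T \<in> I \<Longrightarrow> S \<star> T \<in> I" "S \<in> A \<Longrightarrow> T \<in> I \<Longrightarrow> T \<star> S \<in> I" "closed I"
  using assms by (auto simp: closed_ideal_def)

lemma simple_iff:
  assumes "E \<noteq> 0"
  shows "simple_cstar_algebra A \<longleftrightarrow> (\<forall>I. closed_ideal I A \<longrightarrow> E \<notin> I \<longrightarrow> I = {0})"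
proof -
  have "I = A \<longleftrightarrow> E \<in> I" if "closed_ideal I A" for I
    using closed_idealD[OF that] unit_left by (metis subsetI subset_antisym unit_mem)
  moreover have "A \<noteq> {0}"
    using assms unit_mem by blast
  ultimately show ?thesis
    by (auto simp: simple_cstar_algebra_def)
qed

text \<open>The kernel of the representation that a positive functional generates.\<close>

lemma closed_ideal_vanishing:
  assumes \<phi>: "positive_functional \<phi>"
  shows "closed_ideal {T \<in> A. \<forall>P\<in>A. \<forall>R\<in>A. \<phi> (P \<star> T \<star> R) = 0} A" (is "closed_ideal ?J A")
  unfolding closed_ideal_def
proof (intro conjI ballI allI)
  fix S T assume "S \<in> A" "T \<in> ?J"
  moreover have "\<phi> (P \<star> (S \<star> T) \<star> R) = \<phi> ((P \<star> S) \<star> T \<star> R)"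
    and "\<phi> (P \<star> (T \<star> S) \<star> R) = \<phi> (P \<star> T \<star> (S \<star> R))" for P R
    by (simp_all add: compose_assoc)
  ultimately show "S \<star> T \<in> ?J" "T \<star> S \<in> ?J"
    by (simp_all del: compose_assoc)
next
  have "?J = (\<Inter>P\<in>A. \<Inter>R\<in>A. {T \<in> A. \<phi> (P \<star> T \<star> R) = 0})"
    using unit_mem by blast
  then show "closed ?J"
    by (simp only:) (intro closed_INT ballI closed_positive_vanishing \<phi>)
qed (auto simp: positive_linear[OF \<phi>] compose_distribs op_scale_compose)

text \<open>If a selfadjoint \<open>h\<close> is positive in the representation of one state of a simple algebra, it is
  positive: with the negative part \<open>q\<close> of \<open>h\<close>, positivity and \<open>q h q = - q\<^sup>3\<close> force \<open>\<psi>(z\<^sup>*q\<^sup>3z) = 0\<close> for all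
  \<open>z\<close>, and the elements that a state annihilates in this way form a proper ideal. The square roots
  provide \<open>\<bar>h\<bar>\<close> and its own root \<open>v\<close>.\<close>

lemma simple_positive_square:
  assumes simple: "simple_cstar_algebra A" and \<psi>: "state \<psi>" and h: "h \<in> A" "adj h = h"
    and nonneg: "\<And>z. z \<in> A \<Longrightarrow> Re (\<psi> (adj z \<star> h \<star> z)) \<ge> 0"
  obtains v c where "v \<in> A" "adj v = v" "c \<ge> 0" "h = c *\<^sub>R (v \<star> v)"
proof (cases "h = 0")
  case True
  then show ?thesis
    using that[of 0 0] adj_uminus[of 0] adj_scale[of 0 0] by simp
next
  case False
  note pos = state_positive[OF \<psi>]
  define c where "c = norm h"
  define k where "k = (1 / c) *\<^sub>R h"
  have c: "c > 0"
    using False by (simp add: c_def)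
  have h_k: "h = c *\<^sub>R k"
    using c by (simp add: k_def)
  have k: "k \<in> A" "adj k = k" "norm k \<le> 1"
    using h c by (simp_all add: k_def c_def)
  have "norm (E - k \<star> k) \<le> 1"
    using norm_unit_minus_square[of k 1] k by simp
  then obtain Y where Y: "Y \<in> A" "adj Y = Y" "norm Y \<le> 1" "(E - Y) \<star> (E - Y) = E - (E - k \<star> k)"
    and Y_comm: "\<And>Z. Z \<star> (E - k \<star> k) = (E - k \<star> k) \<star> Z \<Longrightarrow> Z \<star> Y = Y \<star> Z"
    using sqrt_unit_minus[of "E - k \<star> k"] k by auto
  obtain X where X: "X \<in> A" "adj X = X" "(E - X) \<star> (E - X) = E - Y"
    using sqrt_unit_minus[OF Y(1-3)] by blast
  define r where "r = E - Y"
  define v where "v = E - X"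
  have r: "r \<in> A" "adj r = r" "r \<star> r = k \<star> k" and v: "v \<in> A" "adj v = v" "v \<star> v = r"
    using X Y by (auto simp: r_def v_def)
  have "k \<star> Y = Y \<star> k"
    using k by (intro Y_comm) (simp add: compose_distribs compose_assoc)
  then have rk: "k \<star> r = r \<star> k"
    using k Y by (simp add: r_def compose_distribs)
  define p where "p = (1/2) *\<^sub>R (r + k)"
  define q where "q = (1/2) *\<^sub>R (r - k)"
  have p: "p \<in> A" and q: "q \<in> A" "adj q = q"
    using r k by (simp_all add: p_def q_def)
  have kpq: "k = p - q" and rpq: "r = p + q"
    by (simp_all add: p_def q_def flip: scaleR_diff_right scaleR_add_right)
  have qp: "q \<star> p = 0"
    by (simp add: p_def q_def compose_scaleR_left compose_scaleR_right compose_distribs r(3) rk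
        flip: scaleR_add_right)
  have qkq: "q \<star> k \<star> q = - (q \<star> q \<star> q)" and qrq: "q \<star> r \<star> q = q \<star> q \<star> q"
    unfolding kpq rpq by (simp_all add: compose_distribs compose_minus_left qp)
  have vq: "v \<star> q \<in> {T \<in> A. \<forall>P\<in>A. \<forall>R\<in>A. \<psi> (P \<star> T \<star> R) = 0}"
  proof (intro CollectI conjI ballI)
    fix P z assume P: "P \<in> A" and z: "z \<in> A"
    define w where "w = v \<star> q \<star> z"
    have w: "w \<in> A"
      using v q z by (simp add: w_def)
    have "adj w \<star> w = adj z \<star> (q \<star> (v \<star> v) \<star> q) \<star> z"
      using v(1,2) q z by (simp add: w_def compose_assoc)
    also have "\<dots> = adj z \<star> (q \<star> q \<star> q) \<star> z"
      by (simp only: v(3) qrq)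
    finally have ww: "adj w \<star> w = adj z \<star> (q \<star> q \<star> q) \<star> z" .
    have "adj (q \<star> z) \<star> h \<star> (q \<star> z) = c *\<^sub>R (adj z \<star> (q \<star> k \<star> q) \<star> z)"
      using q z by (simp add: h_k compose_scaleR_left compose_scaleR_right compose_assoc)
    also have "\<dots> = - (c *\<^sub>R (adj w \<star> w))"
      unfolding qkq ww by (simp add: op_uminus compose_op_scale clin z op_scale_compose q
          scaleR_op_scale mult.commute)
    finally have "- (c * Re (\<psi> (adj w \<star> w))) \<ge> 0"
      using nonneg[of "q \<star> z"] q z w by (simp add: positive_linear[OF pos])
    then have "Re (\<psi> (adj w \<star> w)) \<le> 0"
      using c by (simp add: mult_le_0_iff)
    then have "\<psi> (adj w \<star> w) = 0"
      using positive_nonneg[OF pos w] by (simp add: complex_nonneg_Reals_iff complex_eq_iff)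
    then show "\<psi> (P \<star> (v \<star> q) \<star> z) = 0"
      using positive_null_right[OF pos P w] by (simp add: w_def compose_assoc)
  qed (use v q in auto)
  have "E \<noteq> 0"
    using state_unit[OF \<psi>] positive_zero[OF pos] by auto
  moreover have "E \<notin> {T \<in> A. \<forall>P\<in>A. \<forall>R\<in>A. \<psi> (P \<star> T \<star> R) = 0}"
  proof -
    have "\<psi> (E \<star> E \<star> E) \<noteq> 0"
      using state_unit[OF \<psi>] by simp
    then show ?thesis
      using unit_mem by blast
  qed
  ultimately have "v \<star> q = 0"
    using simple closed_ideal_vanishing[OF pos] vq unfolding simple_iff[OF \<open>E \<noteq> 0\<close>] by blast
  have "q \<star> q \<star> q = q \<star> v \<star> (v \<star> q)"
    unfolding qrq[symmetric] v(3)[symmetric] by (simp add: compose_assoc)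
  then have "q \<star> q \<star> q = 0"
    by (simp add: \<open>v \<star> q = 0\<close>)
  then have "adj (q \<star> q) \<star> (q \<star> q) = 0"
    using q by (simp add: compose_assoc[symmetric])
  then have "adj q \<star> q = 0"
    using q adj_mult_self_zero[of "q \<star> q"] by simp
  then have "q = 0"
    using q adj_mult_self_zero by blast
  then have "h = c *\<^sub>R (v \<star> v)"
    using h_k kpq rpq v(3) by simp
  then show ?thesis
    using that[of v c] v c by simp
qed

end

section \<open>The Hahn-Banach theorem\<close>

text \<open>A linear functional on a subspace is given by its graph, so that no well-definedness has to be
  checked: the bound \<open>a \<le> \<parallel>x\<parallel>\<close> on the graph implies it. A maximal graph is total since the values
  admissible at a new point \<open>x\<^sub>0\<close> lie between \<open>a - \<parallel>x - x\<^sub>0\<parallel>\<close> and \<open>\<parallel>y + x\<^sub>0\<parallel> - b\<close>, and every lower bound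
  is at most every upper bound.\<close>

lemma hahn_banach_graph:
  fixes \<Gamma>\<^sub>0 :: "('v::real_normed_vector \<times> real) set"
  assumes sub: "subspace \<Gamma>\<^sub>0" and bound: "\<And>x a. (x, a) \<in> \<Gamma>\<^sub>0 \<Longrightarrow> a \<le> norm x"
  obtains g :: "'v \<Rightarrow> real" where "linear g" "\<And>x. g x \<le> norm x" "\<And>x a. (x, a) \<in> \<Gamma>\<^sub>0 \<Longrightarrow> g x = a"
proof -
  define \<A> where "\<A> = {\<Gamma> :: ('v \<times> real) set. \<Gamma>\<^sub>0 \<subseteq> \<Gamma> \<and> subspace \<Gamma> \<and> (\<forall>(x, a) \<in> \<Gamma>. a \<le> norm x)}"
  have "\<exists>M\<in>\<A>. \<forall>X\<in>\<A>. M \<subseteq> X \<longrightarrow> X = M"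
  proof (rule subset_Zorn_nonempty)
    show "\<A> \<noteq> {}"
      using assms by (auto simp: \<A>_def)
    fix \<C> assume ne: "\<C> \<noteq> {}" and ch: "subset.chain \<A> \<C>"
    have sub: "subspace \<Gamma>" if "\<Gamma> \<in> \<C>" for \<Gamma>
      using ch that by (auto simp: subset.chain_def \<A>_def)
    have "subspace (\<Union>\<C>)"
    proof (rule subspaceI)
      show "0 \<in> \<Union>\<C>"
        using ne sub subspace_0 by blast
      fix u v assume "u \<in> \<Union>\<C>" "v \<in> \<Union>\<C>"
      then obtain \<Gamma> \<Delta> where *: "\<Gamma> \<in> \<C>" "\<Delta> \<in> \<C>" "u \<in> \<Gamma>" "v \<in> \<Delta>"
        by blast
      then have "\<Gamma> \<subseteq> \<Delta> \<or> \<Delta> \<subseteq> \<Gamma>"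
        using ch by (auto simp: subset.chain_def)
      then show "u + v \<in> \<Union>\<C>"
        using * sub subspace_add by blast
    next
      fix r u assume "u \<in> \<Union>\<C>"
      then show "r *\<^sub>R u \<in> \<Union>\<C>"
        using sub subspace_scale by blast
    qed
    then show "\<Union>\<C> \<in> \<A>"
      using ch ne by (fastforce simp: subset.chain_def \<A>_def)
  qed
  then obtain M where M: "M \<in> \<A>" and max: "\<And>X. X \<in> \<A> \<Longrightarrow> M \<subseteq> X \<Longrightarrow> X = M"
    by blast
  have M_sub: "subspace M" and M_bound: "\<And>x a. (x, a) \<in> M \<Longrightarrow> a \<le> norm x" and M_ext: "\<Gamma>\<^sub>0 \<subseteq> M"
    using M by (auto simp: \<A>_def)
  have single_valued: "a = b" if "(x, a) \<in> M" "(x, b) \<in> M" for x a b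
    using subspace_diff[OF M_sub that] subspace_diff[OF M_sub that(2,1)]
      M_bound[of 0 "a - b"] M_bound[of 0 "b - a"] by simp
  have total: "\<exists>a. (x\<^sub>0, a) \<in> M" for x\<^sub>0
  proof (rule ccontr)
    assume no: "\<nexists>a. (x\<^sub>0, a) \<in> M"
    define L where "L = {a - norm (x - x\<^sub>0) |x a. (x, a) \<in> M}"
    have key: "a - norm (x - x\<^sub>0) \<le> norm (y + x\<^sub>0) - b" if "(x, a) \<in> M" "(y, b) \<in> M" for x a y b
    proof -
      have "a + b \<le> norm (x + y)"
        using subspace_add[OF M_sub that] M_bound by force
      also have "\<dots> \<le> norm (x - x\<^sub>0) + norm (y + x\<^sub>0)"
        using norm_triangle_ineq[of "x - x\<^sub>0" "y + x\<^sub>0"] by simp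
      finally show ?thesis
        by simp
    qed
    have "(0, 0) \<in> M"
      using subspace_0[OF M_sub] by (simp add: zero_prod_def)
    then have "L \<noteq> {}" "bdd_above L"
      using key[OF _ \<open>(0, 0) \<in> M\<close>] by (auto simp: L_def intro!: bdd_aboveI[of _ "norm (0 + x\<^sub>0) - 0"])
    define \<alpha> where "\<alpha> = Sup L"
    have lower: "a - norm (x - x\<^sub>0) \<le> \<alpha>" if "(x, a) \<in> M" for x a
      unfolding \<alpha>_def using that by (intro cSup_upper \<open>bdd_above L\<close>) (auto simp: L_def)
    have upper: "\<alpha> \<le> norm (y + x\<^sub>0) - b" if "(y, b) \<in> M" for y b
      unfolding \<alpha>_def using key[OF _ that] by (intro cSup_least \<open>L \<noteq> {}\<close>) (auto simp: L_def)
    define M' where "M' = {u + t *\<^sub>R (x\<^sub>0, \<alpha>) |u t. u \<in> M}"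
    have "subspace M'"
    proof (rule subspaceI)
      show "0 \<in> M'"
        unfolding M'_def by (rule CollectI, rule exI[of _ 0], rule exI[of _ 0])
            (use \<open>(0, 0) \<in> M\<close> in \<open>simp add: zero_prod_def\<close>)
      fix u v assume "u \<in> M'" "v \<in> M'"
      then obtain u' s v' t where "u = u' + s *\<^sub>R (x\<^sub>0, \<alpha>)" "v = v' + t *\<^sub>R (x\<^sub>0, \<alpha>)" "u' \<in> M" "v' \<in> M"
        unfolding M'_def by blast
      then show "u + v \<in> M'"
        unfolding M'_def using subspace_add[OF M_sub]
        by (intro CollectI exI[of _ "u' + v'"] exI[of _ "s + t"]) (simp add: scaleR_add_left ac_simps del: scaleR_Pair)
    next
      fix r u assume "u \<in> M'"
      then obtain u' s where "u = u' + s *\<^sub>R (x\<^sub>0, \<alpha>)" "u' \<in> M"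
        unfolding M'_def by blast
      then show "r *\<^sub>R u \<in> M'"
        unfolding M'_def using subspace_scale[OF M_sub]
        by (intro CollectI exI[of _ "r *\<^sub>R u'"] exI[of _ "r * s"]) (simp add: scaleR_add_right del: scaleR_Pair)
    qed
    moreover have "a \<le> norm x" if xa: "(x, a) \<in> M'" for x a
    proof -
      obtain y b t where y: "x = y + t *\<^sub>R x\<^sub>0" "a = b + t * \<alpha>" "(y, b) \<in> M"
        using xa unfolding M'_def by force
      consider "t = 0" | "t > 0" | "t < 0" by linarith
      then show ?thesis
      proof cases
        case 1
        then show ?thesis using y M_bound by simp
      next
        case 2
        have "\<alpha> \<le> norm ((1/t) *\<^sub>R y + x\<^sub>0) - (1/t) * b"
          using subspace_scale[OF M_sub y(3), of "1/t"] by (intro upper) simp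
        then have "t * \<alpha> \<le> t * (norm ((1/t) *\<^sub>R y + x\<^sub>0) - (1/t) * b)"
          using 2 by (intro mult_left_mono) auto
        then have "t * \<alpha> \<le> t * norm ((1/t) *\<^sub>R y + x\<^sub>0) - b"
          using 2 by (simp add: right_diff_distrib)
        also have "t * norm ((1/t) *\<^sub>R y + x\<^sub>0) = norm (t *\<^sub>R ((1/t) *\<^sub>R y + x\<^sub>0))"
          using 2 by simp
        also have "t *\<^sub>R ((1/t) *\<^sub>R y + x\<^sub>0) = x"
          using 2 y by (simp add: scaleR_add_right)
        finally show ?thesis
          using y by simp
      next
        case 3
        have "(- 1/t) * b - norm ((- 1/t) *\<^sub>R y - x\<^sub>0) \<le> \<alpha>"
          using subspace_scale[OF M_sub y(3), of "- 1/t"] by (intro lower) simp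
        then have "(- t) * ((- 1/t) * b - norm ((- 1/t) *\<^sub>R y - x\<^sub>0)) \<le> (- t) * \<alpha>"
          using 3 by (intro mult_left_mono) auto
        then have "b - (- t) * norm ((- 1/t) *\<^sub>R y - x\<^sub>0) \<le> (- t) * \<alpha>"
          using 3 by (simp add: right_diff_distrib)
        also have "(- t) * norm ((- 1/t) *\<^sub>R y - x\<^sub>0) = norm ((- t) *\<^sub>R ((- 1/t) *\<^sub>R y - x\<^sub>0))"
          using 3 by simp
        also have "(- t) *\<^sub>R ((- 1/t) *\<^sub>R y - x\<^sub>0) = x"
          using 3 y by (simp add: scaleR_diff_right)
        finally show ?thesis
          using y by simp
      qed
    qed
    moreover have "M \<subseteq> M'"
      unfolding M'_def by (force intro: exI[of _ "0::real"])
    ultimately have "M' = M"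
      using M_ext by (intro max) (auto simp: \<A>_def)
    moreover have "(x\<^sub>0, \<alpha>) \<in> M'"
      unfolding M'_def using subspace_0[OF M_sub]
      by (intro CollectI exI[of _ 0] exI[of _ 1]) (simp add: zero_prod_def)
    ultimately show False
      using no by blast
  qed
  define g where "g x = (THE a. (x, a) \<in> M)" for x
  have g: "(x, g x) \<in> M" for x
    unfolding g_def using total[of x] single_valued by (metis (mono_tags, lifting) theI)
  have g_eq: "g x = a" if "(x, a) \<in> M" for x a
    using single_valued[OF g that] .
  show ?thesis
  proof (rule that[of g])
    show "linear g"
    proof (rule linearI)
      show "g (x + y) = g x + g y" for x y
        using subspace_add[OF M_sub g[of x] g[of y]] by (intro g_eq) simp
      show "g (r *\<^sub>R x) = r *\<^sub>R g x" for r x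
        using subspace_scale[OF M_sub g[of x], of r] by (intro g_eq) simp
    qed
    show "g x \<le> norm x" for x
      using M_bound[OF g] .
    show "g x = a" if "(x, a) \<in> \<Gamma>\<^sub>0" for x a
      using g_eq that M_ext by blast
  qed
qed

text \<open>The complex version for operators: a complex-linear functional is determined by its real part.\<close>

lemma hahn_banach_operators:
  fixes \<Gamma> :: "('a operator \<times> complex) set"
  assumes zero: "(0, 0) \<in> \<Gamma>"
    and add: "\<And>S a T b. (S, a) \<in> \<Gamma> \<Longrightarrow> (T, b) \<in> \<Gamma> \<Longrightarrow> (S + T, a + b) \<in> \<Gamma>"
    and scale: "\<And>c T a. (T, a) \<in> \<Gamma> \<Longrightarrow> (c *\<^sub>O T, c * a) \<in> \<Gamma>"
    and bound: "\<And>T a. (T, a) \<in> \<Gamma> \<Longrightarrow> cmod a \<le> norm T"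
  obtains \<phi> where "\<And>S T. \<phi> (S + T) = \<phi> S + \<phi> T" "\<And>c T. \<phi> (c *\<^sub>O T) = c * \<phi> T"
    "\<And>T. cmod (\<phi> T) \<le> norm T" "\<And>T a. (T, a) \<in> \<Gamma> \<Longrightarrow> \<phi> T = a"
proof -
  define \<Gamma>\<^sub>0 where "\<Gamma>\<^sub>0 = (\<lambda>(T, a). (T, Re a)) ` \<Gamma>"
  have "subspace \<Gamma>\<^sub>0"
  proof (rule subspaceI)
    show "0 \<in> \<Gamma>\<^sub>0"
      unfolding \<Gamma>\<^sub>0_def by (rule image_eqI[OF _ zero]) (simp add: zero_prod_def)
    fix u v assume "u \<in> \<Gamma>\<^sub>0" "v \<in> \<Gamma>\<^sub>0"
    then obtain S a T b where "u = (S, Re a)" "v = (T, Re b)" "(S, a) \<in> \<Gamma>" "(T, b) \<in> \<Gamma>"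
      by (auto simp: \<Gamma>\<^sub>0_def)
    then show "u + v \<in> \<Gamma>\<^sub>0"
      unfolding \<Gamma>\<^sub>0_def by (intro image_eqI[OF _ add[of S a T b]]) auto
  next
    fix r u assume "u \<in> \<Gamma>\<^sub>0"
    then obtain S a where "u = (S, Re a)" "(S, a) \<in> \<Gamma>"
      by (auto simp: \<Gamma>\<^sub>0_def)
    then show "r *\<^sub>R u \<in> \<Gamma>\<^sub>0"
      unfolding \<Gamma>\<^sub>0_def by (intro image_eqI[OF _ scale[of S a "complex_of_real r"]]) (auto simp: scaleR_op_scale)
  qed
  moreover have "a \<le> norm T" if "(T, a) \<in> \<Gamma>\<^sub>0" for T a
    using that bound complex_Re_le_cmod order_trans by (fastforce simp: \<Gamma>\<^sub>0_def)
  ultimately have "\<exists>g. linear g \<and> (\<forall>T. g T \<le> norm T) \<and> (\<forall>T a. (T, a) \<in> \<Gamma>\<^sub>0 \<longrightarrow> g T = a)"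
    using hahn_banach_graph[of \<Gamma>\<^sub>0] by metis
  then obtain g :: "'a operator \<Rightarrow> real" where g: "linear g" "\<And>T. g T \<le> norm T"
      "\<And>T a. (T, a) \<in> \<Gamma>\<^sub>0 \<Longrightarrow> g T = a"
    by metis
  define \<phi> where "\<phi> T = Complex (g T) (- g (\<i> *\<^sub>O T))" for T
  have \<phi>_add: "\<phi> (S + T) = \<phi> S + \<phi> T" for S T
    by (simp add: \<phi>_def linear_add[OF g(1)] op_scale_add_right complex_eq_iff)
  have gR: "g (complex_of_real r *\<^sub>O T) = r * g T" for r T
    using linear_scale[OF g(1), of r T] by (simp add: scaleR_op_scale)
  have \<phi>_scale: "\<phi> (c *\<^sub>O T) = c * \<phi> T" for c T
  proof -
    have "c *\<^sub>O T = complex_of_real (Re c) *\<^sub>O T + complex_of_real (Im c) *\<^sub>O \<i> *\<^sub>O T"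
      and "\<i> *\<^sub>O c *\<^sub>O T = complex_of_real (Re c) *\<^sub>O \<i> *\<^sub>O T + complex_of_real (- Im c) *\<^sub>O T"
      by (simp_all add: op_scale_add_left[symmetric] complex_eq_iff[of _ c] complex_eq_iff[of _ "\<i> * c"]
          del: of_real_minus)
        (auto intro!: arg_cong[where f = "\<lambda>c. c *\<^sub>O T"] simp: complex_eq_iff)
    then show ?thesis
      unfolding \<phi>_def by (simp only: linear_add[OF g(1)] gR) (simp add: complex_eq_iff)
  qed
  have "cmod (\<phi> T) \<le> norm T" for T
  proof (cases "\<phi> T = 0")
    case False
    define c where "c = cnj (\<phi> T) / cmod (\<phi> T)"
    have c: "cmod c = 1" "c * \<phi> T = cmod (\<phi> T)"
      using False by (simp_all add: c_def norm_divide field_simps)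
        (metis complex_norm_square mult.commute of_real_mult power2_eq_square)
    have "cmod (\<phi> T) = Re (\<phi> (c *\<^sub>O T))"
      by (simp add: \<phi>_scale c)
    also have "\<dots> \<le> norm (c *\<^sub>O T)"
      using g(2) by (simp add: \<phi>_def)
    finally show ?thesis
      by (simp add: norm_op_scale c)
  qed simp
  moreover have "\<phi> T = a" if "(T, a) \<in> \<Gamma>" for T a
  proof -
    have "(T, Re a) \<in> \<Gamma>\<^sub>0" if "(T, a) \<in> \<Gamma>" for T a
      using that unfolding \<Gamma>\<^sub>0_def by force
    then have "g T = Re a" "g (\<i> *\<^sub>O T) = Re (\<i> * a)"
      using that scale[OF that, of \<i>] by (blast intro: g(3))+
    then show ?thesis
      by (simp add: \<phi>_def complex_eq_iff)
  qed
  ultimately show ?thesis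
    using that[of \<phi>] \<phi>_add \<phi>_scale by blast
qed

text \<open>The distance from the unit to a proper closed ideal is at least \<open>1\<close>: if \<open>z = 1 - y\<close> with \<open>y\<close> in the ideal,
  then every power of \<open>z\<close> is congruent to \<open>1\<close>, and these powers tend to \<open>0\<close> when \<open>\<parallel>z\<parallel> < 1\<close>.\<close>

lemma (in unital_cstar) exists_state_vanishing_on_ideal:
  assumes I: "closed_ideal I A" and "E \<notin> I"
  obtains \<phi> where "state \<phi>" "\<And>T. T \<in> I \<Longrightarrow> \<phi> T = 0"
proof -
  note I_simps = closed_idealD[OF I]
  have I_diff: "S - T \<in> I" if "S \<in> I" "T \<in> I" for S T
    using I_simps(3)[OF that(1) I_simps(4)[OF that(2), of "-1"]] by (simp flip: op_uminus)
  have dist1: "1 \<le> norm (E - y)" if y: "y \<in> I" for y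
  proof (rule ccontr)
    assume "\<not> 1 \<le> norm (E - y)"
    define z where "z = E - y"
    have z: "z \<in> A" "norm z < 1"
      using \<open>\<not> 1 \<le> norm (E - y)\<close> I_simps(1)[OF y] by (auto simp: z_def)
    define Z where "Z = rec_nat E (\<lambda>_ T. T \<star> z)"
    have Z_simps: "Z 0 = E" "\<And>n. Z (Suc n) = Z n \<star> z"
      by (simp_all add: Z_def)
    have ZA: "Z n \<in> A" for n
      by (induction n) (use z in \<open>simp_all add: Z_simps\<close>)
    have "E - Z n \<in> I" for n
    proof (induction n)
      case (Suc n)
      have "E - Z (Suc n) = (E - Z n) + Z n \<star> y"
        using ZA[of n] by (simp add: Z_simps z_def compose_distribs)
      show ?case
        unfolding \<open>E - Z (Suc n) = _\<close> by (rule I_simps(3)[OF Suc I_simps(5)[OF ZA y]])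
    qed (use I_simps in \<open>simp add: Z_simps\<close>)
    moreover have "Z \<longlonglongrightarrow> 0"
    proof (rule Lim_null_comparison)
      have "norm (Z n) \<le> norm z ^ n" for n
      proof (induction n)
        case (Suc n)
        then show ?case
          using norm_blinfun_compose[of "Z n" z] mult_right_mono[OF Suc norm_ge_zero[of z]]
          by (simp add: Z_simps mult.commute)
      qed (simp add: Z_simps norm_unit)
      then show "\<forall>\<^sub>F n in sequentially. norm (Z n) \<le> norm z ^ n"
        by simp
      show "(\<lambda>n. norm z ^ n) \<longlonglongrightarrow> 0"
        using z(2) by (intro LIMSEQ_power_zero) simp
    qed
    then have "(\<lambda>n. E - Z n) \<longlonglongrightarrow> E - 0"
      by (intro tendsto_intros)
    ultimately have "E \<in> I"
      using closed_sequentially[OF I_simps(7)] by (metis diff_zero)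
    with \<open>E \<notin> I\<close> show False ..
  qed
  define \<Gamma> where "\<Gamma> = {(c *\<^sub>O E + y, c) |c y. y \<in> I}"
  obtain \<phi> where \<phi>: "\<And>S T. \<phi> (S + T) = \<phi> S + \<phi> T" "\<And>c T. \<phi> (c *\<^sub>O T) = c * \<phi> T"
    "\<And>T. cmod (\<phi> T) \<le> norm T" "\<And>T a. (T, a) \<in> \<Gamma> \<Longrightarrow> \<phi> T = a"
  proof (rule hahn_banach_operators[of \<Gamma>])
    show "(0, 0) \<in> \<Gamma>"
      unfolding \<Gamma>_def using I_simps(2) by (intro CollectI exI[of _ 0]) simp
    fix S a T b assume "(S, a) \<in> \<Gamma>" "(T, b) \<in> \<Gamma>"
    then obtain y z where "S = a *\<^sub>O E + y" "T = b *\<^sub>O E + z" "y \<in> I" "z \<in> I"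
      by (auto simp: \<Gamma>_def)
    then show "(S + T, a + b) \<in> \<Gamma>"
      unfolding \<Gamma>_def using I_simps(3)[of y z]
      by (intro CollectI exI[of _ "a + b"] exI[of _ "y + z"]) (simp add: op_scale_add_left)
  next
    fix c T a assume "(T, a) \<in> \<Gamma>"
    then obtain y where "T = a *\<^sub>O E + y" "y \<in> I"
      by (auto simp: \<Gamma>_def)
    then show "(c *\<^sub>O T, c * a) \<in> \<Gamma>"
      unfolding \<Gamma>_def using I_simps(4)[of y c]
      by (intro CollectI exI[of _ "c * a"] exI[of _ "c *\<^sub>O y"]) (simp add: op_scale_add_right)
  next
    fix T a assume "(T, a) \<in> \<Gamma>"
    then obtain y where y: "T = a *\<^sub>O E + y" "y \<in> I"
      by (auto simp: \<Gamma>_def)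
    show "cmod a \<le> norm T"
    proof (cases "a = 0")
      case False
      have "T = a *\<^sub>O (E - (- 1 / a) *\<^sub>O y)"
        using False y by (simp add: op_uminus compose_distribs op_scale_add_right
            diff_conv_add_uminus del: add_uminus_conv_diff)
      then have "norm T = cmod a * norm (E - (- 1 / a) *\<^sub>O y)"
        by (metis norm_op_scale)
      then show ?thesis
        using dist1[OF I_simps(4)[OF y(2)]] by (simp add: mult_le_cancel_left1)
    qed simp
  qed blast
  have "\<phi> E = 1"
    using I_simps(2) by (intro \<phi>(4)) (auto simp: \<Gamma>_def intro!: exI[of _ 1] exI[of _ 0])
  moreover have "\<phi> T = 0" if "T \<in> I" for T
    using that by (intro \<phi>(4)) (auto simp: \<Gamma>_def intro!: exI[of _ 0])
  ultimately show ?thesis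
    using that[of \<phi>] contractive_imp_positive[of \<phi>] \<phi> by blast
qed


section \<open>Reduced group C*-algebras\<close>

context group
begin

abbreviation (input) U :: "'a \<Rightarrow> 'a operator" where "U \<equiv> left_regular G"
abbreviation (input) A :: "'a operator set" where "A \<equiv> reduced_cstar_algebra G"

lemma left_regular_apply':
  "g \<in> carrier G \<Longrightarrow> ell2_apply (U g f) x = (if x \<in> carrier G then ell2_apply f (inv g \<otimes> x) else 0)"
  by (rule left_regular_apply) unfold_locales

lemma left_regular_mult:
  "g \<in> carrier G \<Longrightarrow> h \<in> carrier G \<Longrightarrow> U g \<star> U h = U (g \<otimes> h)"
  by (rule blinfun_eqI, rule ell2_eqI) (auto simp: left_regular_apply' inv_mult_group m_assoc)

lemma left_regular_complex_linear: "g \<in> carrier G \<Longrightarrow> complex_linear (U g)"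
  unfolding complex_linear_def
  by (intro allI ell2_eqI) (auto simp: left_regular_apply' scaleC.rep_eq)

lemma left_regular_adjoint:
  assumes g: "g \<in> carrier G"
  shows "is_adjoint (U (inv g)) (U g)"
  unfolding is_adjoint_def
proof (intro allI)
  fix f h
  have bij: "bij_betw (\<lambda>x. g \<otimes> x) (carrier G) (carrier G)"
    using g by (intro bij_betwI[of _ _ _ "\<lambda>x. inv g \<otimes> x"]) (auto simp flip: m_assoc)
  have "cinner (U g f) h
      = (\<Sum>\<^sub>\<infinity>x\<in>carrier G. ell2_apply f (inv g \<otimes> x) * cnj (ell2_apply h x))"
    unfolding cinner.rep_eq by (intro infsum_cong_neutral) (auto simp: left_regular_apply' g)
  also have "\<dots> = (\<Sum>\<^sub>\<infinity>x\<in>carrier G. ell2_apply f (inv g \<otimes> (g \<otimes> x)) * cnj (ell2_apply h (g \<otimes> x)))"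
    by (rule infsum_reindex_bij_betw[OF bij, symmetric])
  also have "\<dots> = (\<Sum>\<^sub>\<infinity>x\<in>carrier G. ell2_apply f x * cnj (ell2_apply h (g \<otimes> x)))"
    using g by (intro infsum_cong) (simp flip: m_assoc)
  also have "\<dots> = cinner f (U (inv g) h)"
    unfolding cinner.rep_eq by (intro infsum_cong_neutral) (auto simp: left_regular_apply' g)
  finally show "cinner (U g f) h = cinner f (U (inv g) h)" .
qed

lemma left_regular_delta:
  assumes "g \<in> carrier G" "x \<in> carrier G"
  shows "U g (delta x) = delta (g \<otimes> x)"
proof (rule ell2_eqI)
  fix y
  have "inv g \<otimes> y = x \<longleftrightarrow> y = g \<otimes> x" if "y \<in> carrier G"
    using assms that inv_solve_left' by metis
  then show "ell2_apply (U g (delta x)) y = ell2_apply (delta (g \<otimes> x)) y"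
    using assms by (auto simp: left_regular_apply' delta.rep_eq)
qed

lemma left_regular_one_delta: "x \<notin> carrier G \<Longrightarrow> U \<one> (delta x) = 0"
  by (rule ell2_eqI) (auto simp: left_regular_apply' delta.rep_eq zero_ell2.rep_eq)

inductive_set group_span :: "'a operator set" where
  zero: "0 \<in> group_span"
| step: "T \<in> group_span \<Longrightarrow> g \<in> carrier G \<Longrightarrow> c *\<^sub>O U g + T \<in> group_span"

lemma group_span_add: "S \<in> group_span \<Longrightarrow> T \<in> group_span \<Longrightarrow> S + T \<in> group_span"
  by (induction rule: group_span.induct) (auto simp: add.assoc intro: group_span.intros)

lemma group_span_scale: "T \<in> group_span \<Longrightarrow> c *\<^sub>O T \<in> group_span"
  by (induction rule: group_span.induct) (auto simp: op_scale_add_right intro: group_span.intros)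

lemma group_span_generator: "g \<in> carrier G \<Longrightarrow> c *\<^sub>O U g \<in> group_span"
  using group_span.step[OF group_span.zero] by simp

lemma group_span_mult: "S \<in> group_span \<Longrightarrow> T \<in> group_span \<Longrightarrow> S \<star> T \<in> group_span"
proof (induction rule: group_span.induct)
  case (step S g c)
  have "U g \<star> T \<in> group_span"
    using step.prems step.hyps(2)
    by (induction rule: group_span.induct)
      (auto simp: compose_add_right compose_op_scale left_regular_complex_linear left_regular_mult
        intro!: group_span.intros)
  then show ?case
    using step by (simp add: compose_add_left op_scale_compose group_span_add group_span_scale)
qed (simp add: group_span.zero)

lemma group_span_adjoint: "T \<in> group_span \<Longrightarrow> \<exists>S\<in>group_span. is_adjoint S T"
proof (induction rule: group_span.induct)
  case zero
  show ?case
    by (rule bexI[OF _ group_span.zero]) (simp add: is_adjoint_def op_apply_simps)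
next
  case (step T g c)
  then obtain S where S: "S \<in> group_span" "is_adjoint S T"
    by blast
  have "is_adjoint (cnj c *\<^sub>O U (inv g) + S) (c *\<^sub>O U g + T)"
  proof (rule is_adjoint_add[OF _ S(2)])
    show "is_adjoint (cnj c *\<^sub>O U (inv g)) (c *\<^sub>O U g)"
      using left_regular_adjoint[OF step.hyps(2)]
      by (simp add: is_adjoint_def op_apply_simps cinner_scaleC_left cinner_scaleC_right)
  qed
  then show ?case
    using S step.hyps by (blast intro: group_span.step)
qed

lemma cstar_subalgebra_closure_group_span: "cstar_subalgebra (closure group_span)"
  unfolding cstar_subalgebra_def
proof (intro conjI ballI allI)
  fix T assume "T \<in> closure group_span"
  then obtain X where X: "\<And>n. X n \<in> group_span" "X \<longlonglongrightarrow> T"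
    by (auto simp: closure_sequential)
  have clin: "complex_linear S" if "S \<in> group_span" for S
    using that by (induction rule: group_span.induct)
      (use left_regular_complex_linear in \<open>auto simp: complex_linear_def op_apply_simps scaleC_add_right mult.commute\<close>)
  show "complex_linear T"
    unfolding complex_linear_def
  proof (intro allI)
    fix c f
    have "(\<lambda>n. X n (c *\<^sub>C f)) \<longlonglongrightarrow> T (c *\<^sub>C f)"
      by (intro blinfun.tendsto X(2) tendsto_const)
    moreover have "(\<lambda>n. scalar_op c (X n f)) \<longlonglongrightarrow> scalar_op c (T f)"
      by (intro blinfun.tendsto X(2) tendsto_const)
    moreover have "X n (c *\<^sub>C f) = scalar_op c (X n f)" for n
      using clin[OF X(1)] by (simp add: complex_linear_def scalar_op.rep_eq)
    ultimately show "T (c *\<^sub>C f) = c *\<^sub>C T f"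
      using LIMSEQ_unique by (simp add: scalar_op.rep_eq)
  qed
  show "c *\<^sub>O T \<in> closure group_span" for c
    using X group_span_scale unfolding closure_sequential
    by (intro exI[of _ "\<lambda>n. c *\<^sub>O X n"]) (auto intro: tendsto_compose_op)
  show "\<exists>S\<in>closure group_span. is_adjoint S T"
  proof -
    have "\<forall>n. \<exists>S\<in>group_span. is_adjoint S (X n)"
      using X(1) group_span_adjoint by blast
    then obtain Z where Z: "\<And>n. Z n \<in> group_span" "\<And>n. is_adjoint (Z n) (X n)"
      by metis
    have "norm (Z m - Z n) \<le> norm (X m - X n)" for m n
      using is_adjoint_norm[of "Z m - Z n" "X m - X n"] Z(2)
      by (simp add: is_adjoint_def op_apply_simps cinner_diff_left cinner_diff_right)
    moreover have "Cauchy X"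
      using X(2) by (rule LIMSEQ_imp_Cauchy)
    ultimately have "Cauchy Z"
      unfolding Cauchy_iff by (meson le_less_trans)
    then obtain S where "Z \<longlonglongrightarrow> S"
      using Cauchy_convergent_iff convergent_def by blast
    then have "S \<in> closure group_span" "is_adjoint S T"
      using Z(1) is_adjoint_limit[OF _ X(2) Z(2)] by (auto simp: closure_sequential)
    then show ?thesis
      by blast
  qed
  fix S assume "S \<in> closure group_span"
  then obtain Y where Y: "\<And>n. Y n \<in> group_span" "Y \<longlonglongrightarrow> S"
    by (auto simp: closure_sequential)
  show "S + T \<in> closure group_span"
    using X Y group_span_add unfolding closure_sequential
    by (intro exI[of _ "\<lambda>n. Y n + X n"]) (auto intro: tendsto_add)
  show "S \<star> T \<in> closure group_span"
    using X Y group_span_mult unfolding closure_sequential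
    by (intro exI[of _ "\<lambda>n. Y n \<star> X n"]) (auto intro: tendsto_compose_op)
qed (use group_span.zero closure_subset in auto)

lemma reduced_eq_closure: "A = closure group_span"
  unfolding reduced_cstar_algebra_def
proof (rule hull_unique)
  show "U ` carrier G \<subseteq> closure group_span"
    using group_span_generator[of _ 1] closure_subset by fastforce
  fix B assume B: "U ` carrier G \<subseteq> B" "cstar_subalgebra B"
  have "T \<in> B" if "T \<in> group_span" for T
    using that by (induction rule: group_span.induct) (use B in \<open>auto simp: cstar_subalgebra_def\<close>)
  then show "closure group_span \<subseteq> B"
    using B(2) by (intro closure_minimal) (auto simp: cstar_subalgebra_def)
qed (rule cstar_subalgebra_closure_group_span)

lemma left_regular_mem [simp]: "g \<in> carrier G \<Longrightarrow> U g \<in> A"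
  unfolding reduced_eq_closure using group_span_generator[of g 1] closure_subset by fastforce

text \<open>Most identities below are checked on group elements only; this is the density argument that
  carries them over to the whole algebra.\<close>

lemma vanishing_on_reduced:
  fixes f :: "'a operator \<Rightarrow> 'z::real_normed_vector"
  assumes cont: "continuous_on A f"
    and add: "\<And>S T. S \<in> A \<Longrightarrow> T \<in> A \<Longrightarrow> f (S + T) = f S + f T"
    and gen: "\<And>g c. g \<in> carrier G \<Longrightarrow> f (c *\<^sub>O U g) = 0"
    and T: "T \<in> A"
  shows "f T = 0"
proof -
  note cstar = cstar_subalgebra_closure_group_span[folded reduced_eq_closure]
  have span_A: "group_span \<subseteq> A"
    unfolding reduced_eq_closure by (rule closure_subset)
  have "f 0 = 0"
    using add[of 0 0] cstar by (simp add: cstar_subalgebra_def)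
  have "f S = 0" if "S \<in> group_span" for S
    using that
  proof (induction rule: group_span.induct)
    case (step T g c)
    then have "c *\<^sub>O U g \<in> A" "T \<in> A"
      using span_A group_span_generator by blast+
    then show ?case
      using add gen step by simp
  qed fact
  then have "group_span \<subseteq> {S \<in> A. f S = 0}"
    using span_A by blast
  moreover have "closed A"
    by (simp add: reduced_eq_closure)
  then have "closed {S \<in> A. f S = 0}"
    by (rule continuous_closed_preimage_constant[OF cont])
  ultimately show ?thesis
    using T closure_minimal unfolding reduced_eq_closure by blast
qed

lemma unital_cstar_reduced: "unital_cstar A (U \<one>)"
proof
  show "cstar_subalgebra A"
    unfolding reduced_eq_closure by (rule cstar_subalgebra_closure_group_span)
  show "U \<one> \<in> A"
    by simp
  fix T assume T: "T \<in> A"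
  have "U \<one> \<star> T - T = 0"
    by (rule vanishing_on_reduced[where f = "\<lambda>T. U \<one> \<star> T - T", OF _ _ _ T])
      (auto simp: compose_add_right compose_op_scale left_regular_complex_linear left_regular_mult
        intro!: continuous_intros continuous_on_compose_op)
  then show "U \<one> \<star> T = T"
    by simp
  have "T \<star> U \<one> - T = 0"
    by (rule vanishing_on_reduced[where f = "\<lambda>T. T \<star> U \<one> - T", OF _ _ _ T])
      (auto simp: compose_add_left op_scale_compose left_regular_mult
        intro!: continuous_intros continuous_on_compose_op)
  then show "T \<star> U \<one> = T"
    by simp
qed

sublocale cstar: unital_cstar "reduced_cstar_algebra G" "left_regular G \<one>"
  by (rule unital_cstar_reduced)

lemma adj_left_regular [simp]: "g \<in> carrier G \<Longrightarrow> adj (U g) = U (inv g)"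
  by (rule adj_eqI[OF left_regular_adjoint])

lemma positive_functional_eqI:
  assumes "cstar.positive_functional \<phi>" "cstar.positive_functional \<psi>"
    and "\<And>g. g \<in> carrier G \<Longrightarrow> \<phi> (U g) = \<psi> (U g)" and T: "T \<in> A"
  shows "\<phi> T = \<psi> T"
proof -
  have "\<phi> T - \<psi> T = 0"
  proof (rule vanishing_on_reduced[where f = "\<lambda>T. \<phi> T - \<psi> T", OF _ _ _ T])
    show "continuous_on A (\<lambda>T. \<phi> T - \<psi> T)"
      by (intro continuous_on_diff cstar.positive_continuous_on assms)
  qed (use assms in \<open>auto simp: cstar.positive_linear\<close>)
  then show ?thesis
    by simp
qed


subsection \<open>The canonical trace\<close>

definition trace\<^sub>0 :: "'a operator \<Rightarrow> complex" where
  "trace\<^sub>0 T = cinner (T (delta \<one>)) (delta \<one>)"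

lemma trace0_left_regular: "g \<in> carrier G \<Longrightarrow> trace\<^sub>0 (U g) = (if g = \<one> then 1 else 0)"
  by (simp add: trace\<^sub>0_def left_regular_delta cinner_delta delta.rep_eq)

lemma trace0_square: "T \<in> A \<Longrightarrow> trace\<^sub>0 (adj T \<star> T) = of_real ((norm (T (delta \<one>)))\<^sup>2)"
  unfolding trace\<^sub>0_def cinner_self_norm[symmetric]
  using is_adjoint_sym[OF cstar.is_adjoint_adj] by (simp add: is_adjoint_def)

lemma trace0_state: "cstar.state trace\<^sub>0"
  unfolding cstar.state_def cstar.positive_functional_def
proof (intro conjI ballI allI)
  show "trace\<^sub>0 (adj T \<star> T) \<in> \<real>\<^sub>\<ge>\<^sub>0" if "T \<in> A" for T
    unfolding trace0_square[OF that] by (simp add: complex_nonneg_Reals_iff)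
qed (auto simp: trace0_left_regular, auto simp: trace\<^sub>0_def op_apply_simps cinner_add_left cinner_scaleC_left)

lemma tracial_on_reduced:
  assumes \<tau>: "cstar.positive_functional \<tau>"
    and comm: "\<And>g h. g \<in> carrier G \<Longrightarrow> h \<in> carrier G \<Longrightarrow> \<tau> (U (g \<otimes> h)) = \<tau> (U (h \<otimes> g))"
    and S: "S \<in> A" and T: "T \<in> A"
  shows "\<tau> (S \<star> T) = \<tau> (T \<star> S)"
proof -
  have cont: "continuous_on A (\<lambda>T. \<tau> (P \<star> T) - \<tau> (T \<star> P))" if "P \<in> A" for P
    by (intro continuous_on_diff; rule continuous_on_compose2[OF cstar.positive_continuous_on[OF \<tau>]])
      (use that in \<open>auto intro!: continuous_on_compose_op continuous_intros\<close>)
  have *: "\<tau> (U g \<star> T) - \<tau> (T \<star> U g) = 0" if g: "g \<in> carrier G" and T: "T \<in> A" for g T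
    by (rule vanishing_on_reduced[where f = "\<lambda>T. \<tau> (U g \<star> T) - \<tau> (T \<star> U g)", OF cont _ _ T])
      (use g in \<open>auto simp: compose_distribs op_scale_compose cstar.positive_linear[OF \<tau>]
        left_regular_mult comm[OF g]\<close>)
  have "\<tau> (T \<star> S) - \<tau> (S \<star> T) = 0"
    by (rule vanishing_on_reduced[where f = "\<lambda>S. \<tau> (T \<star> S) - \<tau> (S \<star> T)", OF cont[OF T] _ _ S])
      (use T * in \<open>auto simp: compose_distribs op_scale_compose cstar.positive_linear[OF \<tau>]\<close>)
  then show ?thesis
    by simp
qed

lemma trace0_tracial: "S \<in> A \<Longrightarrow> T \<in> A \<Longrightarrow> trace\<^sub>0 (S \<star> T) = trace\<^sub>0 (T \<star> S)"
proof (rule tracial_on_reduced[OF cstar.state_positive[OF trace0_state]])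
  show "trace\<^sub>0 (U (g \<otimes> h)) = trace\<^sub>0 (U (h \<otimes> g))" if "g \<in> carrier G" "h \<in> carrier G" for g h
    using that inv_comm by (auto simp: trace0_left_regular)
qed

text \<open>The trace at \<open>T\<^sup>*T\<close> is the square norm of \<open>T \<delta>\<^sub>1\<close>. If it is \<open>0\<close>, the trace property moves the zero to
  \<open>T \<delta>\<^sub>x\<close> for every \<open>x\<close>; since the adjoint of \<open>T\<close> is bounded, these values determine \<open>T\<close>.\<close>

lemma trace0_faithful:
  assumes T: "T \<in> A" and zero: "trace\<^sub>0 (adj T \<star> T) = 0"
  shows "T = 0"
proof -
  have delta: "T (delta x) = 0" for x
  proof (cases "x \<in> carrier G")
    case True
    have "trace\<^sub>0 (adj (T \<star> U x) \<star> (T \<star> U x)) = trace\<^sub>0 (U (inv x) \<star> (adj T \<star> T \<star> U x))"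
      using True T by (simp add: compose_assoc)
    also have "\<dots> = trace\<^sub>0 (adj T \<star> T \<star> (U x \<star> U (inv x)))"
      using True T by (subst trace0_tracial) (auto simp: compose_assoc)
    also have "\<dots> = 0"
      using True T zero by (simp add: left_regular_mult)
    finally have "(T \<star> U x) (delta \<one>) = 0"
      using True T by (simp only: trace0_square cstar.mult_mem left_regular_mem) simp
    then show ?thesis
      using True by (simp add: left_regular_delta)
  next
    case False
    have "T (delta x) = (T \<star> U \<one>) (delta x)"
      using T by simp
    then show ?thesis
      using left_regular_one_delta[OF False] by (simp only: blinfun_apply_blinfun_compose) simp
  qed
  have adj: "cinner (T f) h = cinner f (adj T h)" for f h
    using cstar.is_adjoint_adj[OF T] by (simp add: is_adjoint_def)
  have "ell2_apply (adj T (delta y)) x = cnj (cinner (T (delta x)) (delta y))" for x y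
    unfolding adj by (metis cinner_commute cinner_delta)
  then have "adj T (delta y) = 0" for y
    by (intro ell2_eqI) (simp add: delta zero_ell2.rep_eq)
  then have "ell2_apply (T f) y = 0" for f y
    using adj[of f "delta y"] by (simp add: cinner_delta)
  then show ?thesis
    by (intro blinfun_eqI ell2_eqI) (simp add: zero_ell2.rep_eq op_apply_simps)
qed

lemma left_regular_inj:
  assumes "g \<in> carrier G" "h \<in> carrier G" "U g = U h"
  shows "g = h"
proof -
  have "U (inv h \<otimes> g) = U \<one>"
    using assms left_regular_mult[of "inv h" g] left_regular_mult[of "inv h" h] by simp
  then have "inv h \<otimes> g = \<one>"
    using assms trace0_left_regular[of "inv h \<otimes> g"] trace0_left_regular[of \<one>]
    by (auto split: if_splits)
  then show ?thesis
    using assms by (metis inv_closed inv_inv inv_equality)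
qed

lemma left_regular_one_nonzero: "U \<one> \<noteq> 0"
  using trace0_left_regular[of \<one>] by (auto simp: trace\<^sub>0_def op_apply_simps)

lemma cstar_simple_iff:
  "cstar_simple G \<longleftrightarrow> (\<forall>I. closed_ideal I A \<longrightarrow> U \<one> \<notin> I \<longrightarrow> I = {0})"
  unfolding cstar_simple_def by (rule cstar.simple_iff[OF left_regular_one_nonzero])

lemma tracial_state_iff:
  "tracial_state A (U \<one>) \<tau> \<longleftrightarrow> cstar.state \<tau> \<and> (\<forall>S\<in>A. \<forall>T\<in>A. \<tau> (S \<star> T) = \<tau> (T \<star> S))"
proof -
  have "(\<forall>S\<in>A. \<forall>T\<in>A. is_adjoint S T \<longrightarrow> \<tau> (S \<star> T) \<in> \<real>\<^sub>\<ge>\<^sub>0) \<longleftrightarrow> (\<forall>T\<in>A. \<tau> (adj T \<star> T) \<in> \<real>\<^sub>\<ge>\<^sub>0)"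
    using cstar.is_adjoint_adj cstar.adj_mem adj_eqI by metis
  then show ?thesis
    unfolding tracial_state_def cstar.state_def cstar.positive_functional_def by auto
qed

text \<open>The canonical trace is always present, so uniqueness means that every trace agrees with it.\<close>

lemma unique_trace_iff:
  "unique_trace_property G \<longleftrightarrow>
     (\<forall>\<tau>. tracial_state A (U \<one>) \<tau> \<longrightarrow> (\<forall>g\<in>carrier G. g \<noteq> \<one> \<longrightarrow> \<tau> (U g) = 0))"
proof
  have tracial_restrict: "tracial_state A (U \<one>) (restrict \<tau> A)" if "tracial_state A (U \<one>) \<tau>" for \<tau>
    using that by (simp add: tracial_state_def)
  have trace0: "tracial_state A (U \<one>) trace\<^sub>0"
    using trace0_state trace0_tracial by (simp add: tracial_state_iff)
  {
    assume "unique_trace_property G"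
    then have unique: "\<sigma> = \<tau>" if "\<sigma> \<in> extensional A" "tracial_state A (U \<one>) \<sigma>"
        "\<tau> \<in> extensional A" "tracial_state A (U \<one>) \<tau>" for \<sigma> \<tau>
      using that by (auto simp: unique_trace_property_def)
    show "\<forall>\<tau>. tracial_state A (U \<one>) \<tau> \<longrightarrow> (\<forall>g\<in>carrier G. g \<noteq> \<one> \<longrightarrow> \<tau> (U g) = 0)"
    proof (intro allI ballI impI)
      fix \<tau> g assume \<tau>: "tracial_state A (U \<one>) \<tau>" and g: "g \<in> carrier G" "g \<noteq> \<one>"
      have "restrict \<tau> A = restrict trace\<^sub>0 A"
        by (intro unique tracial_restrict \<tau> trace0) auto
      then have "restrict \<tau> A (U g) = restrict trace\<^sub>0 A (U g)"
        by simp
      then show "\<tau> (U g) = 0"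
        using g by (simp add: trace0_left_regular)
    qed
  next
    assume vanish: "\<forall>\<tau>. tracial_state A (U \<one>) \<tau> \<longrightarrow> (\<forall>g\<in>carrier G. g \<noteq> \<one> \<longrightarrow> \<tau> (U g) = 0)"
    show "unique_trace_property G"
      unfolding unique_trace_property_def
    proof (rule ex1I[of _ "restrict trace\<^sub>0 A"])
      show "restrict trace\<^sub>0 A \<in> extensional A \<and> tracial_state A (U \<one>) (restrict trace\<^sub>0 A)"
        using tracial_restrict[OF trace0] by simp
      fix \<tau> assume \<tau>: "\<tau> \<in> extensional A \<and> tracial_state A (U \<one>) \<tau>"
      then have state: "cstar.state \<tau>"
        by (simp add: tracial_state_iff)
      have "\<tau> T = trace\<^sub>0 T" if "T \<in> A" for T
        by (rule positive_functional_eqI[OF _ _ _ that])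
          (use state trace0_state vanish \<tau> in \<open>auto simp: cstar.state_def trace0_left_regular\<close>)
      then show "\<tau> = restrict trace\<^sub>0 A"
        using \<tau> by (auto simp: extensional_def)
    qed
  }
qed

end


section \<open>Subgroups\<close>

text \<open>For a subgroup \<open>\<theta>(N)\<close> of \<open>G\<close>, the space \<open>\<ell>\<^sup>2(G)\<close> is the sum of copies of \<open>\<ell>\<^sup>2(N)\<close>, one for each right
  coset, and an operator on \<open>\<ell>\<^sup>2(N)\<close> acts on all of them at once. A coordinate \<open>p\<close>, equivariant for
  left multiplication by \<open>\<theta>(N)\<close>, selects the representative with coordinate \<open>\<one>\<close> in every coset; wreath
  products have such coordinates by construction.\<close>

locale group_embedding = N: group N + G: group G
  for N :: "('a, 'c) monoid_scheme" and G :: "('b, 'd) monoid_scheme" +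
  fixes \<theta> :: "'a \<Rightarrow> 'b" and p :: "'b \<Rightarrow> 'a"
  assumes \<theta>_hom: "\<theta> \<in> hom N G"
    and p_closed [simp]: "x \<in> carrier G \<Longrightarrow> p x \<in> carrier N"
    and p_mult [simp]: "n \<in> carrier N \<Longrightarrow> x \<in> carrier G \<Longrightarrow> p (\<theta> n \<otimes>\<^bsub>G\<^esub> x) = n \<otimes>\<^bsub>N\<^esub> p x"
begin

lemma \<theta>_closed [simp]: "n \<in> carrier N \<Longrightarrow> \<theta> n \<in> carrier G"
  and \<theta>_mult: "m \<in> carrier N \<Longrightarrow> n \<in> carrier N \<Longrightarrow> \<theta> (m \<otimes>\<^bsub>N\<^esub> n) = \<theta> m \<otimes>\<^bsub>G\<^esub> \<theta> n"
  using \<theta>_hom by (auto simp: hom_def)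

lemma \<theta>_one [simp]: "\<theta> \<one>\<^bsub>N\<^esub> = \<one>\<^bsub>G\<^esub>"
  using \<theta>_hom N.is_group G.is_group by (simp add: hom_one)

lemma \<theta>_inv: "n \<in> carrier N \<Longrightarrow> \<theta> (inv\<^bsub>N\<^esub> n) = inv\<^bsub>G\<^esub> \<theta> n"
  using \<theta>_mult[of "inv\<^bsub>N\<^esub> n" n] by (simp add: G.inv_equality)

definition transversal :: "'b set" where
  "transversal = {r \<in> carrier G. p r = \<one>\<^bsub>N\<^esub>}"

definition base :: "'b \<Rightarrow> 'b" where
  "base x = inv\<^bsub>G\<^esub> \<theta> (p x) \<otimes>\<^bsub>G\<^esub> x"

lemma base_transversal [simp]: "x \<in> carrier G \<Longrightarrow> base x \<in> transversal"
  by (simp add: transversal_def base_def \<theta>_inv[symmetric, OF p_closed])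

lemma \<theta>_p_base: "x \<in> carrier G \<Longrightarrow> \<theta> (p x) \<otimes>\<^bsub>G\<^esub> base x = x"
  by (simp add: base_def G.m_assoc[symmetric])

lemma transversal_closed [simp]: "r \<in> transversal \<Longrightarrow> r \<in> carrier G"
  by (simp add: transversal_def)

lemma p_transversal [simp]: "r \<in> transversal \<Longrightarrow> p r = \<one>\<^bsub>N\<^esub>"
  unfolding transversal_def by blast

lemma base_\<theta> [simp]: "n \<in> carrier N \<Longrightarrow> x \<in> carrier G \<Longrightarrow> base (\<theta> n \<otimes>\<^bsub>G\<^esub> x) = base x"
  by (simp add: base_def \<theta>_mult G.inv_mult_group G.m_assoc[symmetric])
    (simp add: G.m_assoc)

lemma base_of_transversal [simp]: "r \<in> transversal \<Longrightarrow> base r = r"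
  by (simp add: base_def)

lemma bij_cosets:
  "bij_betw (\<lambda>(r, n). \<theta> n \<otimes>\<^bsub>G\<^esub> r) (Sigma transversal (\<lambda>_. carrier N)) (carrier G)"
  by (rule bij_betw_byWitness[where f' = "\<lambda>x. (base x, p x)"]) (auto simp: \<theta>_p_base)

lemma infsum_cosets:
  fixes F :: "'b \<Rightarrow> 'z::banach"
  assumes "F summable_on carrier G"
  shows "(\<Sum>\<^sub>\<infinity>x\<in>carrier G. F x) = (\<Sum>\<^sub>\<infinity>r\<in>transversal. \<Sum>\<^sub>\<infinity>n\<in>carrier N. F (\<theta> n \<otimes>\<^bsub>G\<^esub> r))"
proof -
  have "(\<lambda>(r, n). F (\<theta> n \<otimes>\<^bsub>G\<^esub> r)) summable_on Sigma transversal (\<lambda>_. carrier N)"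
    using summable_on_reindex_bij_betw[OF bij_cosets, of F] assms by (simp add: case_prod_unfold)
  from infsum_Sigma'_banach[OF this] show ?thesis
    using infsum_reindex_bij_betw[OF bij_cosets, of F] by (simp add: case_prod_unfold)
qed

text \<open>The part of \<open>f\<close> on the coset of \<open>r\<close>, read as a function on \<open>N\<close>.\<close>

definition slice :: "'b \<Rightarrow> 'b ell2 \<Rightarrow> 'a ell2" where
  "slice r f = Abs_ell2 (\<lambda>n. if n \<in> carrier N then ell2_apply f (\<theta> n \<otimes>\<^bsub>G\<^esub> r) else 0)"

lemma slice_apply:
  assumes r: "r \<in> transversal"
  shows "ell2_apply (slice r f) n = (if n \<in> carrier N then ell2_apply f (\<theta> n \<otimes>\<^bsub>G\<^esub> r) else 0)"
proof -
  have "inj_on (\<lambda>n. \<theta> n \<otimes>\<^bsub>G\<^esub> r) (carrier N)"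
    using r by (intro inj_on_inverseI[of _ p]) auto
  then have "(\<lambda>n. (cmod (ell2_apply f (\<theta> n \<otimes>\<^bsub>G\<^esub> r)))\<^sup>2) summable_on carrier N"
    using square_summable_ell2[of f] summable_on_reindex[of _ _ "\<lambda>x. (cmod (ell2_apply f x))\<^sup>2"]
    by (auto simp: o_def)
  then have "(\<lambda>n. (cmod (if n \<in> carrier N then ell2_apply f (\<theta> n \<otimes>\<^bsub>G\<^esub> r) else 0))\<^sup>2) summable_on UNIV"
    by (rule summable_on_cong_neutral[THEN iffD1, rotated -1]) auto
  then show ?thesis
    by (simp add: slice_def Abs_ell2_apply)
qed

lemma slice_add: "r \<in> transversal \<Longrightarrow> slice r (f + g) = slice r f + slice r g"
  by (rule ell2_eqI) (simp add: slice_apply plus_ell2.rep_eq)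

lemma slice_scaleC: "r \<in> transversal \<Longrightarrow> slice r (c *\<^sub>C f) = c *\<^sub>C slice r f"
  by (rule ell2_eqI) (simp add: slice_apply scaleC.rep_eq)

lemma norm_slice: "r \<in> transversal \<Longrightarrow>
    (norm (slice r f))\<^sup>2 = (\<Sum>\<^sub>\<infinity>n\<in>carrier N. (cmod (ell2_apply f (\<theta> n \<otimes>\<^bsub>G\<^esub> r)))\<^sup>2)"
  unfolding norm_ell2_square by (intro infsum_cong_neutral) (auto simp: slice_apply)

lemma summable_norm_slice: "(\<lambda>r. (norm (slice r f))\<^sup>2) summable_on transversal"
  and infsum_norm_slice: "(\<Sum>\<^sub>\<infinity>r\<in>transversal. (norm (slice r f))\<^sup>2) \<le> (norm f)\<^sup>2"
proof -
  have "(\<lambda>(r, n). (cmod (ell2_apply f (\<theta> n \<otimes>\<^bsub>G\<^esub> r)))\<^sup>2) summable_on Sigma transversal (\<lambda>_. carrier N)"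
    using summable_on_reindex_bij_betw[OF bij_cosets, of "\<lambda>x. (cmod (ell2_apply f x))\<^sup>2"]
      square_summable_ell2[of f] by (simp add: case_prod_unfold)
  from summable_on_Sigma_banach[OF this]
  show "(\<lambda>r. (norm (slice r f))\<^sup>2) summable_on transversal"
    by (rule summable_on_cong[THEN iffD1, rotated]) (simp add: norm_slice)
  have "(\<Sum>\<^sub>\<infinity>r\<in>transversal. (norm (slice r f))\<^sup>2)
      = (\<Sum>\<^sub>\<infinity>r\<in>transversal. \<Sum>\<^sub>\<infinity>n\<in>carrier N. (cmod (ell2_apply f (\<theta> n \<otimes>\<^bsub>G\<^esub> r)))\<^sup>2)"
    by (intro infsum_cong norm_slice)
  also have "\<dots> = (\<Sum>\<^sub>\<infinity>x\<in>carrier G. (cmod (ell2_apply f x))\<^sup>2)"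
    by (rule infsum_cosets[OF square_summable_ell2, symmetric])
  also have "\<dots> \<le> (norm f)\<^sup>2"
    unfolding norm_ell2_square by (intro infsum_mono2 square_summable_ell2) auto
  finally show "(\<Sum>\<^sub>\<infinity>r\<in>transversal. (norm (slice r f))\<^sup>2) \<le> (norm f)\<^sup>2" .
qed

definition lift :: "'a operator \<Rightarrow> 'b operator" where
  "lift T = Blinfun (\<lambda>f. Abs_ell2 (\<lambda>x. if x \<in> carrier G then ell2_apply (T (slice (base x) f)) (p x) else 0))"

lemma lift_apply: "ell2_apply (lift T f) x =
    (if x \<in> carrier G then ell2_apply (T (slice (base x) f)) (p x) else 0)"
  and norm_lift_apply: "norm (lift T f) \<le> norm T * norm f"
proof -
  define L where "L f x = (if x \<in> carrier G then ell2_apply (T (slice (base x) f)) (p x) else 0)" for f x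
  have L_coset: "L f (\<theta> n \<otimes>\<^bsub>G\<^esub> r) = ell2_apply (T (slice r f)) n"
    if "r \<in> transversal" "n \<in> carrier N" for f r n
    using that by (simp add: L_def)
  have norm_T: "(norm (T (slice r f)))\<^sup>2 \<le> (norm T)\<^sup>2 * (norm (slice r f))\<^sup>2" for r f
    using power_mono[OF norm_blinfun norm_ge_zero] by (metis power_mult_distrib)
  have summable_T: "(\<lambda>r. (norm (T (slice r f)))\<^sup>2) summable_on transversal" for f
    by (rule summable_on_comparison_test[OF summable_on_cmult_right[OF summable_norm_slice[of f], of "(norm T)\<^sup>2"]])
      (auto simp: norm_T)
  have inner: "(\<Sum>\<^sub>\<infinity>n\<in>carrier N. (cmod (L f (\<theta> n \<otimes>\<^bsub>G\<^esub> r)))\<^sup>2) \<le> (norm (T (slice r f)))\<^sup>2"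
    if r: "r \<in> transversal" for f r
  proof -
    have "(\<Sum>\<^sub>\<infinity>n\<in>carrier N. (cmod (L f (\<theta> n \<otimes>\<^bsub>G\<^esub> r)))\<^sup>2)
        = (\<Sum>\<^sub>\<infinity>n\<in>carrier N. (cmod (ell2_apply (T (slice r f)) n))\<^sup>2)"
      by (intro infsum_cong) (simp add: L_coset r)
    also have "\<dots> \<le> (norm (T (slice r f)))\<^sup>2"
      unfolding norm_ell2_square by (intro infsum_mono2 square_summable_ell2) auto
    finally show ?thesis .
  qed
  have summable_inner: "(\<lambda>n. (cmod (L f (\<theta> n \<otimes>\<^bsub>G\<^esub> r)))\<^sup>2) summable_on carrier N"
    if "r \<in> transversal" for f r
    by (rule summable_on_cong[THEN iffD1, OF _ square_summable_ell2[of "T (slice r f)"]]) (simp add: L_coset that)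
  have summable_outer: "(\<lambda>r. \<Sum>\<^sub>\<infinity>n\<in>carrier N. (cmod (L f (\<theta> n \<otimes>\<^bsub>G\<^esub> r)))\<^sup>2) summable_on transversal" for f
    by (rule summable_on_comparison_test[OF summable_T[of f]]) (auto simp: inner intro: infsum_nonneg)
  have "(\<lambda>(r, n). (cmod (L f (\<theta> n \<otimes>\<^bsub>G\<^esub> r)))\<^sup>2) summable_on Sigma transversal (\<lambda>_. carrier N)" for f
    by (rule summable_on_SigmaI[OF _ summable_outer[of f]]) (auto intro!: has_sum_infsum summable_inner)
  then have summable_G: "(\<lambda>x. (cmod (L f x))\<^sup>2) summable_on carrier G" for f
    using summable_on_reindex_bij_betw[OF bij_cosets, of "\<lambda>x. (cmod (L f x))\<^sup>2"]
    by (simp add: case_prod_unfold)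
  then have "(\<lambda>x. (cmod (L f x))\<^sup>2) summable_on UNIV" for f
    by (rule summable_on_cong_neutral[THEN iffD1, rotated -1]) (auto simp: L_def)
  then have ap: "ell2_apply (Abs_ell2 (L f)) = L f" for f
    by (simp add: Abs_ell2_inverse)
  have norm: "norm (Abs_ell2 (L f)) \<le> norm T * norm f" for f
  proof -
    have "(norm (Abs_ell2 (L f)))\<^sup>2 = (\<Sum>\<^sub>\<infinity>x\<in>carrier G. (cmod (L f x))\<^sup>2)"
      unfolding norm_ell2_square ap by (intro infsum_cong_neutral) (auto simp: L_def)
    also have "\<dots> = (\<Sum>\<^sub>\<infinity>r\<in>transversal. \<Sum>\<^sub>\<infinity>n\<in>carrier N. (cmod (L f (\<theta> n \<otimes>\<^bsub>G\<^esub> r)))\<^sup>2)"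
      by (rule infsum_cosets[OF summable_G])
    also have "\<dots> \<le> (\<Sum>\<^sub>\<infinity>r\<in>transversal. (norm T)\<^sup>2 * (norm (slice r f))\<^sup>2)"
      by (intro infsum_mono summable_outer summable_on_cmult_right summable_norm_slice)
        (rule order_trans[OF inner norm_T])
    also have "\<dots> = (norm T)\<^sup>2 * (\<Sum>\<^sub>\<infinity>r\<in>transversal. (norm (slice r f))\<^sup>2)"
      by (rule infsum_cmult_right')
    also have "\<dots> \<le> (norm T)\<^sup>2 * (norm f)\<^sup>2"
      by (intro mult_left_mono infsum_norm_slice) auto
    finally have "(norm (Abs_ell2 (L f)))\<^sup>2 \<le> (norm T * norm f)\<^sup>2"
      by (simp add: power_mult_distrib)
    then show ?thesis
      by (rule power2_le_imp_le) simp
  qed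
  have "bounded_linear (\<lambda>f. Abs_ell2 (L f))"
  proof (rule bounded_linear_intro)
    fix f h :: "'b ell2" and r :: real
    show "Abs_ell2 (L (f + h)) = Abs_ell2 (L f) + Abs_ell2 (L h)"
      by (rule ell2_eqI) (simp add: ap plus_ell2.rep_eq L_def slice_add blinfun.add_right)
    have scaleR_apply: "ell2_apply (r *\<^sub>R k) x = complex_of_real r * ell2_apply k x"
      for k :: "'z ell2" and x
      by (simp add: scaleR_ell2_def scaleC.rep_eq)
    have "slice s (r *\<^sub>R f) = r *\<^sub>R slice s f" if "s \<in> transversal" for s
      using that by (simp add: scaleR_ell2_def slice_scaleC)
    then show "Abs_ell2 (L (r *\<^sub>R f)) = r *\<^sub>R Abs_ell2 (L f)"
      by (intro ell2_eqI) (simp add: ap L_def blinfun.scaleR_right scaleR_apply)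
    show "norm (Abs_ell2 (L f)) \<le> norm f * norm T"
      using norm[of f] by (simp add: mult.commute)
  qed
  then have lift: "lift T f = Abs_ell2 (L f)"
    unfolding lift_def L_def by (simp add: bounded_linear_Blinfun_apply)
  show "ell2_apply (lift T f) x = (if x \<in> carrier G then ell2_apply (T (slice (base x) f)) (p x) else 0)"
    unfolding lift ap L_def ..
  show "norm (lift T f) \<le> norm T * norm f"
    unfolding lift by (rule norm)
qed

lemma norm_lift: "norm (lift T) \<le> norm T"
  by (rule norm_blinfun_bound) (auto simp: norm_lift_apply)

lemma lift_add: "lift (S + T) = lift S + lift T"
  by (intro blinfun_eqI ell2_eqI) (simp add: lift_apply op_apply_simps plus_ell2.rep_eq)

lemma lift_scale: "lift (c *\<^sub>O T) = c *\<^sub>O lift T"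
  by (intro blinfun_eqI ell2_eqI) (simp add: lift_apply op_apply_simps scaleC.rep_eq)

lemma lift_scaleR: "lift (r *\<^sub>R T) = r *\<^sub>R lift T"
  by (simp add: scaleR_op_scale lift_scale)

lemma bounded_linear_lift: "bounded_linear lift"
  by (rule bounded_linear_intro[where K = 1]) (auto simp: lift_add lift_scaleR norm_lift)

lemma lift_zero [simp]: "lift 0 = 0"
  using lift_scale[of 0 0] by simp

lemma range_reduced:
  assumes "T \<in> reduced_cstar_algebra N" "n \<notin> carrier N"
  shows "ell2_apply (T f) n = 0"
proof -
  have "T f = left_regular N \<one>\<^bsub>N\<^esub> (T f)"
    using N.cstar.unit_left[OF assms(1)] by (metis blinfun_apply_blinfun_compose)
  then show ?thesis
    using assms(2) by (metis N.left_regular_apply' N.one_closed)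
qed

text \<open>Operators in the reduced algebra produce functions that vanish off the carrier; this is what makes
  slicing and lifting compatible, and \<open>lift\<close> multiplicative.\<close>

lemma slice_lift:
  assumes T: "T \<in> reduced_cstar_algebra N" and r: "r \<in> transversal"
  shows "slice r (lift T f) = T (slice r f)"
  by (rule ell2_eqI) (simp add: slice_apply r lift_apply range_reduced[OF T])

lemma lift_mult:
  assumes "S \<in> reduced_cstar_algebra N" "T \<in> reduced_cstar_algebra N"
  shows "lift (S \<star> T) = lift S \<star> lift T"
  by (intro blinfun_eqI ell2_eqI) (simp add: lift_apply slice_lift assms)

lemma cinner_lift:
  "cinner (lift T f) h = (\<Sum>\<^sub>\<infinity>r\<in>transversal. cinner (T (slice r f)) (slice r h))"
proof -
  have summable: "(\<lambda>x. ell2_apply (lift T f) x * cnj (ell2_apply h x)) summable_on carrier G"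
    by (intro square_summable_mult square_summable_ell2)
  have "cinner (lift T f) h = (\<Sum>\<^sub>\<infinity>x\<in>carrier G. ell2_apply (lift T f) x * cnj (ell2_apply h x))"
    unfolding cinner.rep_eq by (intro infsum_cong_neutral) (auto simp: lift_apply)
  also have "\<dots> = (\<Sum>\<^sub>\<infinity>r\<in>transversal. \<Sum>\<^sub>\<infinity>n\<in>carrier N.
      ell2_apply (lift T f) (\<theta> n \<otimes>\<^bsub>G\<^esub> r) * cnj (ell2_apply h (\<theta> n \<otimes>\<^bsub>G\<^esub> r)))"
    by (rule infsum_cosets[OF summable])
  also have "\<dots> = (\<Sum>\<^sub>\<infinity>r\<in>transversal. cinner (T (slice r f)) (slice r h))"
    unfolding cinner.rep_eq
    by (intro infsum_cong infsum_cong_neutral) (auto simp: lift_apply slice_apply)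
  finally show ?thesis .
qed

lemma is_adjoint_lift:
  assumes "is_adjoint S T"
  shows "is_adjoint (lift S) (lift T)"
  unfolding is_adjoint_def
proof (intro allI)
  fix f h
  have "cinner (lift T f) h = (\<Sum>\<^sub>\<infinity>r\<in>transversal. cnj (cinner (S (slice r h)) (slice r f)))"
    unfolding cinner_lift using assms by (intro infsum_cong) (metis is_adjoint_def cinner_commute)
  also have "\<dots> = cnj (cinner (lift S h) f)"
    unfolding cinner_lift by (rule infsum_cnj)
  finally show "cinner (lift T f) h = cinner f (lift S h)"
    by (metis cinner_commute)
qed

lemma adj_lift: "T \<in> reduced_cstar_algebra N \<Longrightarrow> adj (lift T) = lift (adj T)"
  by (intro adj_eqI is_adjoint_lift N.cstar.is_adjoint_adj)

lemma lift_left_regular: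
  assumes n: "n \<in> carrier N"
  shows "lift (left_regular N n) = left_regular G (\<theta> n)"
proof (intro blinfun_eqI ell2_eqI)
  fix f x
  have "\<theta> (inv\<^bsub>N\<^esub> n \<otimes>\<^bsub>N\<^esub> p x) \<otimes>\<^bsub>G\<^esub> base x = inv\<^bsub>G\<^esub> \<theta> n \<otimes>\<^bsub>G\<^esub> x" if x: "x \<in> carrier G"
    using n x by (simp add: \<theta>_mult \<theta>_inv G.m_assoc \<theta>_p_base)
  then show "ell2_apply (lift (left_regular N n) f) x = ell2_apply (left_regular G (\<theta> n) f) x"
    using n by (simp add: lift_apply N.left_regular_apply' G.left_regular_apply' slice_apply)
qed

lemma lift_one: "lift (left_regular N \<one>\<^bsub>N\<^esub>) = left_regular G \<one>\<^bsub>G\<^esub>"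
  by (simp add: lift_left_regular)

lemma lift_mem [simp]:
  assumes "T \<in> reduced_cstar_algebra N"
  shows "lift T \<in> reduced_cstar_algebra G"
proof -
  have "S \<in> lift -` reduced_cstar_algebra G" if "S \<in> N.group_span" for S
    using that by (induction rule: N.group_span.induct) (auto simp: lift_add lift_scale lift_left_regular)
  moreover have "closed (lift -` reduced_cstar_algebra G)"
    by (intro closed_vimage G.cstar.closed_algebra linear_continuous_on bounded_linear_lift)
  ultimately have "reduced_cstar_algebra N \<subseteq> lift -` reduced_cstar_algebra G"
    unfolding N.reduced_eq_closure by (intro closure_minimal) auto
  then show ?thesis
    using assms by blast
qed

lemma positive_functional_lift:
  assumes "G.cstar.positive_functional \<phi>"
  shows "N.cstar.positive_functional (\<lambda>T. \<phi> (lift T))"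
  unfolding N.cstar.positive_functional_def
proof (intro conjI ballI allI)
  fix T assume T: "T \<in> reduced_cstar_algebra N"
  then have "lift (adj T \<star> T) = adj (lift T) \<star> lift T"
    by (simp add: lift_mult adj_lift)
  then show "\<phi> (lift (adj T \<star> T)) \<in> \<real>\<^sub>\<ge>\<^sub>0"
    using G.cstar.positive_nonneg[OF assms] T by simp
qed (simp_all add: lift_add lift_scale G.cstar.positive_linear[OF assms])

lemma trace0_lift:
  assumes "T \<in> reduced_cstar_algebra N"
  shows "G.trace\<^sub>0 (lift T) = N.trace\<^sub>0 T"
proof (rule N.positive_functional_eqI[OF _ _ _ assms])
  show "N.cstar.positive_functional (\<lambda>T. G.trace\<^sub>0 (lift T))"
    by (intro positive_functional_lift G.cstar.state_positive G.trace0_state)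
  show "N.cstar.positive_functional N.trace\<^sub>0"
    by (intro N.cstar.state_positive N.trace0_state)
  fix n assume n: "n \<in> carrier N"
  have "\<theta> n = \<one>\<^bsub>G\<^esub> \<longleftrightarrow> n = \<one>\<^bsub>N\<^esub>"
    using n p_mult[of n "\<one>\<^bsub>G\<^esub>"] by (metis G.l_one G.one_closed N.r_cancel_one p_closed \<theta>_one)
  then show "G.trace\<^sub>0 (lift (left_regular N n)) = N.trace\<^sub>0 (left_regular N n)"
    using n by (simp add: lift_left_regular G.trace0_left_regular N.trace0_left_regular)
qed

lemma lift_eq_zero_iff:
  assumes T: "T \<in> reduced_cstar_algebra N" and "lift T = 0"
  shows "T = 0"
proof (rule N.trace0_faithful[OF T])
  have "G.trace\<^sub>0 (lift (adj T \<star> T)) = 0"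
    using assms by (simp add: lift_mult G.trace\<^sub>0_def op_apply_simps)
  then show "N.trace\<^sub>0 (adj T \<star> T) = 0"
    using T by (simp add: trace0_lift)
qed

end


section \<open>Finite groups\<close>

lemma (in unital_cstar) adj_sum:
  "(\<And>i. i \<in> F \<Longrightarrow> T i \<in> A) \<Longrightarrow> adj (\<Sum>i\<in>F. T i) = (\<Sum>i\<in>F. adj (T i))"
  by (induction F rule: infinite_finite_induct) (auto simp: adj_eqI is_adjoint_def op_apply_simps)

context group
begin

text \<open>The sum \<open>T\<close> of all group elements is central and satisfies \<open>U\<^sub>g T = T\<close>. Its annihilator is a proper
  ideal, and multiplication by \<open>T\<close> gives the trivial character as a second trace.\<close>

lemma
  assumes fin: "finite (carrier G)" and nontrivial: "carrier G \<noteq> {\<one>}"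
  shows finite_not_cstar_simple: "\<not> cstar_simple G"
    and finite_not_unique_trace: "\<not> unique_trace_property G"
proof -
  obtain h where h: "h \<in> carrier G" "h \<noteq> \<one>"
    using nontrivial by blast
  define T where "T = (\<Sum>g\<in>carrier G. U g)"
  have T: "T \<in> A"
    by (simp add: T_def)
  have UT: "U g \<star> T = T" if g: "g \<in> carrier G" for g
  proof -
    have "U g \<star> T = (\<Sum>x\<in>carrier G. U g \<star> U x)"
      unfolding T_def by (rule bounded_bilinear.sum_right[OF bounded_bilinear_blinfun_compose])
    also have "\<dots> = (\<Sum>x\<in>carrier G. U (g \<otimes> x))"
      using g by (intro sum.cong) (auto simp: left_regular_mult)
    also have "\<dots> = T"
      unfolding T_def
      by (rule sum.reindex_bij_witness[of _ "\<lambda>x. inv g \<otimes> x" "\<lambda>x. g \<otimes> x"]) (use g in \<open>auto simp: m_assoc[symmetric]\<close>)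
    finally show ?thesis .
  qed
  have TU: "T \<star> U g = T" if g: "g \<in> carrier G" for g
  proof -
    have "T \<star> U g = (\<Sum>x\<in>carrier G. U x \<star> U g)"
      unfolding T_def by (rule bounded_bilinear.sum_left[OF bounded_bilinear_blinfun_compose])
    also have "\<dots> = (\<Sum>x\<in>carrier G. U (x \<otimes> g))"
      using g by (intro sum.cong) (auto simp: left_regular_mult)
    also have "\<dots> = T"
      unfolding T_def
      by (rule sum.reindex_bij_witness[of _ "\<lambda>x. x \<otimes> inv g" "\<lambda>x. x \<otimes> g"]) (use g in \<open>auto simp: m_assoc\<close>)
    finally show ?thesis .
  qed
  have central: "S \<star> T = T \<star> S" if S: "S \<in> A" for S
  proof -
    have "S \<star> T - T \<star> S = 0"
      by (rule vanishing_on_reduced[where f = "\<lambda>S. S \<star> T - T \<star> S", OF _ _ _ S])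
        (use T in \<open>auto simp: compose_distribs op_scale_compose UT TU
          intro!: continuous_intros continuous_on_compose_op\<close>)
    then show ?thesis
      by simp
  qed
  have trace_T: "trace\<^sub>0 T = 1"
    using fin by (simp add: T_def cstar.positive_sum[OF cstar.state_positive[OF trace0_state]]
        trace0_left_regular)
  then have "T \<noteq> 0"
    using cstar.positive_zero[OF cstar.state_positive[OF trace0_state]] by auto
  let ?J = "{S \<in> A. S \<star> T = 0}"
  have "closed_ideal ?J A"
    unfolding closed_ideal_def
  proof (intro conjI ballI allI)
    show "closed ?J"
      by (rule continuous_closed_preimage_constant[OF _ cstar.closed_algebra])
        (intro continuous_on_compose_op continuous_intros)
    fix R S assume R: "R \<in> A" and S: "S \<in> ?J"
    have "S \<star> R \<star> T = S \<star> T \<star> R"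
      using central[OF R] by (simp add: compose_assoc)
    then have "S \<star> R \<star> T = 0"
      using S by simp
    then show "S \<star> R \<in> ?J"
      using R S by simp
    show "R \<star> S \<in> ?J"
      using R S by (simp add: compose_assoc)
  qed (auto simp: compose_distribs op_scale_compose)
  moreover have "U \<one> \<notin> ?J"
    using T \<open>T \<noteq> 0\<close> by simp
  moreover have "U \<one> - U h \<in> ?J" "U \<one> - U h \<noteq> 0"
    using h T left_regular_inj[of \<one> h] by (auto simp: compose_distribs UT)
  ultimately show "\<not> cstar_simple G"
    unfolding cstar_simple_iff by (metis (no_types, lifting) singletonD)
  define \<tau> where "\<tau> S = trace\<^sub>0 (S \<star> T)" for S
  note pos = cstar.state_positive[OF trace0_state]
  have "adj T = (\<Sum>g\<in>carrier G. U (inv g))"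
    by (simp add: T_def cstar.adj_sum)
  also have "\<dots> = T"
    unfolding T_def by (rule sum.reindex_bij_witness[of _ "\<lambda>x. inv x" "\<lambda>x. inv x"]) auto
  finally have adj_T: "adj T = T" .
  have "T \<star> T = (\<Sum>x\<in>carrier G. U x \<star> T)"
    unfolding T_def by (rule bounded_bilinear.sum_left[OF bounded_bilinear_blinfun_compose])
  also have "\<dots> = real (card (carrier G)) *\<^sub>R T"
    by (simp add: UT sum_constant_scaleR)
  finally have TT: "T \<star> T = real (card (carrier G)) *\<^sub>R T" .
  have card: "card (carrier G) > 0"
    using fin h(1) card_gt_0_iff by blast
  have "cstar.state \<tau>"
    unfolding cstar.state_def cstar.positive_functional_def
  proof (intro conjI ballI allI)
    fix S assume S: "S \<in> A"
    have "adj (S \<star> T) \<star> (S \<star> T) = T \<star> (adj S \<star> S) \<star> T"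
      using S T by (simp add: adj_T compose_assoc)
    also have "\<dots> = adj S \<star> S \<star> (T \<star> T)"
      using S central[of "adj S \<star> S", symmetric] by (simp add: compose_assoc)
    also have "\<dots> = real (card (carrier G)) *\<^sub>R (adj S \<star> S \<star> T)"
      by (simp add: TT compose_scaleR_right)
    finally have "trace\<^sub>0 (adj (S \<star> T) \<star> (S \<star> T)) = of_nat (card (carrier G)) * \<tau> (adj S \<star> S)"
      using S T by (simp add: cstar.positive_linear[OF pos] \<tau>_def)
    then have "of_nat (card (carrier G)) * \<tau> (adj S \<star> S) \<in> \<real>\<^sub>\<ge>\<^sub>0"
      using cstar.positive_nonneg[OF pos, of "S \<star> T"] S T by simp
    then show "\<tau> (adj S \<star> S) \<in> \<real>\<^sub>\<ge>\<^sub>0"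
      using card by (simp add: complex_nonneg_Reals_iff zero_le_mult_iff)
  qed (use T trace_T in \<open>simp_all add: \<tau>_def compose_distribs op_scale_compose cstar.positive_linear[OF pos]\<close>)
  moreover have "\<tau> (U g) = 1" if "g \<in> carrier G" for g
    using that trace_T by (simp add: \<tau>_def UT)
  ultimately have "tracial_state A (U \<one>) \<tau>" "\<tau> (U h) \<noteq> 0"
    using h tracial_on_reduced[of \<tau>] by (auto simp: tracial_state_iff cstar.state_def)
  then show "\<not> unique_trace_property G"
    using h unfolding unique_trace_iff by blast
qed

end


section \<open>Compact sets of states\<close>

context unital_cstar
begin

text \<open>The values of a state outside the algebra are normalised to \<open>0\<close>, so that sets of states are subsets
  of a product of discs.\<close>

definition states_vanishing_on :: "'a operator set \<Rightarrow> ('a operator \<Rightarrow> complex) set" where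
  "states_vanishing_on I = {\<phi>. state \<phi> \<and> (\<forall>T. T \<notin> A \<longrightarrow> \<phi> T = 0) \<and> (\<forall>T\<in>I. \<phi> T = 0)}"

lemma continuous_on_evaluation: "continuous_on S (\<lambda>\<phi> :: 'b \<Rightarrow> 'c::topological_space. \<phi> T)"
  by (rule continuous_on_subset[OF continuous_on_product_coordinates subset_UNIV])

lemma compact_states_vanishing_on: "compact (states_vanishing_on I)"
proof -
  let ?D = "{\<phi> :: 'a operator \<Rightarrow> complex. \<forall>T. \<phi> T \<in> cball 0 (norm T)}"
  have "compactin (product_topology (\<lambda>T :: 'a operator. euclidean) UNIV)
      (PiE UNIV (\<lambda>T. cball (0 :: complex) (norm T)))"
    unfolding compactin_PiE by simp
  moreover have "PiE UNIV (\<lambda>T :: 'a operator. cball (0 :: complex) (norm T)) = ?D"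
    by (auto simp: PiE_def)
  ultimately have "compact ?D"
    by (simp add: euclidean_product_topology)
  moreover have "closed (states_vanishing_on I)"
  proof -
    have nonneg: "closed {\<phi> :: 'a operator \<Rightarrow> complex. \<phi> T \<in> \<real>\<^sub>\<ge>\<^sub>0}" for T
      using closed_vimage[OF closed_nonneg_Reals_complex continuous_on_evaluation[of UNIV T]]
      by (simp add: vimage_def)
    show ?thesis
      unfolding states_vanishing_on_def state_def positive_functional_def Ball_def
      by (intro closed_Collect_conj closed_Collect_all closed_Collect_imp closed_Collect_eq nonneg
          open_Collect_const continuous_intros continuous_on_evaluation)
  qed
  moreover have "states_vanishing_on I \<subseteq> ?D"
  proof
    fix \<phi> assume \<phi>: "\<phi> \<in> states_vanishing_on I"
    show "\<phi> \<in> ?D"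
    proof (intro CollectI allI)
      fix T
      show "\<phi> T \<in> cball 0 (norm T)"
        using \<phi> state_bounded[of \<phi> T] by (cases "T \<in> A") (auto simp: states_vanishing_on_def)
    qed
  qed
  ultimately show ?thesis
    using compact_Int_closed[of ?D "states_vanishing_on I"] by (simp add: Int_absorb1)
qed

text \<open>The vector state of \<open>X\<close> in the representation that \<open>\<phi>\<close> generates. There is no such state if
  \<open>\<phi>(X\<^sup>*X) = 0\<close>, and the quotient then has its default value \<open>0\<close>.\<close>

definition compression :: "('a operator \<Rightarrow> complex) \<Rightarrow> 'a operator \<Rightarrow> 'a operator \<Rightarrow> complex" where
  "compression \<phi> X = (\<lambda>T. if T \<in> A then \<phi> (adj X \<star> T \<star> X) / \<phi> (adj X \<star> X) else 0)"

lemma state_compression: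
  assumes \<phi>: "state \<phi>" and X: "X \<in> A" and nz: "\<phi> (adj X \<star> X) \<noteq> 0"
  shows "state (compression \<phi> X)"
proof -
  note pos = positive_compress[OF state_positive[OF \<phi>] X]
  have "\<phi> (adj X \<star> X) \<in> \<real>\<^sub>\<ge>\<^sub>0"
    using positive_nonneg[OF state_positive[OF \<phi>] X] .
  then have "\<phi> (adj X \<star> (adj T \<star> T) \<star> X) / \<phi> (adj X \<star> X) \<in> \<real>\<^sub>\<ge>\<^sub>0" if "T \<in> A" for T
    using positive_nonneg[OF pos that] by (rule nonneg_Reals_divide_I[rotated])
  then show ?thesis
    using X nz positive_add[OF pos] positive_scale[OF pos]
    by (simp add: state_def positive_functional_def compression_def add_divide_distrib)
qed

lemma state_convex:
  assumes \<phi>: "state \<phi>" and \<psi>: "state \<psi>" and t: "0 \<le> t" "t \<le> 1"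
  shows "state (\<lambda>T. (1 - complex_of_real t) * \<phi> T + complex_of_real t * \<psi> T)"
proof -
  have "(1 - complex_of_real t) \<in> \<real>\<^sub>\<ge>\<^sub>0" "complex_of_real t \<in> \<real>\<^sub>\<ge>\<^sub>0"
    using t by (auto simp: complex_nonneg_Reals_iff)
  then show ?thesis
    using \<phi> \<psi> unfolding state_def positive_functional_def
    by (intro conjI ballI allI nonneg_Reals_add_I nonneg_Reals_mult_I) (simp_all add: algebra_simps)
qed

lemma states_vanishing_compression:
  assumes I: "closed_ideal I A" and \<phi>: "\<phi> \<in> states_vanishing_on I" and X: "X \<in> A"
    and nz: "\<phi> (adj X \<star> X) \<noteq> 0"
  shows "compression \<phi> X \<in> states_vanishing_on I"
proof -
  have "adj X \<star> T \<star> X \<in> I" if "T \<in> I" for T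
    using closed_idealD[OF I] X that by simp
  then show ?thesis
    using \<phi> state_compression[of \<phi> X] X nz
    by (auto simp: states_vanishing_on_def compression_def)
qed

lemma states_vanishing_convex:
  assumes "\<phi> \<in> states_vanishing_on I" "\<psi> \<in> states_vanishing_on I" "0 \<le> t" "t \<le> 1"
  shows "(\<lambda>T. (1 - complex_of_real t) * \<phi> T + complex_of_real t * \<psi> T) \<in> states_vanishing_on I"
  using assms state_convex by (auto simp: states_vanishing_on_def)

end

section \<open>Product states\<close>

text \<open>If \<open>v + v'\<close> is as long as the bounds on \<open>\<parallel>v\<parallel>\<close> and \<open>\<parallel>v'\<parallel>\<close> allow, then both vectors are multiples of \<open>w\<close>.
  In terms of the deviation \<open>d = v - t w\<close>, the two bounds contain \<open>\<langle>w, d\<rangle>\<close> with opposite signs, and one of them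
  gives \<open>\<parallel>d\<parallel>\<^sup>2 \<le> 0\<close>.\<close>

lemma equality_in_triangle_inequality:
  fixes v v' w :: "'i \<Rightarrow> complex" and t t' :: real
  assumes fin: "finite P" and t: "0 \<le> t" "0 \<le> t'"
    and sum: "\<And>b. b \<in> P \<Longrightarrow> v b + v' b = of_real (t + t') * w b"
    and v: "(\<Sum>b\<in>P. (cmod (v b))\<^sup>2) \<le> t\<^sup>2 * (\<Sum>b\<in>P. (cmod (w b))\<^sup>2)"
    and v': "(\<Sum>b\<in>P. (cmod (v' b))\<^sup>2) \<le> t'\<^sup>2 * (\<Sum>b\<in>P. (cmod (w b))\<^sup>2)"
    and b: "b \<in> P"
  shows "v b = of_real t * w b"
proof -
  define d where "d b = v b - of_real t * w b" for b
  define c where "c = (\<Sum>b\<in>P. Re (w b * cnj (d b)))"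
  define D where "D = (\<Sum>b\<in>P. (cmod (d b))\<^sup>2)"
  define R where "R = (\<Sum>b\<in>P. (cmod (w b))\<^sup>2)"
  have expand: "(\<Sum>b\<in>P. (cmod (of_real s * w b + of_real e * d b))\<^sup>2) = s\<^sup>2 * R + 2 * s * e * c + e\<^sup>2 * D"
    for s e :: real
  proof -
    have "(cmod (of_real s * w b + of_real e * d b))\<^sup>2
        = s\<^sup>2 * (cmod (w b))\<^sup>2 + 2 * s * e * Re (w b * cnj (d b)) + e\<^sup>2 * (cmod (d b))\<^sup>2" for b
      unfolding cmod_power2 by (simp add: power2_eq_square algebra_simps)
    then show ?thesis
      by (simp only: sum.distrib sum_distrib_left R_def c_def D_def)
  qed
  have "v b = of_real t * w b + of_real 1 * d b" for b
    by (simp add: d_def)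
  then have "t\<^sup>2 * R + 2 * t * c + D \<le> t\<^sup>2 * R"
    using v expand[of t 1] by (simp add: R_def)
  moreover have "v' b = of_real t' * w b + of_real (- 1) * d b" if "b \<in> P" for b
    using sum[OF that] by (simp add: d_def algebra_simps)
  then have "(\<Sum>b\<in>P. (cmod (v' b))\<^sup>2) = (\<Sum>b\<in>P. (cmod (of_real t' * w b + of_real (- 1) * d b))\<^sup>2)"
    by (intro sum.cong) auto
  then have "t'\<^sup>2 * R - 2 * t' * c + D \<le> t'\<^sup>2 * R"
    using v' expand[of t' "-1"] by (simp add: R_def)
  moreover have "0 \<le> t * c \<or> t' * c \<le> 0"
    using t by (cases "c \<ge> 0") (auto simp: mult_le_0_iff)
  ultimately have "D \<le> 0"
    by linarith
  moreover have "(cmod (d b))\<^sup>2 \<le> D"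
    unfolding D_def using fin b by (intro member_le_sum) auto
  ultimately have "(cmod (d b))\<^sup>2 \<le> 0"
    by linarith
  then show ?thesis
    by (simp add: d_def)
qed

text \<open>The algebra \<open>B\<close> is embedded into \<open>A\<close> by \<open>\<iota>\<close>, and \<open>V\<close> is a set of unitaries commuting with it. The set
  \<open>\<S>\<close> of states is closed under the compressions that the arguments below use.\<close>

locale commuting_pair = A: unital_cstar A E + B: unital_cstar B F
  for A :: "'a operator set" and E and B :: "'b operator set" and F +
  fixes \<iota> :: "'b operator \<Rightarrow> 'a operator" and V :: "'a operator set"
    and \<S> :: "('a operator \<Rightarrow> complex) set"
  assumes \<iota>_mem [simp]: "b \<in> B \<Longrightarrow> \<iota> b \<in> A"
    and \<iota>_add: "b \<in> B \<Longrightarrow> b' \<in> B \<Longrightarrow> \<iota> (b + b') = \<iota> b + \<iota> b'"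
    and \<iota>_scale: "b \<in> B \<Longrightarrow> \<iota> (c *\<^sub>O b) = c *\<^sub>O \<iota> b"
    and \<iota>_mult: "b \<in> B \<Longrightarrow> b' \<in> B \<Longrightarrow> \<iota> (b \<star> b') = \<iota> b \<star> \<iota> b'"
    and \<iota>_adj: "b \<in> B \<Longrightarrow> \<iota> (adj b) = adj (\<iota> b)"
    and \<iota>_unit: "\<iota> F = E"
    and V_mem [simp]: "u \<in> V \<Longrightarrow> u \<in> A"
    and V_unitary: "u \<in> V \<Longrightarrow> adj u \<star> u = E"
    and V_comm: "u \<in> V \<Longrightarrow> b \<in> B \<Longrightarrow> u \<star> \<iota> b = \<iota> b \<star> u"
    and compact: "compact \<S>"
    and state: "\<phi> \<in> \<S> \<Longrightarrow> A.state \<phi>"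
    and convex: "\<phi> \<in> \<S> \<Longrightarrow> \<psi> \<in> \<S> \<Longrightarrow> 0 \<le> t \<Longrightarrow> t \<le> 1 \<Longrightarrow>
      (\<lambda>T. (1 - complex_of_real t) * \<phi> T + complex_of_real t * \<psi> T) \<in> \<S>"
    and compression_\<iota>: "\<phi> \<in> \<S> \<Longrightarrow> b \<in> B \<Longrightarrow> \<phi> (adj (\<iota> b) \<star> \<iota> b) \<noteq> 0 \<Longrightarrow>
      A.compression \<phi> (\<iota> b) \<in> \<S>"
    and compression_V: "\<phi> \<in> \<S> \<Longrightarrow> u \<in> V \<Longrightarrow> \<phi> (adj (E + c *\<^sub>O u) \<star> (E + c *\<^sub>O u)) \<noteq> 0 \<Longrightarrow>
      A.compression \<phi> (E + c *\<^sub>O u) \<in> \<S>"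
begin

lemma adj_V_comm: "u \<in> V \<Longrightarrow> b \<in> B \<Longrightarrow> adj u \<star> \<iota> b = \<iota> b \<star> adj u"
  using arg_cong[OF V_comm[of u "adj b"], of adj] by (simp add: \<iota>_adj)

lemma continuous_evaluations:
  "continuous_on S (\<lambda>\<phi> :: 'a operator \<Rightarrow> complex. \<Sum>b\<in>P. (cmod (\<phi> (\<iota> b)))\<^sup>2)"
  by (intro continuous_intros A.continuous_on_evaluation)

text \<open>For a unitary \<open>u\<close> commuting with \<open>\<iota>(B)\<close>, compressing \<open>\<phi>\<close> by \<open>1 + cu\<close> and \<open>1 - cu\<close> with \<open>\<bar>c\<bar> = 1\<close> writes the
  restriction of \<open>\<phi>\<close> to \<open>\<iota>(B)\<close> as a convex combination. If \<open>\<phi>\<close> maximises a strictly convex function of its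
  values at finitely many points, then both parts agree with \<open>\<phi>\<close> there, and this says that \<open>\<phi>\<close> is
  multiplicative. Compactness extends this to all of \<open>B\<close>.\<close>

lemma multiplicative_on_finite_set:
  assumes "\<S> \<noteq> {}" and P: "finite P" "P \<subseteq> B"
  shows "\<exists>\<phi>\<in>\<S>. \<forall>b\<in>P. \<forall>u\<in>V. \<phi> (\<iota> b \<star> u) = \<phi> (\<iota> b) * \<phi> u"
proof -
  obtain \<phi> where \<phi>: "\<phi> \<in> \<S>"
    and max: "\<And>\<psi>. \<psi> \<in> \<S> \<Longrightarrow> (\<Sum>b\<in>P. (cmod (\<psi> (\<iota> b)))\<^sup>2) \<le> (\<Sum>b\<in>P. (cmod (\<phi> (\<iota> b)))\<^sup>2)"
    using continuous_attains_sup[OF compact assms(1) continuous_evaluations] by metis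
  note pos = A.state_positive[OF state[OF \<phi>]]
  note lin = A.positive_linear[OF pos] A.state_unit[OF state[OF \<phi>]]
  show ?thesis
  proof (intro bexI[OF _ \<phi>] ballI)
    fix b u assume b: "b \<in> P" and u: "u \<in> V"
    define v where "v c b = \<phi> (adj (E + c *\<^sub>O u) \<star> \<iota> b \<star> (E + c *\<^sub>O u))" for c b
    define t where "t c = Re (\<phi> (adj (E + c *\<^sub>O u) \<star> (E + c *\<^sub>O u)))" for c
    have t_eq: "\<phi> (adj (E + c *\<^sub>O u) \<star> (E + c *\<^sub>O u)) = of_real (t c)" and t_nonneg: "t c \<ge> 0" for c
      using A.positive_nonneg[OF pos, of "E + c *\<^sub>O u"] u
      by (auto simp: t_def complex_nonneg_Reals_iff complex_eq_iff)
    have t_expand: "of_real (t c) = 2 + c * \<phi> u + cnj c * \<phi> (adj u)" if "cmod c = 1" for c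
    proof -
      have "adj (E + c *\<^sub>O u) \<star> (E + c *\<^sub>O u) = E + E + c *\<^sub>O u + cnj c *\<^sub>O adj u"
        using u that complex_norm_square[of c]
        by (simp add: compose_distribs op_scale_compose V_unitary ac_simps)
      then show ?thesis
        unfolding t_eq[symmetric] using u by (simp add: lin)
    qed
    have v_expand: "v c b = 2 * \<phi> (\<iota> b) + c * \<phi> (\<iota> b \<star> u) + cnj c * \<phi> (\<iota> b \<star> adj u)"
      if "cmod c = 1" "b \<in> B" for c b
    proof -
      have "adj u \<star> \<iota> b \<star> u = \<iota> b"
        using u that by (simp add: adj_V_comm compose_assoc V_unitary)
      then have "adj (E + c *\<^sub>O u) \<star> \<iota> b \<star> (E + c *\<^sub>O u)
          = \<iota> b + \<iota> b + c *\<^sub>O (\<iota> b \<star> u) + cnj c *\<^sub>O (\<iota> b \<star> adj u)"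
        using u that complex_norm_square[of c]
        by (simp add: compose_distribs op_scale_compose V_comm adj_V_comm compose_assoc ac_simps)
      then show ?thesis
        unfolding v_def using u that by (simp add: lin)
    qed
    have v_bound: "(\<Sum>b\<in>P. (cmod (v c b))\<^sup>2) \<le> (t c)\<^sup>2 * (\<Sum>b\<in>P. (cmod (\<phi> (\<iota> b)))\<^sup>2)" for c
    proof (cases "t c = 0")
      case True
      have "v c b = 0" if "b \<in> P" for b
        unfolding v_def using that P u t_eq[of c] True by (subst A.positive_null_right[OF pos]) auto
      then show ?thesis
        using True by simp
    next
      case False
      have "v c b = of_real (t c) * A.compression \<phi> (E + c *\<^sub>O u) (\<iota> b)" if "b \<in> P" for b
        using False that P by (auto simp: A.compression_def v_def t_eq)
      then have "(\<Sum>b\<in>P. (cmod (v c b))\<^sup>2)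
          = (t c)\<^sup>2 * (\<Sum>b\<in>P. (cmod (A.compression \<phi> (E + c *\<^sub>O u) (\<iota> b)))\<^sup>2)"
        by (simp add: norm_mult power_mult_distrib sum_distrib_left)
      also have "\<dots> \<le> (t c)\<^sup>2 * (\<Sum>b\<in>P. (cmod (\<phi> (\<iota> b)))\<^sup>2)"
        using False t_eq[of c] by (intro mult_left_mono max compression_V \<phi> u) auto
      finally show ?thesis .
    qed
    have mult: "v c b = of_real (t c) * \<phi> (\<iota> b)" if c: "cmod c = 1" for c
    proof (rule equality_in_triangle_inequality[OF P(1) t_nonneg t_nonneg _ v_bound v_bound b])
      fix b assume "b \<in> P"
      then show "v c b + v (- c) b = of_real (t c + t (- c)) * \<phi> (\<iota> b)"
        using P c by (simp add: v_expand t_expand subset_iff algebra_simps)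
    qed
    define \<alpha> \<beta> where "\<alpha> = \<phi> (\<iota> b \<star> u) - \<phi> (\<iota> b) * \<phi> u"
      and "\<beta> = \<phi> (\<iota> b \<star> adj u) - \<phi> (\<iota> b) * \<phi> (adj u)"
    have *: "c * \<alpha> + cnj c * \<beta> = 0" if "cmod c = 1" for c
      using mult[OF that] v_expand[OF that, of b] t_expand[OF that] b P
      by (auto simp: \<alpha>_def \<beta>_def algebra_simps)
    have "\<alpha> + \<beta> = 0" "\<alpha> = \<beta>"
      using *[of 1] *[of \<i>] by (simp_all add: right_diff_distrib[symmetric])
    then have "\<alpha> = 0"
      by simp
    then show "\<phi> (\<iota> b \<star> u) = \<phi> (\<iota> b) * \<phi> u"
      by (simp add: \<alpha>_def)
  qed
qed

lemma exists_multiplicative: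
  assumes "\<S> \<noteq> {}"
  shows "\<exists>\<phi>\<in>\<S>. \<forall>b\<in>B. \<forall>u\<in>V. \<phi> (\<iota> b \<star> u) = \<phi> (\<iota> b) * \<phi> u"
proof -
  have "\<S> \<inter> (\<Inter>b\<in>B. {\<phi>. \<forall>u. u \<in> V \<longrightarrow> \<phi> (\<iota> b \<star> u) = \<phi> (\<iota> b) * \<phi> u}) \<noteq> {}"
  proof (rule compact_imp_fip_image[OF compact])
    show "closed {\<phi> :: 'a operator \<Rightarrow> complex. \<forall>u. u \<in> V \<longrightarrow> \<phi> (\<iota> b \<star> u) = \<phi> (\<iota> b) * \<phi> u}" for b
      by (intro closed_Collect_all closed_Collect_imp open_Collect_const closed_Collect_eq
          continuous_intros A.continuous_on_evaluation)
    fix P assume "finite P" "P \<subseteq> B"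
    then obtain \<phi> where "\<phi> \<in> \<S>" "\<forall>b\<in>P. \<forall>u\<in>V. \<phi> (\<iota> b \<star> u) = \<phi> (\<iota> b) * \<phi> u"
      using multiplicative_on_finite_set[OF assms] by metis
    then have "\<phi> \<in> \<S> \<inter> (\<Inter>b\<in>P. {\<phi>. \<forall>u. u \<in> V \<longrightarrow> \<phi> (\<iota> b \<star> u) = \<phi> (\<iota> b) * \<phi> u})"
      by simp
    then show "\<S> \<inter> (\<Inter>b\<in>P. {\<phi>. \<forall>u. u \<in> V \<longrightarrow> \<phi> (\<iota> b \<star> u) = \<phi> (\<iota> b) * \<phi> u}) \<noteq> {}"
      unfolding ex_in_conv[symmetric] by (rule exI[of _ \<phi>])
  qed
  then obtain \<phi> where "\<phi> \<in> \<S> \<inter> (\<Inter>b\<in>B. {\<phi>. \<forall>u. u \<in> V \<longrightarrow> \<phi> (\<iota> b \<star> u) = \<phi> (\<iota> b) * \<phi> u})"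
    unfolding ex_in_conv[symmetric] by (rule exE)
  then show ?thesis
    by (intro bexI[of _ \<phi>]) simp_all
qed

text \<open>Simplicity of \<open>B\<close> now allows the restriction of a multiplicative state to \<open>\<iota>(B)\<close> to be replaced by any
  state \<open>\<omega>\<close>. A state \<open>\<phi>\<close> minimising \<open>\<Sum>\<bar>\<phi>(b)\<bar>\<^sup>2\<close> over a finite set \<open>Q\<close> in the kernel of \<open>\<omega>\<close> satisfies a
  variational inequality; it says that a certain selfadjoint \<open>h\<close> with \<open>\<omega>(h) = - \<Sum>\<bar>\<phi>(b)\<bar>\<^sup>2\<close> is positive in the
  representation given by \<open>\<phi>\<close>. As \<open>B\<close> is simple, \<open>h\<close> is positive, and the minimum is \<open>0\<close>.\<close>

lemma exists_product_state:
  assumes "\<S> \<noteq> {}" and simple: "simple_cstar_algebra B" and \<omega>: "B.state \<omega>"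
  shows "\<exists>\<phi>\<in>\<S>. \<forall>b\<in>B. \<forall>u\<in>V. \<phi> (\<iota> b \<star> u) = \<omega> b * \<phi> u"
proof -
  obtain \<kappa> where \<kappa>: "\<kappa> \<in> \<S>" "\<And>b u. b \<in> B \<Longrightarrow> u \<in> V \<Longrightarrow> \<kappa> (\<iota> b \<star> u) = \<kappa> (\<iota> b) * \<kappa> u"
    using exists_multiplicative[OF assms(1)] by metis
  define W where "W = \<S> \<inter> {\<phi>. \<forall>b u. b \<in> B \<and> u \<in> V \<longrightarrow> \<phi> (\<iota> b \<star> u) = \<phi> (\<iota> b) * \<kappa> u}"
  have W_sub: "\<phi> \<in> \<S>" if "\<phi> \<in> W" for \<phi>
    using that by (simp add: W_def)
  have W_mult: "\<phi> (\<iota> b \<star> u) = \<phi> (\<iota> b) * \<kappa> u" if "\<phi> \<in> W" "b \<in> B" "u \<in> V" for \<phi> b u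
    using that by (simp add: W_def)
  have W_compact: "compact W"
    unfolding W_def
    by (intro compact_Int_closed compact closed_Collect_all closed_Collect_imp open_Collect_const
        closed_Collect_eq continuous_intros A.continuous_on_evaluation)
  have "\<kappa> \<in> W"
    using \<kappa> by (simp add: W_def)
  have W_convex: "(\<lambda>T. (1 - complex_of_real t) * \<phi> T + complex_of_real t * \<psi> T) \<in> W"
    if "\<phi> \<in> W" "\<psi> \<in> W" "0 \<le> t" "t \<le> 1" for \<phi> \<psi> t
  proof -
    have "(\<lambda>T. (1 - complex_of_real t) * \<phi> T + complex_of_real t * \<psi> T) \<in> \<S>"
      using that W_sub by (intro convex) auto
    moreover have "(1 - complex_of_real t) * \<phi> (\<iota> b \<star> u) + complex_of_real t * \<psi> (\<iota> b \<star> u)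
        = ((1 - complex_of_real t) * \<phi> (\<iota> b) + complex_of_real t * \<psi> (\<iota> b)) * \<kappa> u"
      if "b \<in> B" "u \<in> V" for b u
      using W_mult[OF \<open>\<phi> \<in> W\<close> that] W_mult[OF \<open>\<psi> \<in> W\<close> that] by (simp add: algebra_simps)
    ultimately show ?thesis
      by (simp add: W_def)
  qed
  have W_compression: "A.compression \<phi> (\<iota> z) \<in> W"
    if \<phi>: "\<phi> \<in> W" and z: "z \<in> B" and nz: "\<phi> (adj (\<iota> z) \<star> \<iota> z) \<noteq> 0" for \<phi> z
  proof -
    have "adj (\<iota> z) \<star> (\<iota> b \<star> u) \<star> \<iota> z = \<iota> (adj z \<star> b \<star> z) \<star> u" if "b \<in> B" "u \<in> V" for b u
      using that z by (simp add: \<iota>_mult \<iota>_adj compose_assoc V_comm)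
    moreover have "adj (\<iota> z) \<star> \<iota> b \<star> \<iota> z = \<iota> (adj z \<star> b \<star> z)" if "b \<in> B" for b
      using that z by (simp add: \<iota>_mult \<iota>_adj)
    ultimately show ?thesis
      using W_mult[OF \<phi>] z compression_\<iota>[OF W_sub[OF \<phi>] z nz] unfolding W_def
      by (auto simp: A.compression_def)
  qed
  have minimum: "\<exists>\<phi>\<in>W. \<forall>b\<in>Q. \<phi> (\<iota> b) = 0" if Q: "finite Q" "Q \<subseteq> {b \<in> B. \<omega> b = 0}" for Q
  proof -
    obtain \<phi> where \<phi>: "\<phi> \<in> W"
      and min: "\<And>\<psi>. \<psi> \<in> W \<Longrightarrow> (\<Sum>b\<in>Q. (cmod (\<phi> (\<iota> b)))\<^sup>2) \<le> (\<Sum>b\<in>Q. (cmod (\<psi> (\<iota> b)))\<^sup>2)"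
      using continuous_attains_inf[OF W_compact _ continuous_evaluations] \<open>\<kappa> \<in> W\<close> by (metis empty_iff)
    note pos = A.state_positive[OF state[OF W_sub[OF \<phi>]]]
    define s where "s = (\<Sum>b\<in>Q. (cmod (\<phi> (\<iota> b)))\<^sup>2)"
    define a where "a = (\<Sum>b\<in>Q. cnj (\<phi> (\<iota> b)) *\<^sub>O b)"
    define h where "h = (1/2) *\<^sub>R (a + adj a) - s *\<^sub>R F"
    have QB: "b \<in> B" if "b \<in> Q" for b
      using that Q by blast
    have a: "a \<in> B"
      unfolding a_def using QB by auto
    have h: "h \<in> B" "adj h = h"
      using a by (simp_all add: h_def add.commute)
    have \<iota>_B: "B.positive_functional (\<lambda>b. \<psi> (\<iota> b))" if "\<psi> \<in> W" for \<psi>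
    proof -
      note p = A.state_positive[OF state[OF W_sub[OF that]]]
      show ?thesis
        using A.positive_nonneg[OF p] unfolding B.positive_functional_def
        by (auto simp: \<iota>_add \<iota>_scale \<iota>_mult \<iota>_adj A.positive_linear[OF p])
    qed
    have \<psi>_a: "\<psi> (\<iota> a) = (\<Sum>b\<in>Q. cnj (\<phi> (\<iota> b)) * \<psi> (\<iota> b))" if "\<psi> \<in> W" for \<psi>
      unfolding a_def using QB by (subst B.positive_sum[OF \<iota>_B[OF that]])
        (auto simp: B.positive_linear[OF \<iota>_B[OF that]])
    have variation: "s \<le> Re (\<psi> (\<iota> a))" if \<psi>: "\<psi> \<in> W" for \<psi>
    proof (rule ccontr)
      assume "\<not> s \<le> Re (\<psi> (\<iota> a))"
      define c where "c = s - Re (\<psi> (\<iota> a))"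
      define D where "D = (\<Sum>b\<in>Q. (cmod (\<psi> (\<iota> b) - \<phi> (\<iota> b)))\<^sup>2)"
      have "c > 0" "D \<ge> 0"
        using \<open>\<not> s \<le> _\<close> by (auto simp: c_def D_def intro: sum_nonneg)
      have expand: "(\<Sum>b\<in>Q. (cmod ((1 - complex_of_real t) * \<phi> (\<iota> b) + complex_of_real t * \<psi> (\<iota> b)))\<^sup>2)
          = s - 2 * t * c + t\<^sup>2 * D" for t
      proof -
        have "(cmod ((1 - complex_of_real t) * x + complex_of_real t * y))\<^sup>2
            = (cmod x)\<^sup>2 - 2 * t * ((cmod x)\<^sup>2 - Re (cnj x * y)) + t\<^sup>2 * (cmod (y - x))\<^sup>2" for x y
          unfolding cmod_power2 by (simp add: power2_eq_square algebra_simps)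
        then show ?thesis
          by (simp add: sum.distrib sum_subtractf sum_distrib_left[symmetric] s_def c_def D_def
              \<psi>_a[OF \<psi>])
      qed
      \<comment> \<open>a step from \<open>\<phi>\<close> towards \<open>\<psi>\<close>, so short that the quadratic term cannot make up for the decrease\<close>
      define t where "t = c / (c + D)"
      have t: "0 < t" "t \<le> 1" "t * D \<le> c"
        using \<open>c > 0\<close> \<open>D \<ge> 0\<close> by (auto simp: t_def field_simps)
      have "s \<le> s - 2 * t * c + t\<^sup>2 * D"
        using min[OF W_convex[OF \<phi> \<psi>, of t]] t unfolding expand s_def[symmetric] by simp
      then have "t * (2 * c) \<le> t * (t * D)"
        by (simp add: power2_eq_square)
      then have "2 * c \<le> t * D"
        using t(1) by simp
      then show False
        using t(3) \<open>c > 0\<close> by linarith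
    qed
    have \<psi>_h: "Re (\<psi> (\<iota> h)) = Re (\<psi> (\<iota> a)) - s" if "\<psi> \<in> W" for \<psi>
    proof -
      have "\<psi> (\<iota> F) = 1"
        using A.state_unit[OF state[OF W_sub[OF that]]] by (simp add: \<iota>_unit)
      then show ?thesis
        using a by (simp add: h_def B.positive_linear[OF \<iota>_B[OF that]] B.positive_hermitian[OF \<iota>_B[OF that]])
    qed
    have "B.state (\<lambda>b. \<phi> (\<iota> b))"
      using \<iota>_B[OF \<phi>] A.state_unit[OF state[OF W_sub[OF \<phi>]]] by (simp add: B.state_def \<iota>_unit)
    moreover have "Re (\<phi> (\<iota> (adj z \<star> h \<star> z))) \<ge> 0" if z: "z \<in> B" for z
    proof -
      have eq: "\<iota> (adj z \<star> h \<star> z) = adj (\<iota> z) \<star> \<iota> h \<star> \<iota> z"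
        using z h by (simp add: \<iota>_mult \<iota>_adj)
      show ?thesis
      proof (cases "\<phi> (adj (\<iota> z) \<star> \<iota> z) = 0")
        case True
        then show ?thesis
          unfolding eq using z h A.positive_null_right[OF pos, of "adj (\<iota> z) \<star> \<iota> h" "\<iota> z"] by simp
      next
        case False
        define r where "r = Re (\<phi> (adj (\<iota> z) \<star> \<iota> z))"
        have r: "\<phi> (adj (\<iota> z) \<star> \<iota> z) = of_real r" "r \<ge> 0"
          using A.positive_nonneg[OF pos, of "\<iota> z"] z
          by (auto simp: r_def complex_nonneg_Reals_iff complex_eq_iff)
        have "\<phi> (\<iota> (adj z \<star> h \<star> z)) = of_real r * A.compression \<phi> (\<iota> z) (\<iota> h)"
          using False h by (simp add: A.compression_def eq r)
        moreover have "Re (A.compression \<phi> (\<iota> z) (\<iota> h)) \<ge> 0"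
          using variation[OF W_compression[OF \<phi> z False]] \<psi>_h[OF W_compression[OF \<phi> z False]] by simp
        ultimately show ?thesis
          using r(2) by simp
      qed
    qed
    ultimately obtain v c where v: "v \<in> B" "adj v = v" "c \<ge> 0" "h = c *\<^sub>R (v \<star> v)"
      using B.simple_positive_square[OF simple _ h] by metis
    note \<omega>_pos = B.state_positive[OF \<omega>]
    have "Re (\<omega> h) \<ge> 0"
      using B.positive_nonneg[OF \<omega>_pos v(1)] v by (simp add: B.positive_linear[OF \<omega>_pos] complex_nonneg_Reals_iff)
    moreover have "\<omega> a = 0"
    proof -
      have "\<omega> a = (\<Sum>b\<in>Q. cnj (\<phi> (\<iota> b)) * \<omega> b)"
        unfolding a_def using QB by (subst B.positive_sum[OF \<omega>_pos]) (auto simp: B.positive_linear[OF \<omega>_pos])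
      also have "\<dots> = 0"
        using Q by (intro sum.neutral) auto
      finally show ?thesis .
    qed
    then have "\<omega> h = - of_real s"
      using a B.state_unit[OF \<omega>]
      by (simp add: h_def B.positive_linear[OF \<omega>_pos] B.positive_hermitian[OF \<omega>_pos])
    ultimately have "s \<le> 0"
      by simp
    have "\<phi> (\<iota> b) = 0" if "b \<in> Q" for b
    proof -
      have "(cmod (\<phi> (\<iota> b)))\<^sup>2 \<le> s"
        unfolding s_def using that Q(1) by (intro member_le_sum) auto
      then have "(cmod (\<phi> (\<iota> b)))\<^sup>2 \<le> 0"
        using \<open>s \<le> 0\<close> by linarith
      then show ?thesis
        by simp
    qed
    then show ?thesis
      using \<phi> by blast
  qed
  have "W \<inter> (\<Inter>b\<in>{b \<in> B. \<omega> b = 0}. {\<phi>. \<phi> (\<iota> b) = 0}) \<noteq> {}"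
  proof (rule compact_imp_fip_image[OF W_compact])
    show "closed {\<phi> :: 'a operator \<Rightarrow> complex. \<phi> (\<iota> b) = 0}" for b
      by (intro closed_Collect_eq continuous_intros A.continuous_on_evaluation)
    fix Q assume "finite Q" "Q \<subseteq> {b \<in> B. \<omega> b = 0}"
    then have "\<exists>\<phi>\<in>W. \<forall>b\<in>Q. \<phi> (\<iota> b) = 0"
      by (rule minimum)
    then obtain \<phi> where "\<phi> \<in> W" "\<forall>b\<in>Q. \<phi> (\<iota> b) = 0"
      by (rule bexE)
    then have "\<phi> \<in> W \<inter> (\<Inter>b\<in>Q. {\<phi>. \<phi> (\<iota> b) = 0})"
      by simp
    then show "W \<inter> (\<Inter>b\<in>Q. {\<phi>. \<phi> (\<iota> b) = 0}) \<noteq> {}"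
      unfolding ex_in_conv[symmetric] by (rule exI[of _ \<phi>])
  qed
  then obtain \<phi> where "\<phi> \<in> W \<inter> (\<Inter>b\<in>{b \<in> B. \<omega> b = 0}. {\<phi>. \<phi> (\<iota> b) = 0})"
    unfolding ex_in_conv[symmetric] by (rule exE)
  then have \<phi>: "\<phi> \<in> W" and ker: "\<And>b. b \<in> B \<Longrightarrow> \<omega> b = 0 \<Longrightarrow> \<phi> (\<iota> b) = 0"
    by simp_all
  note pos = A.state_positive[OF state[OF W_sub[OF \<phi>]]]
  have unit: "\<phi> E = 1"
    using A.state_unit[OF state[OF W_sub[OF \<phi>]]] .
  have "\<phi> (\<iota> b) = \<omega> b" if b: "b \<in> B" for b
  proof -
    have "\<phi> (\<iota> (b + (- \<omega> b) *\<^sub>O F)) = 0"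
      using b B.state_unit[OF \<omega>] by (intro ker) (auto simp: B.positive_linear[OF B.state_positive[OF \<omega>]])
    then show ?thesis
      using b unit by (simp add: \<iota>_add \<iota>_scale \<iota>_unit A.positive_linear[OF pos])
  qed
  moreover have "\<phi> u = \<kappa> u" if "u \<in> V" for u
    using W_mult[OF \<phi> B.unit_mem that] that unit by (simp add: \<iota>_unit)
  ultimately have "\<phi> (\<iota> b \<star> u) = \<omega> b * \<phi> u" if "b \<in> B" "u \<in> V" for b u
    using W_mult[OF \<phi> that] that by simp
  then show ?thesis
    using W_sub[OF \<phi>] by (intro bexI[of _ \<phi>]) simp_all
qed

end


section \<open>Wreath products\<close>

locale wreath = N: group N + K: group K
  for N :: "('a, 'c) monoid_scheme" and K :: "('b, 'd) monoid_scheme"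
begin

abbreviation G :: "(('b \<Rightarrow> 'a) \<times> 'b) monoid" where "G \<equiv> N \<wr> K"

abbreviation support :: "('b \<Rightarrow> 'a) \<Rightarrow> 'b set" where
  "support m \<equiv> {j \<in> carrier K. m j \<noteq> \<one>\<^bsub>N\<^esub>}"

sublocale G: group "N \<wr> K"
  by (rule group_wreath_product) unfold_locales

lemma carrier_G: "carrier G = {x \<in> carrier K \<rightarrow>\<^sub>E carrier N. finite (support x)} \<times> carrier K"
  by (simp add: wreath_product_def semidirect_product_def carrier_sum_group N.is_group)

lemma G_fst [simp]: "x \<in> carrier G \<Longrightarrow> j \<in> carrier K \<Longrightarrow> fst x j \<in> carrier N"
  and G_snd [simp]: "x \<in> carrier G \<Longrightarrow> snd x \<in> carrier K"
  and G_finite: "x \<in> carrier G \<Longrightarrow> finite (support (fst x))"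
  by (auto simp: carrier_G)

lemma G_eqI:
  assumes "x \<in> carrier G" "y \<in> carrier G" "\<And>j. j \<in> carrier K \<Longrightarrow> fst x j = fst y j" "snd x = snd y"
  shows "x = y"
proof (rule prod_eqI)
  have "fst x \<in> carrier K \<rightarrow>\<^sub>E carrier N" "fst y \<in> carrier K \<rightarrow>\<^sub>E carrier N"
    using assms(1,2) by (auto simp: carrier_G)
  then show "fst x = fst y"
    by (rule PiE_ext) (rule assms(3))
qed (rule assms(4))

lemma snd_mult [simp]: "snd (x \<otimes>\<^bsub>G\<^esub> y) = snd x \<otimes>\<^bsub>K\<^esub> snd y"
  by (simp add: wreath_product_def semidirect_product_def case_prod_unfold)

lemma fst_mult [simp]: "j \<in> carrier K \<Longrightarrow>
    fst (x \<otimes>\<^bsub>G\<^esub> y) j = fst x j \<otimes>\<^bsub>N\<^esub> fst y (inv\<^bsub>K\<^esub> (snd x) \<otimes>\<^bsub>K\<^esub> j)"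
  by (simp add: wreath_product_def semidirect_product_def case_prod_unfold shift_def)

lemma snd_one [simp]: "snd \<one>\<^bsub>G\<^esub> = \<one>\<^bsub>K\<^esub>"
  and fst_one [simp]: "j \<in> carrier K \<Longrightarrow> fst \<one>\<^bsub>G\<^esub> j = \<one>\<^bsub>N\<^esub>"
  by (simp_all add: wreath_product_def semidirect_product_def)

lemma snd_inv [simp]: "x \<in> carrier G \<Longrightarrow> snd (inv\<^bsub>G\<^esub> x) = inv\<^bsub>K\<^esub> (snd x)"
proof -
  assume x: "x \<in> carrier G"
  have "snd (inv\<^bsub>G\<^esub> x) \<otimes>\<^bsub>K\<^esub> snd x = snd (inv\<^bsub>G\<^esub> x \<otimes>\<^bsub>G\<^esub> x)"
    by (simp only: snd_mult)
  also have "\<dots> = \<one>\<^bsub>K\<^esub>"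
    using x by (simp only: G.l_inv snd_one)
  finally show ?thesis
    using x K.inv_equality[of "snd (inv\<^bsub>G\<^esub> x)" "snd x"] by simp
qed

lemma fst_inv [simp]:
  assumes "x \<in> carrier G" "snd x = \<one>\<^bsub>K\<^esub>" "j \<in> carrier K"
  shows "fst (inv\<^bsub>G\<^esub> x) j = inv\<^bsub>N\<^esub> (fst x j)"
proof -
  have "fst (inv\<^bsub>G\<^esub> x) j \<otimes>\<^bsub>N\<^esub> fst x j = fst (inv\<^bsub>G\<^esub> x \<otimes>\<^bsub>G\<^esub> x) j"
    using assms by (simp only: fst_mult snd_inv) simp
  also have "\<dots> = \<one>\<^bsub>N\<^esub>"
    using assms by (simp only: G.l_inv fst_one)
  finally show ?thesis
    using assms N.inv_equality[of "fst (inv\<^bsub>G\<^esub> x) j" "fst x j"] by simp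
qed

definition single :: "'b \<Rightarrow> 'a \<Rightarrow> ('b \<Rightarrow> 'a) \<times> 'b" where
  "single i n = ((\<lambda>j\<in>carrier K. if j = i then n else \<one>\<^bsub>N\<^esub>), \<one>\<^bsub>K\<^esub>)"

lemma fst_single [simp]: "j \<in> carrier K \<Longrightarrow> fst (single i n) j = (if j = i then n else \<one>\<^bsub>N\<^esub>)"
  and snd_single [simp]: "snd (single i n) = \<one>\<^bsub>K\<^esub>"
  by (simp_all add: single_def)

lemma single_closed [simp]: "n \<in> carrier N \<Longrightarrow> single i n \<in> carrier G"
proof -
  assume n: "n \<in> carrier N"
  have "support (fst (single i n)) \<subseteq> {i}"
    by (auto split: if_splits)
  then have "finite (support (fst (single i n)))"
    using finite_subset by blast
  then show ?thesis
    using n by (auto simp: carrier_G single_def)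
qed

lemma single_mult: "m \<in> carrier N \<Longrightarrow> n \<in> carrier N \<Longrightarrow>
    single i (m \<otimes>\<^bsub>N\<^esub> n) = single i m \<otimes>\<^bsub>G\<^esub> single i n"
  by (rule G_eqI) auto

lemma coordinate_embedding:
  assumes "i \<in> carrier K"
  shows "group_embedding N G (single i) (\<lambda>x. fst x i)"
proof unfold_locales
  show "single i \<in> hom N G"
    by (auto simp: hom_def single_mult)
qed (use assms in auto)

lemma single_commute:
  assumes "n \<in> carrier N" "x \<in> carrier G" "snd x = \<one>\<^bsub>K\<^esub>" "i \<in> carrier K" "fst x i = \<one>\<^bsub>N\<^esub>"
  shows "single i n \<otimes>\<^bsub>G\<^esub> x = x \<otimes>\<^bsub>G\<^esub> single i n"
  using assms by (intro G_eqI) auto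

text \<open>Elements of the base group split off one coordinate.\<close>

lemma split_coordinate:
  assumes x: "x \<in> carrier G" "snd x = \<one>\<^bsub>K\<^esub>" and i: "i \<in> carrier K"
  obtains y where "y \<in> carrier G" "snd y = \<one>\<^bsub>K\<^esub>" "fst y i = \<one>\<^bsub>N\<^esub>"
    "\<And>j. j \<in> carrier K \<Longrightarrow> j \<noteq> i \<Longrightarrow> fst y j = fst x j" "x = single i (fst x i) \<otimes>\<^bsub>G\<^esub> y"
proof -
  let ?y = "inv\<^bsub>G\<^esub> single i (fst x i) \<otimes>\<^bsub>G\<^esub> x"
  show ?thesis
  proof (rule that[of ?y])
    show "x = single i (fst x i) \<otimes>\<^bsub>G\<^esub> ?y"
      using x i by (simp add: G.m_assoc[symmetric])
  qed (use x i in auto)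
qed

text \<open>Conjugating an element \<open>x\<close> outside the base group by the elements of one coordinate moves it within a
  coset of the base group, to different places for different \<open>n\<close>: the coordinate \<open>i\<close> changes from \<open>x\<^sub>i\<close> to
  \<open>n x\<^sub>i\<close>, since \<open>n\<close> and \<open>n\<^sup>-\<^sup>1\<close> act at different coordinates. A state that is the canonical trace on the base
  group therefore sees these conjugates as orthonormal vectors.\<close>

lemma average_of_conjugates:
  assumes \<phi>: "G.cstar.state \<phi>"
    and base: "\<And>x. x \<in> carrier G \<Longrightarrow> snd x = \<one>\<^bsub>K\<^esub> \<Longrightarrow> x \<noteq> \<one>\<^bsub>G\<^esub> \<Longrightarrow> \<phi> (left_regular G x) = 0"
    and x: "x \<in> carrier G" "snd x \<noteq> \<one>\<^bsub>K\<^esub>" and i: "i \<in> carrier K" and F: "finite F" "F \<subseteq> carrier N"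
  shows "(cmod (\<Sum>n\<in>F. \<phi> (left_regular G (single i n \<otimes>\<^bsub>G\<^esub> x \<otimes>\<^bsub>G\<^esub> inv\<^bsub>G\<^esub> single i n))))\<^sup>2 \<le> card F"
proof -
  note pos = G.cstar.state_positive[OF \<phi>]
  define c where "c n = single i n \<otimes>\<^bsub>G\<^esub> x \<otimes>\<^bsub>G\<^esub> inv\<^bsub>G\<^esub> single i n" for n
  have FN: "n \<in> carrier N" if "n \<in> F" for n
    using that F by blast
  have c: "c n \<in> carrier G" if "n \<in> F" for n
    using FN[OF that] x by (simp add: c_def)
  have "inv\<^bsub>K\<^esub> (snd x) \<otimes>\<^bsub>K\<^esub> i \<noteq> i"
    using x i by (metis G_snd K.inv_closed K.inv_inv K.inv_one K.r_cancel_one)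
  then have fst_c: "fst (c n) i = n \<otimes>\<^bsub>N\<^esub> fst x i" and snd_c: "snd (c n) = snd x" if "n \<in> F" for n
    using FN[OF that] x i by (simp_all add: c_def)
  have "\<phi> (left_regular G (inv\<^bsub>G\<^esub> c m \<otimes>\<^bsub>G\<^esub> c n)) = (if m = n then 1 else 0)" if "m \<in> F" "n \<in> F" for m n
  proof (cases "m = n")
    case True
    then show ?thesis
      using c[OF that(1)] G.cstar.state_unit[OF \<phi>] by simp
  next
    case False
    have "c m \<noteq> c n"
      using fst_c that FN x i False by (metis G_fst N.right_cancel)
    then have "inv\<^bsub>G\<^esub> c m \<otimes>\<^bsub>G\<^esub> c n \<noteq> \<one>\<^bsub>G\<^esub>"
      using c that by (metis G.inv_closed G.inv_equality G.inv_inv)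
    then show ?thesis
      using base[of "inv\<^bsub>G\<^esub> c m \<otimes>\<^bsub>G\<^esub> c n"] c[OF that(1)] c[OF that(2)] snd_c that x False by simp
  qed
  note orth = this
  define X where "X = (\<Sum>n\<in>F. left_regular G (c n))"
  have X: "X \<in> reduced_cstar_algebra G"
    unfolding X_def using c by auto
  have "adj X = (\<Sum>m\<in>F. left_regular G (inv\<^bsub>G\<^esub> c m))"
    unfolding X_def using c by (subst G.cstar.adj_sum) auto
  then have "adj X \<star> X = (\<Sum>m\<in>F. \<Sum>n\<in>F. left_regular G (inv\<^bsub>G\<^esub> c m \<otimes>\<^bsub>G\<^esub> c n))"
    unfolding X_def
    by (simp add: bounded_bilinear.sum_right[OF bounded_bilinear_blinfun_compose]
        bounded_bilinear.sum_left[OF bounded_bilinear_blinfun_compose] G.left_regular_mult c)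
      (rule sum.swap)
  then have "\<phi> (adj X \<star> X) = (\<Sum>m\<in>F. \<Sum>n\<in>F. \<phi> (left_regular G (inv\<^bsub>G\<^esub> c m \<otimes>\<^bsub>G\<^esub> c n)))"
    using c by (simp add: G.cstar.positive_sum[OF pos])
  also have "\<dots> = of_nat (card F)"
    using F by (simp add: orth)
  finally have "\<phi> (adj X \<star> X) = of_nat (card F)" .
  then have "(cmod (\<phi> X))\<^sup>2 \<le> card F"
    using G.cstar.positive_Cauchy_Schwarz[OF pos G.cstar.unit_mem X] G.cstar.state_unit[OF \<phi>] X by simp
  then show ?thesis
    using c by (simp add: X_def c_def G.cstar.positive_sum[OF pos])
qed

end

subsection \<open>Infinite products of states\<close>

lemma norm_op_leI:
  fixes T :: "'x operator"
  assumes "\<And>\<xi> \<eta>. norm \<xi> \<le> 1 \<Longrightarrow> norm \<eta> \<le> 1 \<Longrightarrow> cmod (cinner (T \<xi>) \<eta>) \<le> C" and "C \<ge> 0"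
  shows "norm T \<le> C"
proof (rule norm_blinfun_bound[OF assms(2)])
  fix f
  show "norm (T f) \<le> C * norm f"
  proof (cases "f = 0 \<or> T f = 0")
    case True
    then show ?thesis
      using assms(2) by (auto simp: op_apply_simps)
  next
    case False
    define \<xi> where "\<xi> = (1 / norm f) *\<^sub>R f"
    define \<eta> where "\<eta> = complex_of_real (1 / norm (T f)) *\<^sub>C T f"
    have unit: "norm \<eta> \<le> 1" "norm \<xi> \<le> 1"
      using False unfolding \<eta>_def \<xi>_def norm_scaleC by (simp_all add: norm_divide)
    have "cinner (T \<xi>) \<eta> = of_real (1 / norm f * (1 / norm (T f) * (norm (T f))\<^sup>2))"
      unfolding \<xi>_def \<eta>_def blinfun.scaleR_right
      by (simp add: scaleR_ell2_def cinner_scaleC_left cinner_scaleC_right cinner_self_norm)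
    moreover have "1 / norm f * (1 / norm (T f) * (norm (T f))\<^sup>2) = norm (T f) / norm f"
      using False by (simp add: power2_eq_square)
    ultimately have "cmod (of_real (norm (T f) / norm f)) \<le> C"
      using assms(1)[OF unit(2,1)] by (simp only:)
    then have "norm (T f) / norm f \<le> C"
      by (simp add: norm_divide)
    then show ?thesis
      using False by (simp add: field_simps)
  qed
qed

lemma summable_on_prod_PiE:
  fixes f :: "'i \<Rightarrow> 'x \<Rightarrow> real"
  assumes fin: "finite J" and summable: "\<And>j. j \<in> J \<Longrightarrow> f j summable_on B j"
    and nonneg: "\<And>j x. 0 \<le> f j x"
  shows "(\<lambda>p. \<Prod>j\<in>J. f j (p j)) summable_on PiE J B"
proof (rule nonneg_bdd_above_summable_on)
  show "bdd_above (sum (\<lambda>p. \<Prod>j\<in>J. f j (p j)) ` {X. X \<subseteq> PiE J B \<and> finite X})"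
  proof (rule bdd_aboveI2)
    fix X assume "X \<in> {X. X \<subseteq> PiE J B \<and> finite X}"
    then have X: "X \<subseteq> PiE J B" "finite X"
      by auto
    let ?Y = "\<lambda>j. (\<lambda>p. p j) ` X"
    have "(\<Sum>p\<in>X. \<Prod>j\<in>J. f j (p j)) \<le> (\<Sum>p\<in>PiE J ?Y. \<Prod>j\<in>J. f j (p j))"
      using X fin by (intro sum_mono2 finite_PiE) (auto intro!: prod_nonneg nonneg simp: PiE_def)
    also have "\<dots> = (\<Prod>j\<in>J. \<Sum>x\<in>?Y j. f j x)"
      using X fin by (subst prod_sum_PiE) auto
    also have "\<dots> \<le> (\<Prod>j\<in>J. \<Sum>\<^sub>\<infinity>x\<in>B j. f j x)"
      using X by (intro prod_mono conjI sum_nonneg nonneg finite_sum_le_infsum summable)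
        (auto simp: PiE_iff subset_iff)
    finally show "(\<Sum>p\<in>X. \<Prod>j\<in>J. f j (p j)) \<le> (\<Prod>j\<in>J. \<Sum>\<^sub>\<infinity>x\<in>B j. f j x)" .
  qed
qed (auto intro: prod_nonneg nonneg)

text \<open>A state is dominated by the operator norm, hence by the functionals of unit vectors. A bound for all
  products of such functionals therefore holds for products of the state: the factors are exchanged one
  at a time, with the others absorbed into the coefficients.\<close>

lemma (in group) product_state_bound:
  fixes J :: "'j set"
  assumes \<phi>: "cstar.state \<phi>" and "finite J" "finite F" and C: "C \<ge> 0"
    and x: "\<And>s j. s \<in> F \<Longrightarrow> j \<in> J \<Longrightarrow> x s j \<in> carrier G"
    and bound: "\<And>\<xi> \<eta>. (\<And>j. norm (\<xi> j) \<le> 1) \<Longrightarrow> (\<And>j. norm (\<eta> j) \<le> 1) \<Longrightarrow>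
      cmod (\<Sum>s\<in>F. d s * (\<Prod>j\<in>J. cinner (left_regular G (x s j) (\<xi> j)) (\<eta> j))) \<le> C"
  shows "cmod (\<Sum>s\<in>F. d s * (\<Prod>j\<in>J. \<phi> (left_regular G (x s j)))) \<le> C"
  using \<open>finite J\<close> x bound
proof (induction J arbitrary: d)
  case empty
  show ?case
    using empty.prems(2)[of "\<lambda>_. 0" "\<lambda>_. 0"] by simp
next
  case (insert j J)
  note pos = cstar.state_positive[OF \<phi>]
  let ?e = "\<lambda>s. \<Prod>i\<in>J. \<phi> (left_regular G (x s i))"
  define T where "T = (\<Sum>s\<in>F. (d s * ?e s) *\<^sub>O left_regular G (x s j))"
  have T: "T \<in> A"
    unfolding T_def using insert.prems(1) by auto
  have "norm T \<le> C"
  proof (rule norm_op_leI[OF _ C])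
    fix \<xi>\<^sub>0 \<eta>\<^sub>0 :: "'a ell2" assume unit: "norm \<xi>\<^sub>0 \<le> 1" "norm \<eta>\<^sub>0 \<le> 1"
    let ?v = "\<lambda>s. cinner (left_regular G (x s j) \<xi>\<^sub>0) \<eta>\<^sub>0"
    have "cmod (\<Sum>s\<in>F. (d s * ?v s) * ?e s) \<le> C"
    proof (rule insert.IH)
      fix \<xi> \<eta> :: "'j \<Rightarrow> 'a ell2"
      assume "\<And>j. norm (\<xi> j) \<le> 1" "\<And>j. norm (\<eta> j) \<le> 1"
      then have "cmod (\<Sum>s\<in>F. d s * (\<Prod>i\<in>insert j J. cinner (left_regular G (x s i) ((\<xi>(j := \<xi>\<^sub>0)) i)) ((\<eta>(j := \<eta>\<^sub>0)) i))) \<le> C"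
        using unit by (intro insert.prems(2)) auto
      moreover have "(\<Prod>i\<in>J. cinner (left_regular G (x s i) ((\<xi>(j := \<xi>\<^sub>0)) i)) ((\<eta>(j := \<eta>\<^sub>0)) i))
          = (\<Prod>i\<in>J. cinner (left_regular G (x s i) (\<xi> i)) (\<eta> i))" for s
        using insert.hyps(2) by (intro prod.cong) auto
      ultimately show "cmod (\<Sum>s\<in>F. d s * ?v s * (\<Prod>i\<in>J. cinner (left_regular G (x s i) (\<xi> i)) (\<eta> i))) \<le> C"
        using insert.hyps by (simp add: mult.assoc)
    qed (use insert.prems(1) in auto)
    moreover have "cinner (T \<xi>\<^sub>0) \<eta>\<^sub>0 = (\<Sum>s\<in>F. (d s * ?v s) * ?e s)"
      unfolding T_def by (simp add: blinfun.sum_left cinner_sum_left scalar_op.rep_eq cinner_scaleC_left ac_simps)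
    ultimately show "cmod (cinner (T \<xi>\<^sub>0) \<eta>\<^sub>0) \<le> C"
      by simp
  qed
  then have "cmod (\<phi> T) \<le> C"
    using cstar.state_bounded[OF \<phi> T] by linarith
  moreover have "\<phi> T = (\<Sum>s\<in>F. d s * (\<Prod>i\<in>insert j J. \<phi> (left_regular G (x s i))))"
    unfolding T_def using insert.prems(1) insert.hyps
    by (simp add: cstar.positive_sum[OF pos] cstar.positive_linear[OF pos] ac_simps)
  ultimately show ?case
    by simp
qed

context wreath
begin

text \<open>For finitely many coordinates, a product of vector functionals of \<open>\<ell>\<^sup>2(N)\<close> is the functional of a product
  vector in \<open>\<ell>\<^sup>2(G)\<close>. As that vector is supported in the subgroup \<open>supported_in J\<close>, the functional vanishes
  at all other group elements, those outside the base group included.\<close>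

definition supported_in :: "'b set \<Rightarrow> (('b \<Rightarrow> 'a) \<times> 'b) set" where
  "supported_in J = {x \<in> carrier G. snd x = \<one>\<^bsub>K\<^esub> \<and> (\<forall>j\<in>carrier K - J. fst x j = \<one>\<^bsub>N\<^esub>)}"

definition product_vector :: "'b set \<Rightarrow> ('b \<Rightarrow> 'a ell2) \<Rightarrow> (('b \<Rightarrow> 'a) \<times> 'b) ell2" where
  "product_vector J \<xi> = Abs_ell2 (\<lambda>x. if x \<in> supported_in J then \<Prod>j\<in>J. ell2_apply (\<xi> j) (fst x j) else 0)"

lemma supported_in_mult:
  "x \<in> supported_in J \<Longrightarrow> y \<in> supported_in J \<Longrightarrow> x \<otimes>\<^bsub>G\<^esub> y \<in> supported_in J"
  by (auto simp: supported_in_def)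

lemma supported_in_inv: "x \<in> supported_in J \<Longrightarrow> inv\<^bsub>G\<^esub> x \<in> supported_in J"
  by (auto simp: supported_in_def)

lemma bij_supported_in:
  assumes J: "finite J" "J \<subseteq> carrier K"
  shows "bij_betw (\<lambda>p. ((\<lambda>j\<in>carrier K. if j \<in> J then p j else \<one>\<^bsub>N\<^esub>), \<one>\<^bsub>K\<^esub>))
    (J \<rightarrow>\<^sub>E carrier N) (supported_in J)" (is "bij_betw ?e _ _")
proof (rule bij_betw_byWitness[where f' = "\<lambda>x. restrict (fst x) J"])
  show "\<forall>p\<in>J \<rightarrow>\<^sub>E carrier N. restrict (fst (?e p)) J = p"
    using J by (auto simp: fun_eq_iff PiE_iff extensional_def)
  show "\<forall>x\<in>supported_in J. ?e (restrict (fst x) J) = x"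
    using J by (auto simp: supported_in_def carrier_G fun_eq_iff PiE_iff extensional_def)
  show "?e ` (J \<rightarrow>\<^sub>E carrier N) \<subseteq> supported_in J"
  proof
    fix x assume "x \<in> ?e ` (J \<rightarrow>\<^sub>E carrier N)"
    then obtain p where p: "p \<in> J \<rightarrow>\<^sub>E carrier N" "x = ?e p"
      by blast
    have "support (fst x) \<subseteq> J"
      using p by auto
    then have "finite (support (fst x))"
      using J finite_subset by blast
    then show "x \<in> supported_in J"
      using p J by (auto simp: supported_in_def carrier_G)
  qed
  show "(\<lambda>x. restrict (fst x) J) ` supported_in J \<subseteq> J \<rightarrow>\<^sub>E carrier N"
  proof (rule image_subsetI)
    fix x assume "x \<in> supported_in J"
    then show "restrict (fst x) J \<in> J \<rightarrow>\<^sub>E carrier N"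
      using J by (simp add: supported_in_def subset_iff)
  qed
qed

lemma infsum_supported_in:
  fixes f :: "'b \<Rightarrow> 'a \<Rightarrow> 'z :: {banach, real_normed_div_algebra, comm_semiring_1}"
  assumes J: "finite J" "J \<subseteq> carrier K" and f: "\<And>j. j \<in> J \<Longrightarrow> (\<lambda>n. norm (f j n)) summable_on carrier N"
  shows "(\<Sum>\<^sub>\<infinity>x\<in>supported_in J. \<Prod>j\<in>J. f j (fst x j)) = (\<Prod>j\<in>J. \<Sum>\<^sub>\<infinity>n\<in>carrier N. f j n)"
proof -
  have "(\<Sum>\<^sub>\<infinity>x\<in>supported_in J. \<Prod>j\<in>J. f j (fst x j)) = (\<Sum>\<^sub>\<infinity>p\<in>J \<rightarrow>\<^sub>E carrier N. \<Prod>j\<in>J. f j (p j))"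
    by (subst infsum_reindex_bij_betw[OF bij_supported_in[OF J], symmetric], intro infsum_cong prod.cong)
      (use J in auto)
  then show ?thesis
    by (simp add: infsum_prod_PiE_abs J f)
qed

lemma
  assumes J: "finite J" "J \<subseteq> carrier K"
  shows product_vector_apply: "ell2_apply (product_vector J \<xi>) x =
      (if x \<in> supported_in J then \<Prod>j\<in>J. ell2_apply (\<xi> j) (fst x j) else 0)"
    and norm_product_vector: "(\<And>j. norm (\<xi> j) \<le> 1) \<Longrightarrow> norm (product_vector J \<xi>) \<le> 1"
proof -
  have "(\<lambda>p. \<Prod>j\<in>J. (cmod (ell2_apply (\<xi> j) (p j)))\<^sup>2) summable_on (J \<rightarrow>\<^sub>E carrier N)"
    by (intro summable_on_prod_PiE J square_summable_ell2) auto
  also have "?this \<longleftrightarrow> (\<lambda>x. \<Prod>j\<in>J. (cmod (ell2_apply (\<xi> j) (fst x j)))\<^sup>2) summable_on supported_in J"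
    by (subst summable_on_reindex_bij_betw[OF bij_supported_in[OF J], symmetric], intro summable_on_cong prod.cong)
      (use J in auto)
  finally have "(\<lambda>x. (cmod (if x \<in> supported_in J then \<Prod>j\<in>J. ell2_apply (\<xi> j) (fst x j) else 0))\<^sup>2) summable_on UNIV"
    by (rule summable_on_cong_neutral[THEN iffD1, rotated -1])
      (auto simp: prod_norm[symmetric] prod_power_distrib)
  then show *: "ell2_apply (product_vector J \<xi>) x =
      (if x \<in> supported_in J then \<Prod>j\<in>J. ell2_apply (\<xi> j) (fst x j) else 0)" for x
    by (simp add: product_vector_def Abs_ell2_apply)
  assume unit: "\<And>j. norm (\<xi> j) \<le> 1"
  have "(norm (product_vector J \<xi>))\<^sup>2
      = (\<Sum>\<^sub>\<infinity>x\<in>supported_in J. \<Prod>j\<in>J. (cmod (ell2_apply (\<xi> j) (fst x j)))\<^sup>2)"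
    unfolding norm_ell2_square
    by (intro infsum_cong_neutral) (auto simp: * prod_norm[symmetric] prod_power_distrib)
  also have "\<dots> = (\<Prod>j\<in>J. \<Sum>\<^sub>\<infinity>n\<in>carrier N. (cmod (ell2_apply (\<xi> j) n))\<^sup>2)"
    using square_summable_ell2 by (intro infsum_supported_in J) auto
  also have "\<dots> \<le> (\<Prod>j\<in>J. (norm (\<xi> j))\<^sup>2)"
    unfolding norm_ell2_square
    by (intro prod_mono conjI infsum_nonneg infsum_mono2 square_summable_ell2) auto
  also have "\<dots> \<le> 1"
    using unit by (intro prod_le_1) (auto simp: power_le_one)
  finally show "norm (product_vector J \<xi>) \<le> 1"
    by (simp add: power_le_one_iff)
qed

lemma cinner_product_vector:
  assumes J: "finite J" "J \<subseteq> carrier K" and g: "g \<in> carrier G"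
  shows "cinner (left_regular G g (product_vector J \<xi>)) (product_vector J \<eta>) =
    (if g \<in> supported_in J then \<Prod>j\<in>J. cinner (left_regular N (fst g j) (\<xi> j)) (\<eta> j) else 0)"
proof (cases "g \<in> supported_in J")
  case False
  have "inv\<^bsub>G\<^esub> g \<otimes>\<^bsub>G\<^esub> x \<notin> supported_in J" if x: "x \<in> supported_in J" for x
  proof
    assume *: "inv\<^bsub>G\<^esub> g \<otimes>\<^bsub>G\<^esub> x \<in> supported_in J"
    have xG: "x \<in> carrier G"
      using x by (simp add: supported_in_def)
    have "inv\<^bsub>G\<^esub> (inv\<^bsub>G\<^esub> g \<otimes>\<^bsub>G\<^esub> x \<otimes>\<^bsub>G\<^esub> inv\<^bsub>G\<^esub> x) \<in> supported_in J"
      by (intro supported_in_inv supported_in_mult * x)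
    then show False
      using False g xG by (simp add: G.m_assoc)
  qed
  then show ?thesis
    using False g unfolding cinner.rep_eq
    by (subst infsum_0) (auto simp: product_vector_apply[OF J] G.left_regular_apply')
next
  case True
  let ?f = "\<lambda>j n. ell2_apply (left_regular N (fst g j) (\<xi> j)) n * cnj (ell2_apply (\<eta> j) n)"
  have gj: "fst g j \<in> carrier N" if "j \<in> J" for j
    using g J that by auto
  have summable: "(\<lambda>n. norm (?f j n)) summable_on carrier N" for j
  proof (rule summable_on_comparison_test)
    let ?h = "left_regular N (fst g j) (\<xi> j)"
    show "(\<lambda>n. (cmod (ell2_apply ?h n))\<^sup>2 + (cmod (ell2_apply (\<eta> j) n))\<^sup>2) summable_on carrier N"
      by (intro summable_on_add square_summable_ell2)
    show "norm (?f j n) \<le> (cmod (ell2_apply ?h n))\<^sup>2 + (cmod (ell2_apply (\<eta> j) n))\<^sup>2" for n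
      using sum_squares_bound[of "cmod (ell2_apply ?h n)" "cmod (ell2_apply (\<eta> j) n)"]
        mult_nonneg_nonneg[OF norm_ge_zero[of "ell2_apply ?h n"] norm_ge_zero[of "ell2_apply (\<eta> j) n"]]
      unfolding norm_mult complex_mod_cnj by linarith
  qed auto
  have "cinner (left_regular G g (product_vector J \<xi>)) (product_vector J \<eta>)
      = (\<Sum>\<^sub>\<infinity>x\<in>supported_in J. \<Prod>j\<in>J. ?f j (fst x j))"
    unfolding cinner.rep_eq
  proof (rule infsum_cong_neutral)
    fix x assume "x \<in> UNIV \<inter> supported_in J"
    then have x: "x \<in> supported_in J" "x \<in> carrier G"
      by (auto simp: supported_in_def)
    have "inv\<^bsub>G\<^esub> g \<otimes>\<^bsub>G\<^esub> x \<in> supported_in J"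
      by (intro supported_in_inv supported_in_mult x True)
    moreover have "fst (inv\<^bsub>G\<^esub> g \<otimes>\<^bsub>G\<^esub> x) j = inv\<^bsub>N\<^esub> fst g j \<otimes>\<^bsub>N\<^esub> fst x j" if "j \<in> J" for j
      using True x g J that by (auto simp: supported_in_def)
    ultimately show "ell2_apply (left_regular G g (product_vector J \<xi>)) x * cnj (ell2_apply (product_vector J \<eta>) x)
        = (\<Prod>j\<in>J. ?f j (fst x j))"
      using x g gj J by (simp add: product_vector_apply[OF J] G.left_regular_apply' N.left_regular_apply'
          prod.distrib subset_iff)
  qed (auto simp: product_vector_apply[OF J])
  also have "\<dots> = (\<Prod>j\<in>J. \<Sum>\<^sub>\<infinity>n\<in>carrier N. ?f j n)"
    by (intro infsum_supported_in J summable)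
  also have "\<dots> = (\<Prod>j\<in>J. cinner (left_regular N (fst g j) (\<xi> j)) (\<eta> j))"
    unfolding cinner.rep_eq
    by (intro prod.cong infsum_cong_neutral) (auto simp: N.left_regular_apply' gj)
  finally show ?thesis
    using True by simp
qed

definition product_values :: "('a operator \<Rightarrow> complex) \<Rightarrow> ('b \<Rightarrow> 'a) \<times> 'b \<Rightarrow> complex" where
  "product_values \<phi> x = (if snd x = \<one>\<^bsub>K\<^esub> then \<Prod>j\<in>support (fst x). \<phi> (left_regular N (fst x j)) else 0)"

lemma product_values_eq:
  assumes \<phi>: "N.cstar.state \<phi>" and J: "finite J" "J \<subseteq> carrier K" "support (fst x) \<subseteq> J"
    and "snd x = \<one>\<^bsub>K\<^esub>"
  shows "product_values \<phi> x = (\<Prod>j\<in>J. \<phi> (left_regular N (fst x j)))"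
proof -
  have "(\<Prod>j\<in>J. \<phi> (left_regular N (fst x j))) = (\<Prod>j\<in>support (fst x). \<phi> (left_regular N (fst x j)))"
    using J N.cstar.state_unit[OF \<phi>] by (intro prod.mono_neutral_right) auto
  then show ?thesis
    using assms by (simp add: product_values_def)
qed

lemma product_values_bound:
  assumes \<phi>: "N.cstar.state \<phi>" and F: "finite F" "F \<subseteq> carrier G"
  shows "cmod (\<Sum>g\<in>F. c g * product_values \<phi> g) \<le> norm (\<Sum>g\<in>F. c g *\<^sub>O left_regular G g)"
proof -
  define J where "J = (\<Union>g\<in>F. support (fst g))"
  have J: "finite J" "J \<subseteq> carrier K"
    using F G_finite by (auto simp: J_def)
  define F' where "F' = {g \<in> F. snd g = \<one>\<^bsub>K\<^esub>}"
  have F': "finite F'" "F' \<subseteq> F"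
    using F by (auto simp: F'_def)
  have supported: "g \<in> supported_in J \<longleftrightarrow> g \<in> F'" if "g \<in> F" for g
    using that F unfolding F'_def supported_in_def J_def by blast
  let ?T = "\<Sum>g\<in>F. c g *\<^sub>O left_regular G g"
  have "(\<Sum>g\<in>F. c g * product_values \<phi> g) = (\<Sum>g\<in>F'. c g * (\<Prod>j\<in>J. \<phi> (left_regular N (fst g j))))"
  proof (rule sum.mono_neutral_cong_right[OF F(1) F'(2)])
    show "\<forall>g\<in>F - F'. c g * product_values \<phi> g = 0"
      by (auto simp: F'_def product_values_def)
    fix g assume g: "g \<in> F'"
    then have "support (fst g) \<subseteq> J" "snd g = \<one>\<^bsub>K\<^esub>"
      by (auto simp: J_def F'_def)
    then show "c g * product_values \<phi> g = c g * (\<Prod>j\<in>J. \<phi> (left_regular N (fst g j)))"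
      using product_values_eq[OF \<phi> J] by simp
  qed
  moreover have "cmod (\<Sum>g\<in>F'. c g * (\<Prod>j\<in>J. \<phi> (left_regular N (fst g j)))) \<le> norm ?T"
  proof (rule N.product_state_bound[OF \<phi> J(1) F'(1) norm_ge_zero])
    show "fst s j \<in> carrier N" if "s \<in> F'" "j \<in> J" for s j
      using that F F' J by (intro G_fst) auto
    fix \<xi> \<eta> :: "'b \<Rightarrow> 'a ell2"
    assume unit: "\<And>j. norm (\<xi> j) \<le> 1" "\<And>j. norm (\<eta> j) \<le> 1"
    let ?\<xi> = "product_vector J \<xi>" and ?\<eta> = "product_vector J \<eta>"
    have "(\<Sum>g\<in>F'. c g * (\<Prod>j\<in>J. cinner (left_regular N (fst g j) (\<xi> j)) (\<eta> j)))
        = (\<Sum>g\<in>F. c g * cinner (left_regular G g ?\<xi>) ?\<eta>)"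
    proof (rule sum.mono_neutral_cong_left[OF F(1) F'(2)])
      show "\<forall>g\<in>F - F'. c g * cinner (left_regular G g ?\<xi>) ?\<eta> = 0"
        using F supported by (auto simp: cinner_product_vector[OF J])
      show "c g * (\<Prod>j\<in>J. cinner (left_regular N (fst g j) (\<xi> j)) (\<eta> j))
          = c g * cinner (left_regular G g ?\<xi>) ?\<eta>" if "g \<in> F'" for g
      proof -
        have "g \<in> supported_in J" "g \<in> carrier G"
          using that F F' supported[of g] by auto
        then show ?thesis
          by (simp add: cinner_product_vector[OF J])
      qed
    qed
    also have "\<dots> = cinner (?T ?\<xi>) ?\<eta>"
      by (simp add: blinfun.sum_left cinner_sum_left scalar_op.rep_eq cinner_scaleC_left)
    finally have "cmod (\<Sum>g\<in>F'. c g * (\<Prod>j\<in>J. cinner (left_regular N (fst g j) (\<xi> j)) (\<eta> j)))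
        \<le> norm (?T ?\<xi>) * norm ?\<eta>"
      by (simp add: cinner_Cauchy_Schwarz)
    also have "\<dots> \<le> norm ?T * norm ?\<xi> * norm ?\<eta>"
      by (intro mult_right_mono norm_blinfun) auto
    also have "\<dots> \<le> norm ?T * 1 * 1"
      by (intro mult_mono norm_product_vector[OF J] unit) auto
    finally show "cmod (\<Sum>g\<in>F'. c g * (\<Prod>j\<in>J. cinner (left_regular N (fst g j) (\<xi> j)) (\<eta> j))) \<le> norm ?T"
      by simp
  qed
  ultimately show ?thesis
    by simp
qed

lemma product_values_one [simp]: "product_values \<phi> \<one>\<^bsub>G\<^esub> = 1"
proof -
  have "support (fst \<one>\<^bsub>G\<^esub>) = {}"
    by auto
  then show ?thesis
    by (simp add: product_values_def del: Collect_empty_eq)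
qed

text \<open>The bound makes the assignment \<open>U\<^sub>g \<mapsto> product_values \<phi> g\<close> a contraction on linear combinations, which
  extends by the Hahn-Banach theorem; a contraction that is \<open>1\<close> at the unit is a state.\<close>

lemma exists_infinite_product_state:
  assumes \<phi>: "N.cstar.state \<phi>"
  obtains \<Phi> where "G.cstar.state \<Phi>" "\<And>g. g \<in> carrier G \<Longrightarrow> \<Phi> (left_regular G g) = product_values \<phi> g"
proof -
  define \<Gamma> where "\<Gamma> = {(\<Sum>g\<in>F. c g *\<^sub>O left_regular G g, \<Sum>g\<in>F. c g * product_values \<phi> g) |F c.
    finite F \<and> F \<subseteq> carrier G}"
  have \<Gamma>I: "(\<Sum>g\<in>F. c g *\<^sub>O left_regular G g, \<Sum>g\<in>F. c g * product_values \<phi> g) \<in> \<Gamma>"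
    if "finite F" "F \<subseteq> carrier G" for F c
    using that by (auto simp: \<Gamma>_def)
  obtain \<Phi> where \<Phi>: "\<And>S T. \<Phi> (S + T) = \<Phi> S + \<Phi> T" "\<And>c T. \<Phi> (c *\<^sub>O T) = c * \<Phi> T"
    "\<And>T. cmod (\<Phi> T) \<le> norm T" "\<And>T a. (T, a) \<in> \<Gamma> \<Longrightarrow> \<Phi> T = a"
  proof (rule hahn_banach_operators[of \<Gamma>])
    show "(0, 0) \<in> \<Gamma>"
      using \<Gamma>I[of "{}"] by simp
    fix S a T b assume "(S, a) \<in> \<Gamma>" "(T, b) \<in> \<Gamma>"
    then obtain F c F' c' where *: "finite F" "F \<subseteq> carrier G" "finite F'" "F' \<subseteq> carrier G"
      "S = (\<Sum>g\<in>F. c g *\<^sub>O left_regular G g)" "a = (\<Sum>g\<in>F. c g * product_values \<phi> g)"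
      "T = (\<Sum>g\<in>F'. c' g *\<^sub>O left_regular G g)" "b = (\<Sum>g\<in>F'. c' g * product_values \<phi> g)"
      unfolding \<Gamma>_def by blast
    define e where "e g = (if g \<in> F then c g else 0) + (if g \<in> F' then c' g else 0)" for g
    have "S = (\<Sum>g\<in>F \<union> F'. (if g \<in> F then c g else 0) *\<^sub>O left_regular G g)"
      "T = (\<Sum>g\<in>F \<union> F'. (if g \<in> F' then c' g else 0) *\<^sub>O left_regular G g)"
      "a = (\<Sum>g\<in>F \<union> F'. (if g \<in> F then c g else 0) * product_values \<phi> g)"
      "b = (\<Sum>g\<in>F \<union> F'. (if g \<in> F' then c' g else 0) * product_values \<phi> g)"
      unfolding * using *(1,3) by (auto intro!: sum.mono_neutral_cong_left)
    then have "S + T = (\<Sum>g\<in>F \<union> F'. e g *\<^sub>O left_regular G g)"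
      "a + b = (\<Sum>g\<in>F \<union> F'. e g * product_values \<phi> g)"
      by (simp_all add: e_def op_scale_add_left distrib_right sum.distrib)
    then show "(S + T, a + b) \<in> \<Gamma>"
      using \<Gamma>I[of "F \<union> F'" e] * by simp
  next
    fix d T a assume "(T, a) \<in> \<Gamma>"
    then obtain F c where *: "finite F" "F \<subseteq> carrier G"
      "T = (\<Sum>g\<in>F. c g *\<^sub>O left_regular G g)" "a = (\<Sum>g\<in>F. c g * product_values \<phi> g)"
      unfolding \<Gamma>_def by blast
    have "d *\<^sub>O T = (\<Sum>g\<in>F. (d * c g) *\<^sub>O left_regular G g)"
      unfolding * by (simp add: bounded_linear.linear[OF bounded_linear_op_scale] linear_sum)
    then show "(d *\<^sub>O T, d * a) \<in> \<Gamma>"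
      using \<Gamma>I[of F "\<lambda>g. d * c g"] * by (simp add: sum_distrib_left mult.assoc)
  next
    show "cmod a \<le> norm T" if "(T, a) \<in> \<Gamma>" for T a
      using that product_values_bound[OF \<phi>] by (auto simp: \<Gamma>_def)
  qed blast
  have \<Phi>_values: "\<Phi> (left_regular G g) = product_values \<phi> g" if "g \<in> carrier G" for g
    using \<Phi>(4)[OF \<Gamma>I[of "{g}" "\<lambda>_. 1"]] that by simp
  have "G.cstar.state \<Phi>"
    by (rule G.cstar.contractive_imp_positive) (simp_all add: \<Phi> \<Phi>_values)
  then show ?thesis
    using that \<Phi>_values by blast
qed

end


section \<open>The two properties pass to the factor\<close>

lemma (in unital_cstar) continuous_on_positive:
  assumes "positive_functional \<phi>" "continuous_on S X" "X ` S \<subseteq> A"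
  shows "continuous_on S (\<lambda>s. \<phi> (X s))"
  by (rule continuous_on_compose2[OF positive_continuous_on[OF assms(1)] assms(2,3)])

context wreath
begin

lemma product_values_single:
  assumes \<phi>: "N.cstar.state \<phi>" and "i \<in> carrier K" "n \<in> carrier N"
  shows "product_values \<phi> (single i n) = \<phi> (left_regular N n)"
proof -
  have "support (fst (single i n)) \<subseteq> {i}"
    by (auto split: if_splits)
  then have "product_values \<phi> (single i n) = (\<Prod>j\<in>{i}. \<phi> (left_regular N (fst (single i n) j)))"
    using assms(2) by (intro product_values_eq[OF \<phi>]) auto
  then show ?thesis
    using assms(2) by simp
qed

lemma support_mult:
  assumes "x \<in> carrier G" "y \<in> carrier G"
  shows "support (fst (x \<otimes>\<^bsub>G\<^esub> y)) \<subseteq> support (fst x) \<union> (\<lambda>j. snd x \<otimes>\<^bsub>K\<^esub> j) ` support (fst y)"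
proof
  fix j assume j: "j \<in> support (fst (x \<otimes>\<^bsub>G\<^esub> y))"
  let ?j = "inv\<^bsub>K\<^esub> snd x \<otimes>\<^bsub>K\<^esub> j"
  have "j = snd x \<otimes>\<^bsub>K\<^esub> ?j" "?j \<in> carrier K"
    using j assms by (simp_all add: K.m_assoc[symmetric])
  moreover have "fst x j \<noteq> \<one>\<^bsub>N\<^esub> \<or> fst y ?j \<noteq> \<one>\<^bsub>N\<^esub>"
    using j by auto
  ultimately show "j \<in> support (fst x) \<union> (\<lambda>j. snd x \<otimes>\<^bsub>K\<^esub> j) ` support (fst y)"
    using j by blast
qed

text \<open>If \<open>\<tau>\<close> is a trace on the factor, its infinite product is a class function: conjugation permutes the
  coordinates, and within one coordinate \<open>\<tau>\<close> does not see the order of the factors.\<close>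

lemma product_values_commute:
  assumes \<tau>: "N.cstar.state \<tau>"
    and trace: "\<And>m n. m \<in> carrier N \<Longrightarrow> n \<in> carrier N \<Longrightarrow>
      \<tau> (left_regular N (m \<otimes>\<^bsub>N\<^esub> n)) = \<tau> (left_regular N (n \<otimes>\<^bsub>N\<^esub> m))"
    and x: "x \<in> carrier G" and y: "y \<in> carrier G"
  shows "product_values \<tau> (x \<otimes>\<^bsub>G\<^esub> y) = product_values \<tau> (y \<otimes>\<^bsub>G\<^esub> x)"
proof (cases "snd x \<otimes>\<^bsub>K\<^esub> snd y = \<one>\<^bsub>K\<^esub>")
  case False
  then have "snd y \<otimes>\<^bsub>K\<^esub> snd x \<noteq> \<one>\<^bsub>K\<^esub>"
    using x y K.inv_comm[of "snd y" "snd x"] by auto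
  then show ?thesis
    using False by (simp add: product_values_def)
next
  case True
  define k where "k = snd x"
  have k: "k \<in> carrier K" "snd x = k" "snd y = inv\<^bsub>K\<^esub> k"
    using x y True K.inv_equality[OF K.inv_comm[OF True]] by (simp_all add: k_def)
  define J where "J = support (fst x) \<union> (\<lambda>j. k \<otimes>\<^bsub>K\<^esub> j) ` support (fst y)"
  define J' where "J' = (\<lambda>j. inv\<^bsub>K\<^esub> k \<otimes>\<^bsub>K\<^esub> j) ` J"
  have J: "finite J" "J \<subseteq> carrier K" "finite J'" "J' \<subseteq> carrier K"
    using x y k G_finite[OF x] G_finite[OF y] by (auto simp: J_def J'_def)
  have supp_xy: "support (fst (x \<otimes>\<^bsub>G\<^esub> y)) \<subseteq> J"
    using support_mult[OF x y] by (simp only: J_def k)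
  have "support (fst (y \<otimes>\<^bsub>G\<^esub> x)) \<subseteq> support (fst y) \<union> (\<lambda>j. inv\<^bsub>K\<^esub> k \<otimes>\<^bsub>K\<^esub> j) ` support (fst x)"
    using support_mult[OF y x] by (simp only: k)
  also have "support (fst y) \<subseteq> J'"
  proof
    fix j assume j: "j \<in> support (fst y)"
    then have "j = inv\<^bsub>K\<^esub> k \<otimes>\<^bsub>K\<^esub> (k \<otimes>\<^bsub>K\<^esub> j)"
      using k(1) by (simp add: K.m_assoc[symmetric])
    then show "j \<in> J'"
      using j unfolding J'_def J_def by blast
  qed
  also have "J' \<union> (\<lambda>j. inv\<^bsub>K\<^esub> k \<otimes>\<^bsub>K\<^esub> j) ` support (fst x) = J'"
    unfolding J'_def J_def by blast
  finally have supp_yx: "support (fst (y \<otimes>\<^bsub>G\<^esub> x)) \<subseteq> J'"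
    by blast
  have "product_values \<tau> (y \<otimes>\<^bsub>G\<^esub> x) = (\<Prod>j\<in>J'. \<tau> (left_regular N (fst (y \<otimes>\<^bsub>G\<^esub> x) j)))"
    using k by (intro product_values_eq[OF \<tau>] J supp_yx) simp
  also have "\<dots> = (\<Prod>j\<in>J. \<tau> (left_regular N (fst (y \<otimes>\<^bsub>G\<^esub> x) (inv\<^bsub>K\<^esub> k \<otimes>\<^bsub>K\<^esub> j))))"
    unfolding J'_def using J k by (subst prod.reindex) (auto simp: inj_on_def subset_iff)
  also have "\<dots> = (\<Prod>j\<in>J. \<tau> (left_regular N (fst (x \<otimes>\<^bsub>G\<^esub> y) j)))"
  proof (rule prod.cong[OF refl])
    fix j assume "j \<in> J"
    then have j: "j \<in> carrier K"
      using J by blast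
    have "fst (y \<otimes>\<^bsub>G\<^esub> x) (inv\<^bsub>K\<^esub> k \<otimes>\<^bsub>K\<^esub> j) = fst y (inv\<^bsub>K\<^esub> k \<otimes>\<^bsub>K\<^esub> j) \<otimes>\<^bsub>N\<^esub> fst x j"
      using j k by (simp add: K.m_assoc[symmetric])
    moreover have "fst (x \<otimes>\<^bsub>G\<^esub> y) j = fst x j \<otimes>\<^bsub>N\<^esub> fst y (inv\<^bsub>K\<^esub> k \<otimes>\<^bsub>K\<^esub> j)"
      using j k by simp
    ultimately show "\<tau> (left_regular N (fst (y \<otimes>\<^bsub>G\<^esub> x) (inv\<^bsub>K\<^esub> k \<otimes>\<^bsub>K\<^esub> j)))
        = \<tau> (left_regular N (fst (x \<otimes>\<^bsub>G\<^esub> y) j))"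
      using trace x y j k by simp
  qed
  also have "\<dots> = product_values \<tau> (x \<otimes>\<^bsub>G\<^esub> y)"
    using True by (intro product_values_eq[OF \<tau>, symmetric] J supp_xy) simp
  finally show ?thesis
    by simp
qed

lemma unique_trace_factor:
  assumes "unique_trace_property G"
  shows "unique_trace_property N"
  unfolding N.unique_trace_iff
proof (intro allI impI ballI)
  fix \<tau> n assume \<tau>: "tracial_state (reduced_cstar_algebra N) (left_regular N \<one>\<^bsub>N\<^esub>) \<tau>"
    and n: "n \<in> carrier N" "n \<noteq> \<one>\<^bsub>N\<^esub>"
  have trace: "\<tau> (left_regular N (l \<otimes>\<^bsub>N\<^esub> m)) = \<tau> (left_regular N (m \<otimes>\<^bsub>N\<^esub> l))"
    if "l \<in> carrier N" "m \<in> carrier N" for l m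
    using \<tau> that by (auto simp: N.tracial_state_iff simp flip: N.left_regular_mult)
  have state: "N.cstar.state \<tau>"
    using \<tau> by (simp add: N.tracial_state_iff)
  obtain \<Phi> where \<Phi>: "G.cstar.state \<Phi>" "\<And>g. g \<in> carrier G \<Longrightarrow> \<Phi> (left_regular G g) = product_values \<tau> g"
    using exists_infinite_product_state[OF state] by blast
  have "\<Phi> (S \<star> T) = \<Phi> (T \<star> S)" if "S \<in> reduced_cstar_algebra G" "T \<in> reduced_cstar_algebra G" for S T
    using that by (intro G.tracial_on_reduced[OF G.cstar.state_positive[OF \<Phi>(1)]])
      (simp_all add: \<Phi>(2) product_values_commute[OF state trace])
  then have "tracial_state (reduced_cstar_algebra G) (left_regular G \<one>\<^bsub>G\<^esub>) \<Phi>"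
    using \<Phi>(1) by (simp add: G.tracial_state_iff)
  moreover have "single \<one>\<^bsub>K\<^esub> n \<noteq> \<one>\<^bsub>G\<^esub>"
  proof
    assume "single \<one>\<^bsub>K\<^esub> n = \<one>\<^bsub>G\<^esub>"
    then have "fst (single \<one>\<^bsub>K\<^esub> n) \<one>\<^bsub>K\<^esub> = fst \<one>\<^bsub>G\<^esub> \<one>\<^bsub>K\<^esub>"
      by (simp only:)
    then show False
      using n(2) by simp
  qed
  ultimately have "\<Phi> (left_regular G (single \<one>\<^bsub>K\<^esub> n)) = 0"
    using assms n(1) by (simp add: G.unique_trace_iff)
  then show "\<tau> (left_regular N n) = 0"
    using n by (simp add: \<Phi>(2) product_values_single[OF state])
qed

text \<open>A state of the factor that vanishes on an ideal \<open>I\<close> has an infinite product that vanishes on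
  \<open>U\<^sub>s x U\<^sub>t\<close> for \<open>x\<close> in the copy of \<open>I\<close> at one coordinate: \<open>U\<^sub>s\<close> and \<open>U\<^sub>t\<close> move that copy to another coordinate
  and multiply it from both sides.\<close>

lemma cstar_simple_factor:
  assumes simple: "cstar_simple G"
  shows "cstar_simple N"
  unfolding N.cstar_simple_iff
proof (intro allI impI)
  fix I assume I: "closed_ideal I (reduced_cstar_algebra N)" and proper: "left_regular N \<one>\<^bsub>N\<^esub> \<notin> I"
  note I_simps = N.cstar.closed_idealD[OF I]
  obtain \<phi> where \<phi>: "N.cstar.state \<phi>" and \<phi>_I: "\<And>x. x \<in> I \<Longrightarrow> \<phi> x = 0"
    using N.cstar.exists_state_vanishing_on_ideal[OF I proper] by blast
  obtain \<Phi> where \<Phi>: "G.cstar.state \<Phi>" "\<And>g. g \<in> carrier G \<Longrightarrow> \<Phi> (left_regular G g) = product_values \<phi> g"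
    using exists_infinite_product_state[OF \<phi>] by blast
  note pos = G.cstar.state_positive[OF \<Phi>(1)] and \<phi>_pos = N.cstar.state_positive[OF \<phi>]
  interpret emb: group_embedding N G "single \<one>\<^bsub>K\<^esub>" "\<lambda>x. fst x \<one>\<^bsub>K\<^esub>"
    by (rule coordinate_embedding) simp
  have cont_lift: "continuous_on S emb.lift" for S
    by (rule linear_continuous_on[OF emb.bounded_linear_lift])
  have elements: "\<Phi> (left_regular G s \<star> emb.lift x \<star> left_regular G t) = 0"
    if x: "x \<in> I" and s: "s \<in> carrier G" and t: "t \<in> carrier G" for x s t
  proof -
    have mem: "left_regular G s \<star> emb.lift T \<star> left_regular G t \<in> reduced_cstar_algebra G"
      if "T \<in> reduced_cstar_algebra N" for T
      using that s t by simp
    have cont: "continuous_on (reduced_cstar_algebra N) (\<lambda>T. \<Phi> (left_regular G s \<star> emb.lift T \<star> left_regular G t))"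
      by (rule G.cstar.continuous_on_positive[OF pos])
        (use mem in \<open>auto intro!: continuous_on_compose_op cont_lift continuous_on_const\<close>)
    define y where "y n = s \<otimes>\<^bsub>G\<^esub> single \<one>\<^bsub>K\<^esub> n \<otimes>\<^bsub>G\<^esub> t" for n
    have y: "y n \<in> carrier G" if "n \<in> carrier N" for n
      using that s t by (simp add: y_def)
    have gen: "\<Phi> (left_regular G s \<star> emb.lift (c *\<^sub>O left_regular N n) \<star> left_regular G t)
        = c * product_values \<phi> (y n)" if "n \<in> carrier N" for n c
    proof -
      have "left_regular G s \<star> emb.lift (c *\<^sub>O left_regular N n) \<star> left_regular G t
          = c *\<^sub>O left_regular G (y n)"
        using s t that by (simp add: emb.lift_scale emb.lift_left_regular op_scale_compose
            G.left_regular_mult y_def)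
      then show ?thesis
        using \<Phi>(2) y[OF that] by (simp add: G.cstar.positive_linear[OF pos])
    qed
    show ?thesis
    proof (cases "snd s \<otimes>\<^bsub>K\<^esub> snd t = \<one>\<^bsub>K\<^esub>")
      case False
      then have zero: "product_values \<phi> (y n) = 0" if "n \<in> carrier N" for n
        using s t by (simp add: product_values_def y_def)
      show ?thesis
        by (rule N.vanishing_on_reduced[where f = "\<lambda>T. \<Phi> (left_regular G s \<star> emb.lift T \<star> left_regular G t)",
              OF cont _ _ I_simps(1)[OF x]])
          (use s t in \<open>simp_all add: zero gen emb.lift_add compose_distribs G.cstar.positive_linear[OF pos]\<close>)
    next
      case True
      define k where "k = snd s"
      define J where "J = insert k (support (fst s) \<union> (\<lambda>j. k \<otimes>\<^bsub>K\<^esub> j) ` support (fst t))"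
      define C where "C = (\<Prod>j\<in>J - {k}. \<phi> (left_regular N (fst s j \<otimes>\<^bsub>N\<^esub> fst t (inv\<^bsub>K\<^esub> k \<otimes>\<^bsub>K\<^esub> j))))"
      have k: "k \<in> carrier K" "snd s = k"
        using s by (simp_all add: k_def)
      have J: "finite J" "J \<subseteq> carrier K" "k \<in> J"
        using s t k G_finite[OF s] G_finite[OF t] by (auto simp: J_def)
      define a b where "a = fst s k" and "b = fst t \<one>\<^bsub>K\<^esub>"
      have ab: "a \<in> carrier N" "b \<in> carrier N"
        using s t k by (simp_all add: a_def b_def)
      have fst_y: "fst (y n) j = (if j = k then a \<otimes>\<^bsub>N\<^esub> n \<otimes>\<^bsub>N\<^esub> b else fst s j \<otimes>\<^bsub>N\<^esub> fst t (inv\<^bsub>K\<^esub> k \<otimes>\<^bsub>K\<^esub> j))"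
        if "n \<in> carrier N" "j \<in> carrier K" for n j
      proof -
        have "inv\<^bsub>K\<^esub> k \<otimes>\<^bsub>K\<^esub> j = \<one>\<^bsub>K\<^esub> \<longleftrightarrow> j = k"
          using k that by (metis K.inv_closed K.inv_equality K.inv_inv K.l_inv)
        then show ?thesis
          using that s t k by (auto simp: y_def a_def b_def)
      qed
      have values_y: "product_values \<phi> (y n) = C * \<phi> (left_regular N (a \<otimes>\<^bsub>N\<^esub> n \<otimes>\<^bsub>N\<^esub> b))"
        if n: "n \<in> carrier N" for n
      proof -
        have "support (fst (y n)) \<subseteq> J"
        proof
          fix j assume "j \<in> support (fst (y n))"
          then have j: "j \<in> carrier K" "fst (y n) j \<noteq> \<one>\<^bsub>N\<^esub>"
            by auto
          show "j \<in> J"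
          proof (cases "j = k")
            case False
            then have "fst (s \<otimes>\<^bsub>G\<^esub> t) j \<noteq> \<one>\<^bsub>N\<^esub>"
              using j fst_y[OF n j(1)] k by simp
            then show ?thesis
              using support_mult[OF s t] j(1) k by (auto simp: J_def simp del: fst_mult)
          qed (simp add: J_def)
        qed
        then have "product_values \<phi> (y n) = (\<Prod>j\<in>J. \<phi> (left_regular N (fst (y n) j)))"
          using True s t by (intro product_values_eq[OF \<phi> J(1,2)]) (simp_all add: y_def)
        also have "\<dots> = \<phi> (left_regular N (fst (y n) k)) * (\<Prod>j\<in>J - {k}. \<phi> (left_regular N (fst (y n) j)))"
          using J by (simp add: prod.remove)
        also have "(\<Prod>j\<in>J - {k}. \<phi> (left_regular N (fst (y n) j))) = C"
          unfolding C_def using J fst_y[OF n] by (intro prod.cong) (auto simp: subset_iff)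
        finally show ?thesis
          using fst_y[OF n k(1)] by simp
      qed
      let ?f = "\<lambda>T. \<Phi> (left_regular G s \<star> emb.lift T \<star> left_regular G t)
          - C * \<phi> (left_regular N a \<star> T \<star> left_regular N b)"
      have "?f x = 0"
      proof (rule N.vanishing_on_reduced[where f = ?f, OF _ _ _ I_simps(1)[OF x]])
        show "continuous_on (reduced_cstar_algebra N) ?f"
          by (intro continuous_on_diff cont continuous_on_mult continuous_on_const
              N.cstar.continuous_on_positive[OF \<phi>_pos])
            (use ab in \<open>auto intro!: continuous_on_compose_op continuous_intros\<close>)
        show "?f (S + T) = ?f S + ?f T"
          if "S \<in> reduced_cstar_algebra N" "T \<in> reduced_cstar_algebra N" for S T
          using that s t ab by (simp add: emb.lift_add compose_distribs G.cstar.positive_linear[OF pos]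
              N.cstar.positive_linear[OF \<phi>_pos] algebra_simps)
        show "?f (c *\<^sub>O left_regular N n) = 0" if "n \<in> carrier N" for n c
          using that ab by (simp add: gen values_y op_scale_compose N.left_regular_mult
              N.cstar.positive_linear[OF \<phi>_pos])
      qed
      moreover have "left_regular N a \<star> x \<star> left_regular N b \<in> I"
        using ab x I_simps(5,6) by simp
      ultimately show ?thesis
        using \<phi>_I by simp
    qed
  qed
  have ideal: "emb.lift x \<in> {T \<in> reduced_cstar_algebra G.
      \<forall>P\<in>reduced_cstar_algebra G. \<forall>R\<in>reduced_cstar_algebra G. \<Phi> (P \<star> T \<star> R) = 0}" if x: "x \<in> I" for x
  proof (intro CollectI conjI ballI)
    have lx: "emb.lift x \<in> reduced_cstar_algebra G"
      using I_simps(1)[OF x] by simp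
    then show "emb.lift x \<in> reduced_cstar_algebra G" .
    fix P R assume P: "P \<in> reduced_cstar_algebra G" and R: "R \<in> reduced_cstar_algebra G"
    have "\<Phi> (P \<star> emb.lift x \<star> left_regular G t) = 0" if "t \<in> carrier G" for t
    proof (rule G.vanishing_on_reduced[where f = "\<lambda>P. \<Phi> (P \<star> emb.lift x \<star> left_regular G t)", OF _ _ _ P])
      show "continuous_on (reduced_cstar_algebra G) (\<lambda>P. \<Phi> (P \<star> emb.lift x \<star> left_regular G t))"
        by (rule G.cstar.continuous_on_positive[OF pos])
          (use lx that in \<open>auto intro!: continuous_on_compose_op continuous_intros\<close>)
    qed (use lx that elements[OF x] in \<open>simp_all add: compose_distribs op_scale_compose G.cstar.positive_linear[OF pos]\<close>)
    note step = this
    show "\<Phi> (P \<star> emb.lift x \<star> R) = 0"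
    proof (rule G.vanishing_on_reduced[where f = "\<lambda>R. \<Phi> (P \<star> emb.lift x \<star> R)", OF _ _ _ R])
      show "continuous_on (reduced_cstar_algebra G) (\<lambda>R. \<Phi> (P \<star> emb.lift x \<star> R))"
        by (rule G.cstar.continuous_on_positive[OF pos])
          (use lx P in \<open>auto intro!: continuous_on_compose_op continuous_intros\<close>)
    qed (use lx P step in \<open>simp_all add: compose_distribs G.cstar.positive_linear[OF pos]\<close>)
  qed
  have "\<Phi> (left_regular G \<one>\<^bsub>G\<^esub> \<star> left_regular G \<one>\<^bsub>G\<^esub> \<star> left_regular G \<one>\<^bsub>G\<^esub>) \<noteq> 0"
    using G.cstar.state_unit[OF \<Phi>(1)] by simp
  then have "left_regular G \<one>\<^bsub>G\<^esub> \<notin> {T \<in> reduced_cstar_algebra G.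
      \<forall>P\<in>reduced_cstar_algebra G. \<forall>R\<in>reduced_cstar_algebra G. \<Phi> (P \<star> T \<star> R) = 0}"
    using G.cstar.unit_mem by blast
  then have "emb.lift x = 0" if "x \<in> I" for x
    using simple G.cstar.closed_ideal_vanishing[OF pos] ideal[OF that] unfolding G.cstar_simple_iff by blast
  then have "x = 0" if "x \<in> I" for x
    using emb.lift_eq_zero_iff[OF I_simps(1)[OF that]] that by blast
  then show "I = {0}"
    using I_simps(2) by blast
qed

end

section \<open>The two properties pass to the wreath product\<close>

lemma zero_if_bounded_multiples:
  fixes r :: real
  assumes "r \<ge> 0" "\<And>m::nat. real m * r \<le> 1"
  shows "r = 0"
proof (rule ccontr)
  assume "r \<noteq> 0"
  then have "r > 0"
    using assms(1) by simp
  then obtain m :: nat where "1 < real m * r"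
    using ex_less_of_nat_mult by blast
  then show False
    using assms(2)[of m] by simp
qed

lemma (in group) tracial_positive_vanishing:
  assumes unique: "unique_trace_property G" and f: "cstar.positive_functional f"
    and trace: "\<And>S T. S \<in> A \<Longrightarrow> T \<in> A \<Longrightarrow> f (S \<star> T) = f (T \<star> S)"
    and g: "g \<in> carrier G" "g \<noteq> \<one>"
  shows "f (left_regular G g) = 0"
proof (cases "f (left_regular G \<one>) = 0")
  case True
  then show ?thesis
    using cstar.positive_bounded[OF f, of "left_regular G g"] g by simp
next
  case False
  define r where "r = f (left_regular G \<one>)"
  have r: "r \<in> \<real>\<^sub>\<ge>\<^sub>0" "r \<noteq> 0"
    using cstar.positive_unit[OF f] False by (simp_all add: r_def)
  have "cstar.state (\<lambda>T. f T / r)"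
    using r(2) cstar.positive_nonneg[OF f] r(1) unfolding cstar.state_def cstar.positive_functional_def
    by (auto simp: cstar.positive_linear[OF f] add_divide_distrib r_def[symmetric] intro!: nonneg_Reals_divide_I)
  then have "tracial_state A (left_regular G \<one>) (\<lambda>T. f T / r)"
    by (simp add: tracial_state_iff trace)
  then show ?thesis
    using unique g r(2) unfolding unique_trace_iff by fastforce
qed

lemma (in group_embedding) lift_commute:
  assumes y: "y \<in> carrier G" and comm: "\<And>n. n \<in> carrier N \<Longrightarrow> \<theta> n \<otimes>\<^bsub>G\<^esub> y = y \<otimes>\<^bsub>G\<^esub> \<theta> n"
    and T: "T \<in> reduced_cstar_algebra N"
  shows "left_regular G y \<star> lift T = lift T \<star> left_regular G y"
proof -
  have "left_regular G y \<star> lift T - lift T \<star> left_regular G y = 0"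
  proof (rule N.vanishing_on_reduced[where f = "\<lambda>T. left_regular G y \<star> lift T - lift T \<star> left_regular G y", OF _ _ _ T])
    show "continuous_on (reduced_cstar_algebra N) (\<lambda>T. left_regular G y \<star> lift T - lift T \<star> left_regular G y)"
      by (intro continuous_on_diff continuous_on_compose_op continuous_on_const
          linear_continuous_on[OF bounded_linear_lift])
  qed (use y in \<open>simp_all add: lift_add lift_scale compose_distribs op_scale_compose lift_left_regular
      G.left_regular_mult comm\<close>)
  then show ?thesis
    by simp
qed

context wreath
begin

text \<open>For \<open>y\<close> in the base group with trivial coordinate \<open>i\<close>, the unitary \<open>u = U\<^sub>y\<close> commutes with the copy of the
  factor at \<open>i\<close>. Therefore \<open>T \<mapsto> \<tau>(X\<^sup>*TX)\<close> with \<open>X = 1 + cu\<close> is a positive trace on that copy, a multiple of the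
  canonical one, and polarisation in \<open>c\<close> gives \<open>\<tau>(U\<^sub>n u) = 0\<close>.\<close>

lemma trace_vanishing_on_coordinate:
  assumes unique: "unique_trace_property N"
    and \<tau>: "tracial_state (reduced_cstar_algebra G) (left_regular G \<one>\<^bsub>G\<^esub>) \<tau>"
    and i: "i \<in> carrier K" and n: "n \<in> carrier N" "n \<noteq> \<one>\<^bsub>N\<^esub>"
    and y: "y \<in> carrier G" "snd y = \<one>\<^bsub>K\<^esub>" "fst y i = \<one>\<^bsub>N\<^esub>"
  shows "\<tau> (left_regular G (single i n \<otimes>\<^bsub>G\<^esub> y)) = 0"
proof -
  interpret emb: group_embedding N G "single i" "\<lambda>x. fst x i"
    by (rule coordinate_embedding[OF i])
  have pos: "G.cstar.positive_functional \<tau>"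
    and trace: "\<And>S T. S \<in> reduced_cstar_algebra G \<Longrightarrow> T \<in> reduced_cstar_algebra G \<Longrightarrow> \<tau> (S \<star> T) = \<tau> (T \<star> S)"
    using \<tau> by (auto simp: G.tracial_state_iff G.cstar.state_def)
  let ?E = "left_regular G \<one>\<^bsub>G\<^esub>"
  define u where "u = left_regular G y"
  have u: "u \<in> reduced_cstar_algebra G" "adj u = left_regular G (inv\<^bsub>G\<^esub> y)" "adj u \<star> u = ?E"
    using y(1) by (simp_all add: u_def G.left_regular_mult)
  have comm_u: "u \<star> emb.lift T = emb.lift T \<star> u" if "T \<in> reduced_cstar_algebra N" for T
    unfolding u_def using that y i by (intro emb.lift_commute single_commute) auto
  have comm_adj: "adj u \<star> emb.lift T = emb.lift T \<star> adj u" if "T \<in> reduced_cstar_algebra N" for T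
    using arg_cong[OF comm_u[of "adj T"], of adj] that u(1) by (simp add: emb.adj_lift)
  define a where "a = emb.lift (left_regular N n)"
  have a: "a \<in> reduced_cstar_algebra G" "a = left_regular G (single i n)"
    using n by (simp_all add: a_def emb.lift_left_regular)
  have au: "adj u \<star> a \<star> u = a" "adj u \<star> a = a \<star> adj u"
    using comm_adj[of "left_regular N n"] n u(1,3) a(1) by (simp_all add: a_def compose_assoc)
  have zero: "2 * \<tau> a + c * \<tau> (a \<star> u) + cnj c * \<tau> (a \<star> adj u) = 0" if c: "cmod c = 1" for c
  proof -
    define X where "X = ?E + c *\<^sub>O u"
    have X: "X \<in> reduced_cstar_algebra G" "adj X = ?E + cnj c *\<^sub>O adj u"
      using u(1) by (simp_all add: X_def)
    have comm_X: "X \<star> emb.lift T = emb.lift T \<star> X" "adj X \<star> emb.lift T = emb.lift T \<star> adj X"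
      if "T \<in> reduced_cstar_algebra N" for T
      using that unfolding X(2) unfolding X_def
      by (simp_all add: compose_distribs op_scale_compose comm_u comm_adj)
    define f where "f T = \<tau> (adj X \<star> emb.lift T \<star> X)" for T
    have "N.cstar.positive_functional f"
      unfolding f_def by (intro emb.positive_functional_lift G.cstar.positive_compress pos X)
    moreover have "f (S \<star> T) = f (T \<star> S)"
      if S: "S \<in> reduced_cstar_algebra N" and T: "T \<in> reduced_cstar_algebra N" for S T
    proof -
      have ST: "emb.lift S \<in> reduced_cstar_algebra G" "emb.lift T \<in> reduced_cstar_algebra G"
        using S T by simp_all
      have "adj X \<star> emb.lift (S \<star> T) \<star> X = (adj X \<star> emb.lift S) \<star> (emb.lift T \<star> X)"
        using S T by (simp add: emb.lift_mult compose_assoc)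
      also have "\<dots> = (emb.lift S \<star> adj X) \<star> (X \<star> emb.lift T)"
        using S T by (simp only: comm_X)
      also have "\<dots> = emb.lift S \<star> (adj X \<star> X \<star> emb.lift T)"
        by (simp add: compose_assoc)
      finally have "f (S \<star> T) = \<tau> (emb.lift S \<star> (adj X \<star> X \<star> emb.lift T))"
        by (simp add: f_def)
      also have "\<dots> = \<tau> (adj X \<star> X \<star> emb.lift T \<star> emb.lift S)"
        using ST X(1) by (intro trace) simp_all
      also have "\<dots> = f (T \<star> S)"
        using S T by (simp add: f_def emb.lift_mult compose_assoc comm_X(1))
      finally show ?thesis .
    qed
    ultimately have "f (left_regular N n) = 0"
      using n by (intro N.tracial_positive_vanishing[OF unique]) auto
    moreover have "adj X \<star> a \<star> X = a + a + c *\<^sub>O (a \<star> u) + cnj c *\<^sub>O (a \<star> adj u)"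
      using a(1) u(1) au c complex_norm_square[of c] unfolding X(2) X_def
      by (simp add: compose_distribs op_scale_compose ac_simps)
    ultimately show ?thesis
      using a(1) u(1) by (simp add: f_def a_def[symmetric] G.cstar.positive_linear[OF pos])
  qed
  define \<alpha> \<beta> where "\<alpha> = \<tau> (a \<star> u)" and "\<beta> = \<tau> (a \<star> adj u)"
  have "2 * \<tau> a + (\<alpha> + \<beta>) = 0" "2 * \<tau> a - (\<alpha> + \<beta>) = 0" "2 * \<tau> a + \<i> * (\<alpha> - \<beta>) = 0"
    using zero[of 1] zero[of "-1"] zero[of \<i>] by (simp_all add: \<alpha>_def \<beta>_def algebra_simps)
  then have "\<tau> a = 0" "\<alpha> + \<beta> = 0"
    by algebra+
  then have "\<alpha> = \<beta>"
    using \<open>2 * \<tau> a + \<i> * (\<alpha> - \<beta>) = 0\<close> by simp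
  then have "\<alpha> = 0"
    using \<open>\<alpha> + \<beta> = 0\<close> by simp
  then show ?thesis
    using n(1) y(1) by (simp add: \<alpha>_def a(2) u_def G.left_regular_mult)
qed

lemma nontrivial_coordinate:
  assumes "x \<in> carrier G" "snd x = \<one>\<^bsub>K\<^esub>" "x \<noteq> \<one>\<^bsub>G\<^esub>"
  obtains i where "i \<in> carrier K" "fst x i \<noteq> \<one>\<^bsub>N\<^esub>"
  using assms G_eqI[of x "\<one>\<^bsub>G\<^esub>"] by auto

lemma unique_trace_wreath:
  assumes unique: "unique_trace_property N" and inf: "infinite (carrier N)"
  shows "unique_trace_property G"
  unfolding G.unique_trace_iff
proof (intro allI impI ballI)
  fix \<tau> x assume \<tau>: "tracial_state (reduced_cstar_algebra G) (left_regular G \<one>\<^bsub>G\<^esub>) \<tau>"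
    and x: "x \<in> carrier G" "x \<noteq> \<one>\<^bsub>G\<^esub>"
  have base: "\<tau> (left_regular G z) = 0" if z: "z \<in> carrier G" "snd z = \<one>\<^bsub>K\<^esub>" "z \<noteq> \<one>\<^bsub>G\<^esub>" for z
  proof -
    obtain i where i: "i \<in> carrier K" "fst z i \<noteq> \<one>\<^bsub>N\<^esub>"
      by (rule nontrivial_coordinate[OF z])
    obtain y where y: "y \<in> carrier G" "snd y = \<one>\<^bsub>K\<^esub>" "fst y i = \<one>\<^bsub>N\<^esub>" "z = single i (fst z i) \<otimes>\<^bsub>G\<^esub> y"
      by (rule split_coordinate[OF z(1,2) i(1)])
    show ?thesis
      using trace_vanishing_on_coordinate[OF unique \<tau> i(1) _ i(2) y(1-3)] z(1) i(1) y(4) by simp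
  qed
  show "\<tau> (left_regular G x) = 0"
  proof (cases "snd x = \<one>\<^bsub>K\<^esub>")
    case True
    then show ?thesis
      using base x by blast
  next
    case False
    have state: "G.cstar.state \<tau>"
      and trace: "\<And>S T. S \<in> reduced_cstar_algebra G \<Longrightarrow> T \<in> reduced_cstar_algebra G \<Longrightarrow> \<tau> (S \<star> T) = \<tau> (T \<star> S)"
      using \<tau> by (auto simp: G.tracial_state_iff)
    have conj: "\<tau> (left_regular G (h \<otimes>\<^bsub>G\<^esub> x \<otimes>\<^bsub>G\<^esub> inv\<^bsub>G\<^esub> h)) = \<tau> (left_regular G x)" if h: "h \<in> carrier G" for h
    proof -
      have "\<tau> (left_regular G (h \<otimes>\<^bsub>G\<^esub> x) \<star> left_regular G (inv\<^bsub>G\<^esub> h))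
          = \<tau> (left_regular G (inv\<^bsub>G\<^esub> h) \<star> left_regular G (h \<otimes>\<^bsub>G\<^esub> x))"
        using h x by (intro trace) simp_all
      then show ?thesis
        using h x by (simp add: G.left_regular_mult G.m_assoc[symmetric])
    qed
    have "real m * (cmod (\<tau> (left_regular G x)))\<^sup>2 \<le> 1" for m
    proof (cases "m = 0")
      case False
      obtain F where F: "finite F" "card F = m" "F \<subseteq> carrier N"
        using infinite_arbitrarily_large[OF inf] by blast
      have "(cmod (\<Sum>n\<in>F. \<tau> (left_regular G x)))\<^sup>2 \<le> card F"
      proof -
        have "(\<Sum>n\<in>F. \<tau> (left_regular G (single \<one>\<^bsub>K\<^esub> n \<otimes>\<^bsub>G\<^esub> x \<otimes>\<^bsub>G\<^esub> inv\<^bsub>G\<^esub> single \<one>\<^bsub>K\<^esub> n)))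
            = (\<Sum>n\<in>F. \<tau> (left_regular G x))"
          using F by (intro sum.cong conj) auto
        then show ?thesis
          using average_of_conjugates[OF state base x(1) \<open>snd x \<noteq> _\<close> K.one_closed F(1,3)] by simp
      qed
      then have "real m * (real m * (cmod (\<tau> (left_regular G x)))\<^sup>2) \<le> real m * 1"
        using F by (simp add: norm_mult power2_eq_square ac_simps)
      then show ?thesis
        using False by (simp only: mult_le_cancel_left_pos of_nat_0_less_iff)
    qed simp
    then have "(cmod (\<tau> (left_regular G x)))\<^sup>2 = 0"
      by (intro zero_if_bounded_multiples) auto
    then show ?thesis
      by simp
  qed
qed

text \<open>States vanishing on an ideal that agree with the canonical trace at the coordinates in \<open>J\<close>.\<close>

definition states_trivial_at ::
    "(('b \<Rightarrow> 'a) \<times> 'b) operator set \<Rightarrow> 'b set \<Rightarrow> ((('b \<Rightarrow> 'a) \<times> 'b) operator \<Rightarrow> complex) set" where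
  "states_trivial_at I J = G.cstar.states_vanishing_on I \<inter>
     {\<phi>. \<forall>x. x \<in> carrier G \<and> snd x = \<one>\<^bsub>K\<^esub> \<and> (\<exists>j\<in>J. fst x j \<noteq> \<one>\<^bsub>N\<^esub>) \<longrightarrow> \<phi> (left_regular G x) = 0}"

lemma states_trivial_atD:
  assumes "\<phi> \<in> states_trivial_at I J"
  shows "\<phi> \<in> G.cstar.states_vanishing_on I" "G.cstar.state \<phi>" "G.cstar.positive_functional \<phi>"
    "x \<in> carrier G \<Longrightarrow> snd x = \<one>\<^bsub>K\<^esub> \<Longrightarrow> j \<in> J \<Longrightarrow> fst x j \<noteq> \<one>\<^bsub>N\<^esub> \<Longrightarrow> \<phi> (left_regular G x) = 0"
proof -
  show state: "\<phi> \<in> G.cstar.states_vanishing_on I" "G.cstar.state \<phi>"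
    using assms by (simp_all add: states_trivial_at_def G.cstar.states_vanishing_on_def)
  show "G.cstar.positive_functional \<phi>"
    using state(2) by (rule G.cstar.state_positive)
  assume "x \<in> carrier G" "snd x = \<one>\<^bsub>K\<^esub>" "j \<in> J" "fst x j \<noteq> \<one>\<^bsub>N\<^esub>"
  then show "\<phi> (left_regular G x) = 0"
    using assms unfolding states_trivial_at_def by blast
qed

lemma compact_states_trivial_at: "compact (states_trivial_at I J)"
  unfolding states_trivial_at_def
  by (intro compact_Int_closed G.cstar.compact_states_vanishing_on closed_Collect_all closed_Collect_imp
      open_Collect_const closed_Collect_eq continuous_intros G.cstar.continuous_on_evaluation)

lemma compression_trivial_atI:
  assumes I: "closed_ideal I (reduced_cstar_algebra G)" and \<phi>: "\<phi> \<in> states_trivial_at I J"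
    and X: "X \<in> reduced_cstar_algebra G" and nz: "\<phi> (adj X \<star> X) \<noteq> 0"
    and vanish: "\<And>x j. x \<in> carrier G \<Longrightarrow> snd x = \<one>\<^bsub>K\<^esub> \<Longrightarrow> j \<in> J \<Longrightarrow> fst x j \<noteq> \<one>\<^bsub>N\<^esub> \<Longrightarrow>
      \<phi> (adj X \<star> left_regular G x \<star> X) = 0"
  shows "G.cstar.compression \<phi> X \<in> states_trivial_at I J"
  using G.cstar.states_vanishing_compression[OF I states_trivial_atD(1)[OF \<phi>] X nz] vanish
  by (auto simp: states_trivial_at_def G.cstar.compression_def)

text \<open>One more coordinate: the copy of the factor at \<open>i\<close> and the unitaries of the base group that are trivial
  at \<open>i\<close> and on \<open>J\<close> form a commuting pair, and compressions by elements of either keep the value \<open>0\<close> at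
  all \<open>x\<close> with a nontrivial coordinate in \<open>J\<close>, because they leave the coordinates in \<open>J\<close> unchanged.\<close>

lemma states_trivial_at_insert:
  assumes simple: "cstar_simple N" and I: "closed_ideal I (reduced_cstar_algebra G)"
    and ne: "states_trivial_at I J \<noteq> {}" and J: "J \<subseteq> carrier K" and i: "i \<in> carrier K" "i \<notin> J"
  shows "states_trivial_at I (insert i J) \<noteq> {}"
proof -
  interpret emb: group_embedding N G "single i" "\<lambda>x. fst x i"
    by (rule coordinate_embedding[OF i(1)])
  define Y where "Y = {y \<in> carrier G. snd y = \<one>\<^bsub>K\<^esub> \<and> fst y i = \<one>\<^bsub>N\<^esub> \<and> (\<forall>j\<in>J. fst y j = \<one>\<^bsub>N\<^esub>)}"
  interpret commuting_pair "reduced_cstar_algebra G" "left_regular G \<one>\<^bsub>G\<^esub>"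
    "reduced_cstar_algebra N" "left_regular N \<one>\<^bsub>N\<^esub>" emb.lift "left_regular G ` Y" "states_trivial_at I J"
  proof unfold_locales
    show "emb.lift (left_regular N \<one>\<^bsub>N\<^esub>) = left_regular G \<one>\<^bsub>G\<^esub>"
      by (rule emb.lift_one)
    fix u assume "u \<in> left_regular G ` Y"
    then obtain y where y: "y \<in> carrier G" "snd y = \<one>\<^bsub>K\<^esub>" "fst y i = \<one>\<^bsub>N\<^esub>" "\<And>j. j \<in> J \<Longrightarrow> fst y j = \<one>\<^bsub>N\<^esub>"
      and u: "u = left_regular G y"
      by (auto simp: Y_def)
    show "u \<in> reduced_cstar_algebra G"
      using y by (simp add: u)
    show "adj u \<star> u = left_regular G \<one>\<^bsub>G\<^esub>"
      using y by (simp add: u G.left_regular_mult)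
    show "u \<star> emb.lift b = emb.lift b \<star> u" if "b \<in> reduced_cstar_algebra N" for b
      unfolding u using that y i by (intro emb.lift_commute single_commute) auto
    fix \<phi> and c :: complex
    assume \<phi>: "\<phi> \<in> states_trivial_at I J"
      and nz: "\<phi> (adj (left_regular G \<one>\<^bsub>G\<^esub> + c *\<^sub>O u) \<star> (left_regular G \<one>\<^bsub>G\<^esub> + c *\<^sub>O u)) \<noteq> 0"
    note pos = states_trivial_atD(3)[OF \<phi>]
    show "G.cstar.compression \<phi> (left_regular G \<one>\<^bsub>G\<^esub> + c *\<^sub>O u) \<in> states_trivial_at I J"
    proof (rule compression_trivial_atI[OF I \<phi> _ nz])
      show "left_regular G \<one>\<^bsub>G\<^esub> + c *\<^sub>O u \<in> reduced_cstar_algebra G"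
        using y by (simp add: u)
      fix x j assume x: "x \<in> carrier G" "snd x = \<one>\<^bsub>K\<^esub>" "j \<in> J" "fst x j \<noteq> \<one>\<^bsub>N\<^esub>"
      have j: "j \<in> carrier K"
        using x(3) J by blast
      have vanish: "\<phi> (left_regular G z) = 0"
        if "z \<in> carrier G" "snd z = \<one>\<^bsub>K\<^esub>" "fst z j = fst x j" for z
        using states_trivial_atD(4)[OF \<phi> that(1,2) x(3)] that x(4) by simp
      have "adj (left_regular G \<one>\<^bsub>G\<^esub> + c *\<^sub>O u) \<star> left_regular G x \<star> (left_regular G \<one>\<^bsub>G\<^esub> + c *\<^sub>O u)
          = left_regular G x + c *\<^sub>O left_regular G (x \<otimes>\<^bsub>G\<^esub> y) + (cnj c *\<^sub>O left_regular G (inv\<^bsub>G\<^esub> y \<otimes>\<^bsub>G\<^esub> x)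
            + (c * cnj c) *\<^sub>O left_regular G (inv\<^bsub>G\<^esub> y \<otimes>\<^bsub>G\<^esub> x \<otimes>\<^bsub>G\<^esub> y))"
        using y(1) x(1) by (simp add: u compose_distribs op_scale_compose G.left_regular_mult op_scale_add_right
            mult.commute)
      moreover have "\<phi> (left_regular G x) = 0" "\<phi> (left_regular G (x \<otimes>\<^bsub>G\<^esub> y)) = 0"
        "\<phi> (left_regular G (inv\<^bsub>G\<^esub> y \<otimes>\<^bsub>G\<^esub> x)) = 0" "\<phi> (left_regular G (inv\<^bsub>G\<^esub> y \<otimes>\<^bsub>G\<^esub> x \<otimes>\<^bsub>G\<^esub> y)) = 0"
        using x j y by (auto intro!: vanish)
      ultimately show "\<phi> (adj (left_regular G \<one>\<^bsub>G\<^esub> + c *\<^sub>O u) \<star> left_regular G x \<star> (left_regular G \<one>\<^bsub>G\<^esub> + c *\<^sub>O u)) = 0"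
        using x y by (simp add: G.cstar.positive_linear[OF pos])
    qed
  next
    fix \<phi> b assume \<phi>: "\<phi> \<in> states_trivial_at I J" and b: "b \<in> reduced_cstar_algebra N"
      and nz: "\<phi> (adj (emb.lift b) \<star> emb.lift b) \<noteq> 0"
    note pos = states_trivial_atD(3)[OF \<phi>]
    have cont_lift: "continuous_on (reduced_cstar_algebra N) emb.lift"
      by (rule linear_continuous_on[OF emb.bounded_linear_lift])
    have cont_left: "continuous_on (reduced_cstar_algebra N) (\<lambda>a. \<phi> (emb.lift a \<star> P))"
      and cont_right: "continuous_on (reduced_cstar_algebra N) (\<lambda>a. \<phi> (P \<star> emb.lift a))"
      if "P \<in> reduced_cstar_algebra G" for P
      using that by (auto intro!: G.cstar.continuous_on_positive[OF pos] continuous_on_compose_op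
          continuous_on_const cont_lift)
    show "G.cstar.compression \<phi> (emb.lift b) \<in> states_trivial_at I J"
    proof (rule compression_trivial_atI[OF I \<phi> _ nz])
      show "emb.lift b \<in> reduced_cstar_algebra G"
        using b by simp
      fix x j assume x: "x \<in> carrier G" "snd x = \<one>\<^bsub>K\<^esub>" "j \<in> J" "fst x j \<noteq> \<one>\<^bsub>N\<^esub>"
      have j: "j \<in> carrier K" "j \<noteq> i"
        using x(3) J i by auto
      have elements: "\<phi> (left_regular G (single i m \<otimes>\<^bsub>G\<^esub> x \<otimes>\<^bsub>G\<^esub> single i n)) = 0"
        if "m \<in> carrier N" "n \<in> carrier N" for m n
        by (rule states_trivial_atD(4)[OF \<phi> _ _ x(3)]) (use that x j in auto)
      have "\<phi> (left_regular G (single i m) \<star> left_regular G x \<star> emb.lift b) = 0" if m: "m \<in> carrier N" for m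
        by (rule N.vanishing_on_reduced[where f = "\<lambda>b. \<phi> (left_regular G (single i m) \<star> left_regular G x \<star> emb.lift b)",
              OF cont_right _ _ b])
          (use m x(1) in \<open>simp_all add: compose_distribs emb.lift_add emb.lift_scale emb.lift_left_regular
            op_scale_compose G.left_regular_mult G.cstar.positive_linear[OF pos] elements\<close>)
      note step = this
      have "\<phi> (emb.lift (adj b) \<star> (left_regular G x \<star> emb.lift b)) = 0"
        by (rule N.vanishing_on_reduced[where f = "\<lambda>a. \<phi> (emb.lift a \<star> (left_regular G x \<star> emb.lift b))", OF cont_left])
          (use b x(1) step in \<open>simp_all add: compose_distribs emb.lift_add emb.lift_scale emb.lift_left_regular
            op_scale_compose G.cstar.positive_linear[OF pos] compose_assoc\<close>)
      then show "\<phi> (adj (emb.lift b) \<star> left_regular G x \<star> emb.lift b) = 0"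
        using b by (simp add: emb.adj_lift compose_assoc)
    qed
  next
    fix \<phi> \<psi> and t :: real
    assume *: "\<phi> \<in> states_trivial_at I J" "\<psi> \<in> states_trivial_at I J" "0 \<le> t" "t \<le> 1"
    show "(\<lambda>T. (1 - complex_of_real t) * \<phi> T + complex_of_real t * \<psi> T) \<in> states_trivial_at I J"
      unfolding states_trivial_at_def
      using * G.cstar.states_vanishing_convex[of \<phi> I \<psi> t] by (auto simp: states_trivial_at_def)
  qed (use compact_states_trivial_at states_trivial_atD in
      \<open>auto simp: emb.lift_add emb.lift_scale emb.lift_mult emb.adj_lift\<close>)
  obtain \<phi> where \<phi>: "\<phi> \<in> states_trivial_at I J"
    and product: "\<And>b u. b \<in> reduced_cstar_algebra N \<Longrightarrow> u \<in> left_regular G ` Y \<Longrightarrow>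
      \<phi> (emb.lift b \<star> u) = N.trace\<^sub>0 b * \<phi> u"
    using exists_product_state[OF ne _ N.trace0_state] simple unfolding cstar_simple_def by metis
  have "\<phi> (left_regular G x) = 0"
    if x: "x \<in> carrier G" "snd x = \<one>\<^bsub>K\<^esub>" and j: "j \<in> insert i J" "fst x j \<noteq> \<one>\<^bsub>N\<^esub>" for x j
  proof (cases "\<exists>j\<in>J. fst x j \<noteq> \<one>\<^bsub>N\<^esub>")
    case True
    then show ?thesis
      using states_trivial_atD(4)[OF \<phi> x] by blast
  next
    case False
    then have xi: "fst x i \<noteq> \<one>\<^bsub>N\<^esub>"
      using j by auto
    obtain y where y: "y \<in> carrier G" "snd y = \<one>\<^bsub>K\<^esub>" "fst y i = \<one>\<^bsub>N\<^esub>"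
      "\<And>j. j \<in> carrier K \<Longrightarrow> j \<noteq> i \<Longrightarrow> fst y j = fst x j" "x = single i (fst x i) \<otimes>\<^bsub>G\<^esub> y"
      by (rule split_coordinate[OF x i(1)]) blast
    have "fst y j = \<one>\<^bsub>N\<^esub>" if "j \<in> J" for j
      using y(4)[of j] False that J i by auto
    then have "y \<in> Y"
      using y by (simp add: Y_def)
    have "left_regular G x = left_regular G (single i (fst x i)) \<star> left_regular G y"
      using y(1,5) x i by (simp add: G.left_regular_mult)
    also have "\<dots> = emb.lift (left_regular N (fst x i)) \<star> left_regular G y"
      using x i by (simp add: emb.lift_left_regular)
    finally show ?thesis
      using product[of "left_regular N (fst x i)" "left_regular G y"] \<open>y \<in> Y\<close> x i xi
      by (simp add: N.trace0_left_regular)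
  qed
  then have "\<phi> \<in> states_trivial_at I (insert i J)"
    using states_trivial_atD(1)[OF \<phi>] unfolding states_trivial_at_def by blast
  then show ?thesis
    by blast
qed

text \<open>By compactness the canonical trace on the base group extends to a state vanishing on \<open>I\<close>.\<close>

lemma states_trivial_at_all:
  assumes simple: "cstar_simple N" and I: "closed_ideal I (reduced_cstar_algebra G)"
    and proper: "left_regular G \<one>\<^bsub>G\<^esub> \<notin> I"
  shows "states_trivial_at I (carrier K) \<noteq> {}"
proof -
  obtain \<phi> where \<phi>: "G.cstar.state \<phi>" "\<And>T. T \<in> I \<Longrightarrow> \<phi> T = 0"
    using G.cstar.exists_state_vanishing_on_ideal[OF I proper] by blast
  \<comment> \<open>the state from the Hahn-Banach theorem is defined on all operators\<close>
  have "(\<lambda>T. if T \<in> reduced_cstar_algebra G then \<phi> T else 0) \<in> states_trivial_at I {}"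
    using \<phi> by (simp add: states_trivial_at_def G.cstar.states_vanishing_on_def G.cstar.state_def
        G.cstar.positive_functional_def)
  then have empty: "states_trivial_at I {} \<noteq> {}"
    by blast
  have finite: "states_trivial_at I J \<noteq> {}" if "finite J" "J \<subseteq> carrier K" for J
    using that
  proof (induction J rule: finite_induct)
    case (insert i J)
    then show ?case
      by (intro states_trivial_at_insert[OF simple I]) auto
  qed (rule empty)
  let ?D = "\<lambda>j. {\<phi> :: (('b \<Rightarrow> 'a) \<times> 'b) operator \<Rightarrow> complex. \<forall>x. x \<in> carrier G \<and> snd x = \<one>\<^bsub>K\<^esub> \<and> fst x j \<noteq> \<one>\<^bsub>N\<^esub> \<longrightarrow> \<phi> (left_regular G x) = 0}"
  have eq: "states_trivial_at I J = G.cstar.states_vanishing_on I \<inter> (\<Inter>j\<in>J. ?D j)" for J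
    unfolding states_trivial_at_def by blast
  show ?thesis
    unfolding eq
  proof (rule compact_imp_fip_image[OF G.cstar.compact_states_vanishing_on])
    show "closed (?D j)" for j
      by (intro closed_Collect_all closed_Collect_imp open_Collect_const closed_Collect_eq continuous_intros
          G.cstar.continuous_on_evaluation)
    show "G.cstar.states_vanishing_on I \<inter> (\<Inter>j\<in>J. ?D j) \<noteq> {}" if "finite J" "J \<subseteq> carrier K" for J
      using finite[OF that] unfolding eq .
  qed
qed

text \<open>Averaging a state over its conjugates by elements of one coordinate preserves that it is canonical on
  the base group and vanishes on the ideal, and makes its values outside the base group small.\<close>

lemma average_state:
  assumes I: "closed_ideal I (reduced_cstar_algebra G)"
    and \<phi>: "\<phi> \<in> states_trivial_at I (carrier K)" and F: "finite F" "F \<noteq> {}" "F \<subseteq> carrier N"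
    and i: "i \<in> carrier K"
  shows "\<exists>\<psi>\<in>states_trivial_at I (carrier K). \<forall>x\<in>carrier G. snd x \<noteq> \<one>\<^bsub>K\<^esub> \<longrightarrow>
    card F * (cmod (\<psi> (left_regular G x)))\<^sup>2 \<le> 1"
proof -
  note pos = states_trivial_atD(3)[OF \<phi>] and I_simps = G.cstar.closed_idealD[OF I]
  define m where "m = real (card F)"
  have m: "m > 0"
    using F by (simp add: m_def card_gt_0_iff)
  define s where "s n = left_regular G (single i n)" for n
  have s: "s n \<in> reduced_cstar_algebra G" "adj (s n) = left_regular G (inv\<^bsub>G\<^esub> single i n)"
    "s n \<star> adj (s n) = left_regular G \<one>\<^bsub>G\<^esub>" if "n \<in> F" for n
    using that F by (auto simp: s_def G.left_regular_mult subset_iff)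
  define \<psi> where "\<psi> T = (if T \<in> reduced_cstar_algebra G
      then (\<Sum>n\<in>F. \<phi> (s n \<star> T \<star> adj (s n))) / of_real m else 0)" for T
  have compress: "G.cstar.positive_functional (\<lambda>T. \<phi> (s n \<star> T \<star> adj (s n)))" if "n \<in> F" for n
    using G.cstar.positive_compress[OF pos G.cstar.adj_mem[OF s(1)[OF that]]]
    unfolding G.cstar.adj_adj[OF s(1)[OF that]] .
  have "G.cstar.state \<psi>"
    unfolding G.cstar.state_def G.cstar.positive_functional_def
  proof (intro conjI ballI allI)
    fix S T assume ST: "S \<in> reduced_cstar_algebra G" "T \<in> reduced_cstar_algebra G"
    have "(\<Sum>n\<in>F. \<phi> (s n \<star> (S + T) \<star> adj (s n)))
        = (\<Sum>n\<in>F. \<phi> (s n \<star> S \<star> adj (s n)) + \<phi> (s n \<star> T \<star> adj (s n)))"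
      using ST by (intro sum.cong refl G.cstar.positive_add[OF compress])
    then show "\<psi> (S + T) = \<psi> S + \<psi> T"
      using ST by (simp add: \<psi>_def sum.distrib add_divide_distrib)
  next
    fix c T assume T: "T \<in> reduced_cstar_algebra G"
    have "(\<Sum>n\<in>F. \<phi> (s n \<star> (c *\<^sub>O T) \<star> adj (s n))) = (\<Sum>n\<in>F. c * \<phi> (s n \<star> T \<star> adj (s n)))"
      using T by (intro sum.cong refl G.cstar.positive_scale[OF compress])
    then show "\<psi> (c *\<^sub>O T) = c * \<psi> T"
      using T by (simp add: \<psi>_def sum_distrib_left)
  next
    fix T assume T: "T \<in> reduced_cstar_algebra G"
    have "(\<Sum>n\<in>F. \<phi> (s n \<star> (adj T \<star> T) \<star> adj (s n))) \<in> \<real>\<^sub>\<ge>\<^sub>0"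
      using F(1) G.cstar.positive_nonneg[OF compress T]
      by (auto simp: complex_nonneg_Reals_iff intro!: sum_nonneg)
    moreover have "complex_of_real m \<in> \<real>\<^sub>\<ge>\<^sub>0"
      using m by (simp add: complex_nonneg_Reals_iff)
    ultimately show "\<psi> (adj T \<star> T) \<in> \<real>\<^sub>\<ge>\<^sub>0"
      using T by (simp add: \<psi>_def nonneg_Reals_divide_I)
  next
    have "(\<Sum>n\<in>F. \<phi> (s n \<star> left_regular G \<one>\<^bsub>G\<^esub> \<star> adj (s n))) = (\<Sum>n\<in>F. 1)"
      using G.cstar.state_unit[OF states_trivial_atD(2)[OF \<phi>]] s by (intro sum.cong) auto
    then show "\<psi> (left_regular G \<one>\<^bsub>G\<^esub>) = 1"
      using m by (simp add: \<psi>_def m_def)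
  qed
  moreover have "\<psi> T = 0" if T: "T \<in> I" for T
  proof -
    have "\<phi> (s n \<star> T \<star> adj (s n)) = 0" if "n \<in> F" for n
      using states_trivial_atD(1)[OF \<phi>] I_simps(5,6) s(1)[OF that] T
      by (simp add: G.cstar.states_vanishing_on_def)
    then show ?thesis
      by (simp add: \<psi>_def)
  qed
  moreover have \<psi>_x: "\<psi> (left_regular G x)
      = (\<Sum>n\<in>F. \<phi> (left_regular G (single i n \<otimes>\<^bsub>G\<^esub> x \<otimes>\<^bsub>G\<^esub> inv\<^bsub>G\<^esub> single i n))) / of_real m"
    if x: "x \<in> carrier G" for x
  proof -
    have "s n \<star> left_regular G x \<star> adj (s n)
        = left_regular G (single i n \<otimes>\<^bsub>G\<^esub> x \<otimes>\<^bsub>G\<^esub> inv\<^bsub>G\<^esub> single i n)" if "n \<in> F" for n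
      unfolding s(2)[OF that] unfolding s_def using that F x by (auto simp: G.left_regular_mult subset_iff)
    then show ?thesis
      using x by (simp add: \<psi>_def)
  qed
  moreover have vanish: "\<phi> (left_regular G x) = 0"
    if x: "x \<in> carrier G" "snd x = \<one>\<^bsub>K\<^esub>" "x \<noteq> \<one>\<^bsub>G\<^esub>" for x
    by (rule nontrivial_coordinate[OF x]) (rule states_trivial_atD(4)[OF \<phi> x(1,2)])
  have "\<psi> (left_regular G x) = 0"
    if x: "x \<in> carrier G" "snd x = \<one>\<^bsub>K\<^esub>" "j \<in> carrier K" "fst x j \<noteq> \<one>\<^bsub>N\<^esub>" for x j
  proof -
    have "\<phi> (left_regular G (single i n \<otimes>\<^bsub>G\<^esub> x \<otimes>\<^bsub>G\<^esub> inv\<^bsub>G\<^esub> single i n)) = 0" if n: "n \<in> F" for n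
    proof (rule vanish)
      let ?h = "single i n"
      have h: "?h \<in> carrier G"
        using n F by auto
      show "?h \<otimes>\<^bsub>G\<^esub> x \<otimes>\<^bsub>G\<^esub> inv\<^bsub>G\<^esub> ?h \<in> carrier G"
        using h x by simp
      show "snd (?h \<otimes>\<^bsub>G\<^esub> x \<otimes>\<^bsub>G\<^esub> inv\<^bsub>G\<^esub> ?h) = \<one>\<^bsub>K\<^esub>"
        using h x by simp
      show "?h \<otimes>\<^bsub>G\<^esub> x \<otimes>\<^bsub>G\<^esub> inv\<^bsub>G\<^esub> ?h \<noteq> \<one>\<^bsub>G\<^esub>"
      proof
        assume "?h \<otimes>\<^bsub>G\<^esub> x \<otimes>\<^bsub>G\<^esub> inv\<^bsub>G\<^esub> ?h = \<one>\<^bsub>G\<^esub>"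
        then have "inv\<^bsub>G\<^esub> (inv\<^bsub>G\<^esub> ?h) = ?h \<otimes>\<^bsub>G\<^esub> x"
          using h x by (intro G.inv_equality) simp_all
        then have "x = \<one>\<^bsub>G\<^esub>"
          using h x by simp
        then show False
          using x by simp
      qed
    qed
    then show ?thesis
      using x by (simp add: \<psi>_x)
  qed
  ultimately have "\<psi> \<in> states_trivial_at I (carrier K)"
    by (auto simp: states_trivial_at_def G.cstar.states_vanishing_on_def \<psi>_def)
  moreover have "m * (cmod (\<psi> (left_regular G x)))\<^sup>2 \<le> 1" if x: "x \<in> carrier G" "snd x \<noteq> \<one>\<^bsub>K\<^esub>" for x
  proof -
    have "m * (cmod (\<psi> (left_regular G x)))\<^sup>2
        = (cmod (\<Sum>n\<in>F. \<phi> (left_regular G (single i n \<otimes>\<^bsub>G\<^esub> x \<otimes>\<^bsub>G\<^esub> inv\<^bsub>G\<^esub> single i n))))\<^sup>2 / m"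
      using m x(1) by (simp add: \<psi>_x norm_divide power_divide) (simp add: power2_eq_square)
    also have "\<dots> \<le> m / m"
      using average_of_conjugates[OF states_trivial_atD(2)[OF \<phi>] vanish x i F(1,3)] m
      by (intro divide_right_mono) (auto simp: m_def)
    finally show ?thesis
      using m by simp
  qed
  ultimately show ?thesis
    unfolding m_def by blast
qed

text \<open>By compactness, arbitrarily long averages have a limit among the states that vanish on \<open>I\<close>. This limit is
  the canonical trace of \<open>G\<close>, which is faithful.\<close>

lemma cstar_simple_wreath:
  assumes simple: "cstar_simple N" and inf: "infinite (carrier N)"
  shows "cstar_simple G"
  unfolding G.cstar_simple_iff
proof (intro allI impI)
  fix I assume I: "closed_ideal I (reduced_cstar_algebra G)" and proper: "left_regular G \<one>\<^bsub>G\<^esub> \<notin> I"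
  obtain \<phi> where \<phi>: "\<phi> \<in> states_trivial_at I (carrier K)"
    using states_trivial_at_all[OF simple I proper] by blast
  let ?D = "\<lambda>m::nat. {\<psi>. \<forall>x. x \<in> carrier G \<and> snd x \<noteq> \<one>\<^bsub>K\<^esub> \<longrightarrow>
    real m * (cmod (\<psi> (left_regular G x)))\<^sup>2 \<le> 1}"
  have "states_trivial_at I (carrier K) \<inter> (\<Inter>m\<in>UNIV. ?D m) \<noteq> {}"
  proof (rule compact_imp_fip_image[OF compact_states_trivial_at])
    show "closed (?D m)" for m
      by (intro closed_Collect_all closed_Collect_imp open_Collect_const closed_Collect_le continuous_intros
          G.cstar.continuous_on_evaluation)
    fix Q :: "nat set" assume "finite Q"
    \<comment> \<open>positive even if \<open>Q\<close> is empty or \<open>{0}\<close>, so that there is something to average over\<close>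
    define M where "M = Suc (Max (insert 0 Q))"
    have M: "m \<le> M" if "m \<in> Q" for m
      using that \<open>finite Q\<close> by (simp add: M_def le_SucI)
    obtain F where F: "finite F" "card F = M" "F \<subseteq> carrier N"
      using infinite_arbitrarily_large[OF inf] by blast
    have "F \<noteq> {}"
      using F(2) by (auto simp: M_def)
    obtain \<psi> where \<psi>: "\<psi> \<in> states_trivial_at I (carrier K)"
      and small: "\<And>x. x \<in> carrier G \<Longrightarrow> snd x \<noteq> \<one>\<^bsub>K\<^esub> \<Longrightarrow> real M * (cmod (\<psi> (left_regular G x)))\<^sup>2 \<le> 1"
      using average_state[OF I \<phi> F(1) \<open>F \<noteq> {}\<close> F(3) K.one_closed] unfolding F(2) by blast
    have "\<psi> \<in> ?D m" if "m \<in> Q" for m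
    proof -
      have "real m * (cmod (\<psi> (left_regular G x)))\<^sup>2 \<le> 1" if "x \<in> carrier G" "snd x \<noteq> \<one>\<^bsub>K\<^esub>" for x
        using small[OF that] M[OF \<open>m \<in> Q\<close>]
          mult_right_mono[of "real m" "real M" "(cmod (\<psi> (left_regular G x)))\<^sup>2"] by simp
      then show ?thesis
        by simp
    qed
    then have "\<psi> \<in> states_trivial_at I (carrier K) \<inter> (\<Inter>m\<in>Q. ?D m)"
      using \<psi> by blast
    then show "states_trivial_at I (carrier K) \<inter> (\<Inter>m\<in>Q. ?D m) \<noteq> {}"
      by blast
  qed
  then obtain \<psi> where \<psi>: "\<psi> \<in> states_trivial_at I (carrier K)"
    and small: "\<And>m x. x \<in> carrier G \<Longrightarrow> snd x \<noteq> \<one>\<^bsub>K\<^esub> \<Longrightarrow> real m * (cmod (\<psi> (left_regular G x)))\<^sup>2 \<le> 1"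
    by blast
  have "\<psi> (left_regular G x) = G.trace\<^sub>0 (left_regular G x)" if x: "x \<in> carrier G" for x
  proof -
    consider "x = \<one>\<^bsub>G\<^esub>" | "x \<noteq> \<one>\<^bsub>G\<^esub>" "snd x = \<one>\<^bsub>K\<^esub>" | "x \<noteq> \<one>\<^bsub>G\<^esub>" "snd x \<noteq> \<one>\<^bsub>K\<^esub>"
      by blast
    then show ?thesis
    proof cases
      case 1
      then show ?thesis
        using G.cstar.state_unit[OF states_trivial_atD(2)[OF \<psi>]] by (simp add: G.trace0_left_regular)
    next
      case 2
      obtain j where "j \<in> carrier K" "fst x j \<noteq> \<one>\<^bsub>N\<^esub>"
        by (rule nontrivial_coordinate[OF x 2(2,1)])
      then show ?thesis
        using states_trivial_atD(4)[OF \<psi> x 2(2)] 2 x by (simp add: G.trace0_left_regular)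
    next
      case 3
      have "(cmod (\<psi> (left_regular G x)))\<^sup>2 = 0"
        using small[OF x 3(2)] by (intro zero_if_bounded_multiples) auto
      then show ?thesis
        using 3 x by (simp add: G.trace0_left_regular)
    qed
  qed
  note eq = this
  have trace: "\<psi> T = G.trace\<^sub>0 T" if "T \<in> reduced_cstar_algebra G" for T
    by (rule G.positive_functional_eqI[OF states_trivial_atD(3)[OF \<psi>]
          G.cstar.state_positive[OF G.trace0_state] eq that])
  note I_simps = G.cstar.closed_idealD[OF I]
  have "T = 0" if T: "T \<in> I" for T
  proof (rule G.trace0_faithful[OF I_simps(1)[OF T]])
    have "adj T \<star> T \<in> I"
      using I_simps(1,5) T by simp
    then show "G.trace\<^sub>0 (adj T \<star> T) = 0"
      using trace[OF I_simps(1)] states_trivial_atD(1)[OF \<psi>] by (auto simp: G.cstar.states_vanishing_on_def)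
  qed
  then show "I = {0}"
    using I_simps(2) by blast
qed

end

theorem proposition5p5:
  fixes N :: "('a, 'c) monoid_scheme" and K :: "('b, 'd) monoid_scheme"
  assumes "group N" and "group K"
    and "carrier N \<noteq> {\<one>\<^bsub>N\<^esub>}" and "carrier K \<noteq> {\<one>\<^bsub>K\<^esub>}"
  shows "(cstar_simple (N \<wr> K) \<longleftrightarrow> cstar_simple N) \<and>
         (unique_trace_property (N \<wr> K) \<longleftrightarrow> unique_trace_property N)"
proof -
  interpret wreath N K
    using assms by (simp add: wreath_def)
  have "infinite (carrier N)" if "cstar_simple N \<or> unique_trace_property N"
    using that N.finite_not_cstar_simple N.finite_not_unique_trace assms(3) by blast
  then show ?thesis
    using cstar_simple_factor cstar_simple_wreath unique_trace_factor unique_trace_wreath by blast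
qed

end
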